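(* Let $a,b\in\mathbb{Z}_{\ge 0}\cup\{\infty\}$ with at least one of $a,b$ equal to $\infty$. Let $\mathfrak{g}=\mathfrak{osp}(2a|2b)$ (respectively, $\mathfrak{g}=\mathfrak{osp}(2a+1|2b)$). If $M$ is a bounded weight $\mathfrak{g}$-module, then the restriction of $M$ to $\mathfrak{o}(2a)$ (respectively, to $\mathfrak{o}(2a+1)$) is integrable and semisimple.
   Context: The ground field is $\mathbb{C}$; modules over Lie superalgebras are $\mathbb{Z}_2$-graded. For $\mathfrak{g}=\mathfrak{osp}(2a|2b)$ (respectively $\mathfrak{osp}(2a+1|2b)$) one has $\mathfrak{g}_{\bar 0}=\mathfrak{o}(2a)\oplus\mathfrak{sp}(2b)$ (respectively $\mathfrak{o}(2a+1)\oplus\mathfrak{sp}(2b)$), where infinite $a$ or $b$ means the corresponding direct limit of finite-dimensional orthosymplectic Lie superalgebras under the standard inclusions. $\mathfrak{g}$ is equipped with the standard (diagonal, splitting) Cartan subalgebra $\mathfrak{h}\subset\mathfrak{g}_{\bar 0}$, with even roots $\pm(\varepsilon_i\pm\varepsilon_k)$, $\pm(\delta_j\pm\delta_l)$, $\pm2\delta_j$ and odd roots $\pm(\varepsilon_i\pm\delta_j)$, plus even roots $\pm\varepsilon_i$ and odd roots $\pm\delta_j$ in the case $\mathfrak{osp}(2a+1|2b)$, for $1\le i\ne k\le a$, $1\le j\neq l\le b$. (For $a=\infty$ the two Lie superalgebras are isomorphic and differ by the choice of Cartan subalgebra.) A weight $\mathfrak{g}$-module is a $\mathfrak{g}$-module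 semisimple over $\mathfrak{h}$; it is bounded if there are $p,q\in\mathbb{Z}_{\ge0}$ such that every weight space has dimension $(d_0|d_1)$ with $d_0\le p$, $d_1\le q$. A module over a Lie algebra $\mathfrak{k}$ is integrable if every $k\in\mathfrak{k}$ acts locally finitely, i.e. $\dim\operatorname{span}\{m,km,k^2m,\dots\}<\infty$ for every vector $m$. *)

theory Defs
  imports Complex_Main "HOL-Library.Extended_Nat" "HOL-Library.Z2"
begin

section \<open>The orthosymplectic Lie superalgebras\<close>

text \<open>
  The natural module has the basis vectors \<open>e\<^sub>i, e\<^sub>-\<^sub>i\<close> (\<open>Eps i\<close>, \<open>Eps_neg i\<close>) and, only for
  \<open>osp(2a+1|2b)\<close>, \<open>e\<^sub>0\<close> (\<open>Eps_zero\<close>) in even degree, and \<open>f\<^sub>j, f\<^sub>-\<^sub>j\<close> (\<open>Del j\<close>, \<open>Del_neg j\<close>) in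
  odd degree. Indices start at 0, so \<open>i < a\<close> and \<open>j < b\<close>. Parities are elements of the
  two-element field \<^typ>\<open>bit\<close>.
\<close>

datatype osp_index = Eps nat | Eps_neg nat | Eps_zero | Del nat | Del_neg nat

datatype osp_type =
    Type_D  \<comment> \<open>\<open>osp(2a|2b)\<close>\<close>
  | Type_B  \<comment> \<open>\<open>osp(2a+1|2b)\<close>\<close>

fun in_range :: "osp_type \<Rightarrow> enat \<Rightarrow> enat \<Rightarrow> osp_index \<Rightarrow> bool" where
  "in_range X a b (Eps i) \<longleftrightarrow> enat i < a"
| "in_range X a b (Eps_neg i) \<longleftrightarrow> enat i < a"
| "in_range X a b Eps_zero \<longleftrightarrow> X = Type_B"
| "in_range X a b (Del j) \<longleftrightarrow> enat j < b"
| "in_range X a b (Del_neg j) \<longleftrightarrow> enat j < b"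

fun parity :: "osp_index \<Rightarrow> bit" where
  "parity (Eps i) = 0"
| "parity (Eps_neg i) = 0"
| "parity Eps_zero = 0"
| "parity (Del j) = 1"
| "parity (Del_neg j) = 1"

fun osp_form :: "osp_index \<Rightarrow> osp_index \<Rightarrow> complex" where
  "osp_form (Eps i) (Eps_neg k) = (if i = k then 1 else 0)"
| "osp_form (Eps_neg i) (Eps k) = (if i = k then 1 else 0)"
| "osp_form Eps_zero Eps_zero = 1"
| "osp_form (Del j) (Del_neg l) = (if j = l then 1 else 0)"
| "osp_form (Del_neg j) (Del l) = (if j = l then - 1 else 0)"
| "osp_form _ _ = 0"

definition koszul_sign :: "bit \<Rightarrow> bit \<Rightarrow> complex" where
  "koszul_sign p q = (if p = 1 \<and> q = 1 then - 1 else 1)"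

text \<open>
  A matrix \<open>A\<close> represents the operator \<open>e\<^sub>j \<mapsto> \<Sum>\<^sub>i A i j e\<^sub>i\<close>. For infinite \<open>a\<close> or \<open>b\<close> the
  direct limit of the finite-dimensional orthosymplectic superalgebras consists of the
  matrices with finitely many nonzero entries.
\<close>

type_synonym smatrix = "osp_index \<Rightarrow> osp_index \<Rightarrow> complex"

definition smult :: "smatrix \<Rightarrow> smatrix \<Rightarrow> smatrix" where
  "smult A B = (\<lambda>i j. \<Sum>k | A i k \<noteq> 0. A i k * B k j)"

text \<open>The superbracket of \<open>A\<close> of parity \<open>p\<close> and \<open>B\<close> of parity \<open>q\<close>.\<close>

definition superbracket :: "bit \<Rightarrow> bit \<Rightarrow> smatrix \<Rightarrow> smatrix \<Rightarrow> smatrix" where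
  "superbracket p q A B = (\<lambda>i j. smult A B i j - koszul_sign p q * smult B A i j)"

text \<open>
  The homogeneous component of parity \<open>p\<close>; the last condition is
  \<open>(A e\<^sub>j, e\<^sub>k) + (-1)\<^bsup>p|j|\<^esup> (e\<^sub>j, A e\<^sub>k) = 0\<close>.
\<close>

definition osp :: "osp_type \<Rightarrow> enat \<Rightarrow> enat \<Rightarrow> bit \<Rightarrow> smatrix set" where
  "osp X a b p = {A.
     finite {(i, j). A i j \<noteq> 0} \<and>
     (\<forall>i j. A i j \<noteq> 0 \<longrightarrow> in_range X a b i \<and> in_range X a b j \<and> parity i = parity j + p) \<and>
     (\<forall>j k. (\<Sum>i | A i j \<noteq> 0. A i j * osp_form i k)
          + koszul_sign p (parity j) * (\<Sum>i | A i k \<noteq> 0. osp_form j i * A i k) = 0)}"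

definition osp_cartan :: "osp_type \<Rightarrow> enat \<Rightarrow> enat \<Rightarrow> smatrix set" where
  "osp_cartan X a b = {H \<in> osp X a b 0. \<forall>i j. i \<noteq> j \<longrightarrow> H i j = 0}"

text \<open>The ideal \<open>o(2a)\<close>, respectively \<open>o(2a+1)\<close>, of the even part.\<close>

definition osp_orth :: "osp_type \<Rightarrow> enat \<Rightarrow> enat \<Rightarrow> smatrix set" where
  "osp_orth X a b = {A \<in> osp X a b 0. \<forall>i j. A i j \<noteq> 0 \<longrightarrow> parity i = 0 \<and> parity j = 0}"


section \<open>Modules\<close>

definition super_total :: "(bit \<Rightarrow> smatrix set) \<Rightarrow> smatrix set" where
  "super_total g = {(\<lambda>i j. A i j + B i j) | A B. A \<in> g 0 \<and> B \<in> g 1}"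

text \<open>
  A module over the matrix Lie superalgebra with homogeneous components \<open>g 0\<close>, \<open>g 1\<close>. The
  underlying vector space is the whole type, and \<open>M 0\<close>, \<open>M 1\<close> are its homogeneous
  components. The values of \<open>\<rho>\<close> outside \<open>super_total g\<close> are irrelevant.
\<close>

locale lie_supermodule = vector_space scale
  for scale :: "complex \<Rightarrow> 'm::ab_group_add \<Rightarrow> 'm" +
  fixes g :: "bit \<Rightarrow> smatrix set"
    and M :: "bit \<Rightarrow> 'm set"
    and \<rho> :: "smatrix \<Rightarrow> 'm \<Rightarrow> 'm"
  assumes grading_subspace: "subspace (M p)"
    and grading_disjoint: "M 0 \<inter> M 1 = {0}"
    and grading_sum: "\<exists>u\<in>M 0. \<exists>v\<in>M 1. m = u + v"
    and action_linear: "A \<in> super_total g \<Longrightarrow> Vector_Spaces.linear scale scale (\<rho> A)"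
    and action_add: "\<lbrakk>A \<in> super_total g; B \<in> super_total g\<rbrakk>
          \<Longrightarrow> \<rho> (\<lambda>i j. A i j + B i j) m = \<rho> A m + \<rho> B m"
    and action_scale: "A \<in> super_total g \<Longrightarrow> \<rho> (\<lambda>i j. c * A i j) m = scale c (\<rho> A m)"
    and action_parity: "\<lbrakk>A \<in> g p; m \<in> M q\<rbrakk> \<Longrightarrow> \<rho> A m \<in> M (p + q)"
    and action_bracket: "\<lbrakk>A \<in> g p; B \<in> g q\<rbrakk>
          \<Longrightarrow> \<rho> (superbracket p q A B) m
              = \<rho> A (\<rho> B m) - scale (koszul_sign p q) (\<rho> B (\<rho> A m))"

text \<open>
  In the following, \<open>\<kk>\<close> is a set of matrices forming a Lie subalgebra, acting through \<open>\<rho>\<close> on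
  the whole type, which carries the scalar multiplication \<open>scale\<close>.
\<close>

definition submodule :: "(complex \<Rightarrow> 'm::ab_group_add \<Rightarrow> 'm) \<Rightarrow> (smatrix \<Rightarrow> 'm \<Rightarrow> 'm)
    \<Rightarrow> smatrix set \<Rightarrow> 'm set \<Rightarrow> bool" where
  "submodule scale \<rho> \<kk> N \<longleftrightarrow>
     module.subspace scale N \<and> (\<forall>A\<in>\<kk>. \<forall>v\<in>N. \<rho> A v \<in> N)"

definition simple_submodule :: "(complex \<Rightarrow> 'm::ab_group_add \<Rightarrow> 'm) \<Rightarrow> (smatrix \<Rightarrow> 'm \<Rightarrow> 'm)
    \<Rightarrow> smatrix set \<Rightarrow> 'm set \<Rightarrow> bool" where
  "simple_submodule scale \<rho> \<kk> N \<longleftrightarrow>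
     submodule scale \<rho> \<kk> N \<and> N \<noteq> {0} \<and>
     (\<forall>N'. submodule scale \<rho> \<kk> N' \<and> N' \<subseteq> N \<longrightarrow> N' = {0} \<or> N' = N)"

text \<open>Semisimple: the sum of the simple submodules is everything.\<close>

definition semisimple_module :: "(complex \<Rightarrow> 'm::ab_group_add \<Rightarrow> 'm) \<Rightarrow> (smatrix \<Rightarrow> 'm \<Rightarrow> 'm)
    \<Rightarrow> smatrix set \<Rightarrow> bool" where
  "semisimple_module scale \<rho> \<kk> \<longleftrightarrow>
     module.span scale (\<Union>{N. simple_submodule scale \<rho> \<kk> N}) = UNIV"

text \<open>The dimension \<^const>\<open>vector_space.dim\<close> is a junk value on infinite-dimensional spaces,
  hence the separate notion of finite dimensionality.\<close>

definition finite_dim :: "(complex \<Rightarrow> 'm::ab_group_add \<Rightarrow> 'm) \<Rightarrow> 'm set \<Rightarrow> bool" where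
  "finite_dim scale V \<longleftrightarrow> (\<exists>B. finite B \<and> V \<subseteq> module.span scale B)"

definition integrable_module :: "(complex \<Rightarrow> 'm::ab_group_add \<Rightarrow> 'm) \<Rightarrow> (smatrix \<Rightarrow> 'm \<Rightarrow> 'm)
    \<Rightarrow> smatrix set \<Rightarrow> bool" where
  "integrable_module scale \<rho> \<kk> \<longleftrightarrow>
     (\<forall>A\<in>\<kk>. \<forall>m. finite_dim scale (module.span scale (range (\<lambda>n. (\<rho> A ^^ n) m))))"

text \<open>Linear functionals on \<open>\<hh>\<close>; their values outside \<open>\<hh>\<close> are irrelevant.\<close>

definition functionals :: "smatrix set \<Rightarrow> (smatrix \<Rightarrow> complex) set" where
  "functionals \<hh> = {\<mu>.
     (\<forall>A\<in>\<hh>. \<forall>B\<in>\<hh>. \<mu> (\<lambda>i j. A i j + B i j) = \<mu> A + \<mu> B) \<and>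
     (\<forall>c. \<forall>A\<in>\<hh>. \<mu> (\<lambda>i j. c * A i j) = c * \<mu> A)}"

definition weight_space :: "(complex \<Rightarrow> 'm::ab_group_add \<Rightarrow> 'm) \<Rightarrow> (smatrix \<Rightarrow> 'm \<Rightarrow> 'm)
    \<Rightarrow> smatrix set \<Rightarrow> (smatrix \<Rightarrow> complex) \<Rightarrow> 'm set" where
  "weight_space scale \<rho> \<hh> \<mu> = {m. \<forall>H\<in>\<hh>. \<rho> H m = scale (\<mu> H) m}"

definition weight_module :: "(complex \<Rightarrow> 'm::ab_group_add \<Rightarrow> 'm) \<Rightarrow> (smatrix \<Rightarrow> 'm \<Rightarrow> 'm)
    \<Rightarrow> smatrix set \<Rightarrow> bool" where
  "weight_module scale \<rho> \<hh> \<longleftrightarrow> semisimple_module scale \<rho> \<hh>"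

definition bounded_weight_module :: "(complex \<Rightarrow> 'm::ab_group_add \<Rightarrow> 'm)
    \<Rightarrow> (bit \<Rightarrow> 'm set) \<Rightarrow> (smatrix \<Rightarrow> 'm \<Rightarrow> 'm) \<Rightarrow> smatrix set \<Rightarrow> bool" where
  "bounded_weight_module scale M \<rho> \<hh> \<longleftrightarrow>
     weight_module scale \<rho> \<hh> \<and>
     (\<exists>d :: bit \<Rightarrow> nat. \<forall>\<mu>\<in>functionals \<hh>. \<forall>p.
        finite_dim scale (weight_space scale \<rho> \<hh> \<mu> \<inter> M p) \<and>
        vector_space.dim scale (weight_space scale \<rho> \<hh> \<mu> \<inter> M p) \<le> d p)"

end

theory Submission
  imports Defs "HOL-Library.Function_Algebras" "HOL-Analysis.Continuum_Not_Denumerable"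
    "HOL-Computational_Algebra.Fundamental_Theorem_Algebra"
begin

text \<open>
  Write \<open>u \<and> w\<close> for the root vector \<open>z \<mapsto> (w, z) u - (u, z) w\<close> and let \<open>k\<close> run through the
  infinitely many indices (\<open>\<epsilon>\<close> or \<open>\<delta>\<close>). For orthogonal even \<open>u\<close>, \<open>c\<close> with \<open>u\<close> isotropic, the products
  \<open>(u \<and> k)(u \<and> -k)\<close> all have the same weight, so boundedness forces linear relations between them on
  each weight vector. Commuting such a relation with \<open>(c \<and> -k)(c \<and> k)\<close>, and then with
  \<open>u \<and> k\<close>, yields \<open>e\<^sup>2 (u \<and> k\<^sub>1) \<dots> (u \<and> k\<^sub>r) = 0\<close> on the whole module for \<open>e = u \<and> c\<close> and large \<open>r\<close>, and
  further brackets with \<open>c \<and> -k\<^sub>i\<close> remove the factors: \<open>e\<close> is nilpotent. By \<open>sl\<^sub>2\<close>-theory the weights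
  are bounded in the \<open>\<epsilon>\<close>-directions, so the module is locally finite over each \<open>o(2n)\<close> or \<open>o(2n+1)\<close>,
  hence semisimple over it by the Casimir argument. Since the weight spaces have finite dimension,
  a stabilization argument passes to the union of these algebras.
\<close>

section \<open>Linear relations and nilpotency\<close>

text \<open>The multiplicity bound enters in two ways. Its uniformity gives one nilpotency exponent
  valid on the whole module, hence one bound for the coordinates of all weights, so that only
  finitely many weights occur in a coset of the lattice spanned by finitely many \<epsilon>_k.
  Finite dimension of single weight spaces then handles the infinite union: a module can be
  semisimple over each algebra of the chain without being semisimple over their union.

  The delicate point of the nilpotency argument is that a relation found on a vector v is also
  needed on (c \<and> -k)(c \<and> k) v, where k is the index to be isolated and is known only after
  the relation. The two factors carry opposite k-weights, so these vectors lie in one weight space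
  for all k, and a relation valid on a basis of it can be demanded in advance.

  Odd k are used if b is infinite, even ones otherwise. Since the Cartan subalgebra has infinite
  dimension, the existence of weights itself has to be derived from semisimplicity over it. The
  algebra o(2) has no roots and is treated apart.\<close>

lemma homogeneous_system:
  fixes \<phi> :: "'e \<Rightarrow> 'k \<Rightarrow> 'f::field"
  assumes "finite E" "finite K" "card E < card K"
  shows "\<exists>\<gamma>. (\<exists>k\<in>K. \<gamma> k \<noteq> 0) \<and> (\<forall>e\<in>E. (\<Sum>k\<in>K. \<gamma> k * \<phi> e k) = 0)"
  using assms
proof (induction E arbitrary: K \<phi> rule: finite_induct)
  case empty
  then have "K \<noteq> {}" by auto
  then show ?case by (intro exI[of _ "\<lambda>_. 1"]) auto
next
  case (insert e0 E)
  show ?case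
  proof (cases "\<forall>k\<in>K. \<phi> e0 k = 0")
    case True
    have "card E < card K" using insert by simp
    from insert.IH[OF insert.prems(1) this, of \<phi>] obtain \<gamma> where
      "(\<exists>k\<in>K. \<gamma> k \<noteq> 0)" "(\<forall>e\<in>E. (\<Sum>k\<in>K. \<gamma> k * \<phi> e k) = 0)" by blast
    then show ?thesis using True by (intro exI[of _ \<gamma>]) auto
  next
    case False
    then obtain k0 where k0: "k0 \<in> K" "\<phi> e0 k0 \<noteq> 0" by blast
    define K' where "K' = K - {k0}"
    \<comment> \<open>Gaussian elimination: equation \<open>e0\<close> is solved for the unknown at
      \<open>k0\<close> and substituted into the others.\<close>
    define \<phi>' where "\<phi>' = (\<lambda>e k. \<phi> e k - \<phi> e k0 * \<phi> e0 k / \<phi> e0 k0)"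
    have fin: "finite K'" and card: "card E < card K'"
      using insert k0 by (auto simp: K'_def)
    from insert.IH[OF this, of \<phi>'] obtain \<gamma> where
      \<gamma>: "\<exists>k\<in>K'. \<gamma> k \<noteq> 0" "\<And>e. e \<in> E \<Longrightarrow> (\<Sum>k\<in>K'. \<gamma> k * \<phi>' e k) = 0" by blast
    define \<gamma>' where "\<gamma>' = \<gamma>(k0 := - (\<Sum>k\<in>K'. \<gamma> k * \<phi> e0 k) / \<phi> e0 k0)"
    have split: "(\<Sum>k\<in>K. \<gamma>' k * \<phi> e k) = \<gamma>' k0 * \<phi> e k0 + (\<Sum>k\<in>K'. \<gamma> k * \<phi> e k)" for e
    proof -
      have "(\<Sum>k\<in>K'. \<gamma>' k * \<phi> e k) = (\<Sum>k\<in>K'. \<gamma> k * \<phi> e k)"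
        by (rule sum.cong) (auto simp: \<gamma>'_def K'_def)
      moreover have "(\<Sum>k\<in>K. \<gamma>' k * \<phi> e k) = \<gamma>' k0 * \<phi> e k0 + (\<Sum>k\<in>K'. \<gamma>' k * \<phi> e k)"
        unfolding K'_def using insert.prems(1) k0(1) by (rule sum.remove)
      ultimately show ?thesis by simp
    qed
    have "(\<Sum>k\<in>K. \<gamma>' k * \<phi> e0 k) = 0"
      unfolding split using k0(2) by (simp add: \<gamma>'_def)
    moreover have "(\<Sum>k\<in>K. \<gamma>' k * \<phi> e k) = 0" if "e \<in> E" for e
    proof -
      have "0 = (\<Sum>k\<in>K'. \<gamma> k * \<phi> e k - (\<gamma> k * \<phi> e0 k) * (\<phi> e k0 / \<phi> e0 k0))"
        using \<gamma>(2)[OF that] by (simp add: \<phi>'_def algebra_simps)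
      also have "\<dots> = (\<Sum>k\<in>K'. \<gamma> k * \<phi> e k) - (\<Sum>k\<in>K'. \<gamma> k * \<phi> e0 k) * (\<phi> e k0 / \<phi> e0 k0)"
        by (simp add: sum_subtractf sum_distrib_right del: times_divide_eq_right)
      finally show ?thesis unfolding split by (simp add: \<gamma>'_def)
    qed
    moreover have "\<exists>k\<in>K. \<gamma>' k \<noteq> 0" using \<gamma>(1) by (auto simp: \<gamma>'_def K'_def)
    ultimately show ?thesis by (intro exI[of _ \<gamma>']) auto
  qed
qed

context vector_space
begin

lemma linearI_rules:
  assumes "\<And>v w. f (v + w) = f v + f w" "\<And>c v. f (scale c v) = scale c (f v)"
  shows "Vector_Spaces.linear scale scale f"
  using assms vector_space_axioms
  by (simp add: Vector_Spaces.linear_def module_hom_def module_hom_axioms_def vector_space_def module_def)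

lemma linear_rules:
  assumes "Vector_Spaces.linear scale scale f"
  shows "f (v + w) = f v + f w" "f (scale c v) = scale c (f v)" "f 0 = 0" "f (- v) = - f v"
    "f (v - w) = f v - f w" "f (sum g A) = (\<Sum>i\<in>A. f (g i))"
proof -
  interpret f: Vector_Spaces.linear scale scale f by fact
  show "f (v + w) = f v + f w" "f (scale c v) = scale c (f v)" "f 0 = 0" "f (- v) = - f v"
    "f (v - w) = f v - f w" "f (sum g A) = (\<Sum>i\<in>A. f (g i))"
    by (simp_all add: f.add f.scale f.zero f.neg f.diff f.sum)
qed

text \<open>A vector in \<open>span (B i)\<close> imposes \<open>card (B i)\<close> scalar
  equations, so one choice of coefficients serves all \<open>i\<close> at once when the unknowns
  outnumber the equations.\<close>

lemma common_relation:
  assumes "finite I" "finite K" "\<And>i. i \<in> I \<Longrightarrow> finite (B i)"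
    and "\<And>i k. i \<in> I \<Longrightarrow> k \<in> K \<Longrightarrow> u k i \<in> span (B i)"
    and "(\<Sum>i\<in>I. card (B i)) < card K"
  shows "\<exists>\<gamma>. (\<exists>k\<in>K. \<gamma> k \<noteq> 0) \<and> (\<forall>i\<in>I. (\<Sum>k\<in>K. scale (\<gamma> k) (u k i)) = 0)"
proof -
  have "\<exists>c. \<forall>i k. i \<in> I \<longrightarrow> k \<in> K \<longrightarrow> u k i = (\<Sum>b\<in>B i. scale (c i k b) b)"
  proof -
    have "\<exists>c. i \<in> I \<longrightarrow> k \<in> K \<longrightarrow> u k i = (\<Sum>b\<in>B i. scale (c b) b)" for i k
      using assms(3,4)[of i] span_finite[of "B i"] by (cases "i \<in> I \<and> k \<in> K") auto
    then show ?thesis by metis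
  qed
  then obtain c where c: "\<And>i k. i \<in> I \<Longrightarrow> k \<in> K \<Longrightarrow> u k i = (\<Sum>b\<in>B i. scale (c i k b) b)"
    by blast
  have "finite (Sigma I B)" "card (Sigma I B) < card K" using assms by auto
  from homogeneous_system[OF this(1) assms(2) this(2), of "\<lambda>(i, b) k. c i k b"]
  obtain \<gamma> where \<gamma>: "\<exists>k\<in>K. \<gamma> k \<noteq> 0"
    "\<And>i b. i \<in> I \<Longrightarrow> b \<in> B i \<Longrightarrow> (\<Sum>k\<in>K. \<gamma> k * c i k b) = 0" by auto
  have "(\<Sum>k\<in>K. scale (\<gamma> k) (u k i)) = 0" if "i \<in> I" for i
  proof -
    have "(\<Sum>k\<in>K. scale (\<gamma> k) (u k i)) = (\<Sum>k\<in>K. \<Sum>b\<in>B i. scale (\<gamma> k * c i k b) b)"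
      using that by (simp add: c scale_sum_right)
    also have "\<dots> = (\<Sum>b\<in>B i. scale (\<Sum>k\<in>K. \<gamma> k * c i k b) b)"
      by (subst sum.swap) (simp add: scale_sum_left)
    finally show ?thesis using \<gamma>(2)[OF that] by simp
  qed
  with \<gamma>(1) show ?thesis by blast
qed

end

text \<open>Instantiated below by \<open>x k = u \<and> k\<close>, \<open>y k = u \<and> -k\<close>, \<open>p k = c \<and> -k\<close>, \<open>q k = c \<and> k\<close>, \<open>e = u \<and> c\<close>; the
  sign \<open>\<sigma>\<close> is \<open>1\<close> (commutators) for even and \<open>- 1\<close> (anticommutators) for odd \<open>k\<close>. No relation between
  \<open>p\<close> and \<open>q\<close> is needed, which also covers the non-isotropic \<open>c = e\<^sub>0\<close>.\<close>

locale heisenberg_action = vector_space scale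
  for scale :: "complex \<Rightarrow> 'm::ab_group_add \<Rightarrow> 'm" +
  fixes W :: "'w::ab_group_add \<Rightarrow> 'm set" and D :: nat
    and x y p q :: "nat \<Rightarrow> 'm \<Rightarrow> 'm" and e :: "'m \<Rightarrow> 'm"
    and \<sigma> \<alpha> \<beta> \<theta> :: complex and \<xi> \<eta> :: 'w and \<kappa> :: "nat \<Rightarrow> 'w"
  assumes W_dim: "\<exists>B. finite B \<and> card B \<le> D \<and> W \<mu> \<subseteq> span B"
    and W_span: "span (\<Union>\<mu>. W \<mu>) = UNIV"
    and lin: "Vector_Spaces.linear scale scale (x k)" "Vector_Spaces.linear scale scale (y k)"
      "Vector_Spaces.linear scale scale (p k)" "Vector_Spaces.linear scale scale (q k)"
      "Vector_Spaces.linear scale scale e"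
    and wt: "v \<in> W \<mu> \<Longrightarrow> x k v \<in> W (\<mu> + (\<xi> + \<kappa> k))" "v \<in> W \<mu> \<Longrightarrow> y k v \<in> W (\<mu> + (\<xi> - \<kappa> k))"
      "v \<in> W \<mu> \<Longrightarrow> p k v \<in> W (\<mu> + (\<eta> - \<kappa> k))" "v \<in> W \<mu> \<Longrightarrow> q k v \<in> W (\<mu> + (\<eta> + \<kappa> k))"
    and \<sigma>: "\<sigma> = 1 \<or> \<sigma> = - 1" and \<alpha>: "\<alpha> \<noteq> 0" and \<beta>: "\<beta> \<noteq> 0"
    and xx: "x j (x k v) = scale \<sigma> (x k (x j v))"
    and yx: "y j (x k v) = scale \<sigma> (x k (y j v))"
    and px: "p j (x k v) = scale \<sigma> (x k (p j v)) + (if j = k then scale \<alpha> (e v) else 0)"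
    and py: "p j (y k v) = scale \<sigma> (y k (p j v))"
    and qx: "q j (x k v) = scale \<sigma> (x k (q j v))"
    and qy: "q j (y k v) = scale \<sigma> (y k (q j v)) + (if j = k then scale \<beta> (e v) else 0)"
    and ex: "e (x k v) = x k (e v)"
    and ey: "e (y k v) = y k (e v)"
    and ep: "e (p k v) = p k (e v) + scale \<theta> (y k v)"
begin

lemma lin_simps:
  "x k (v + w) = x k v + x k w" "x k (scale c v) = scale c (x k v)" "x k 0 = 0" "x k (- v) = - x k v"
  "y k (v + w) = y k v + y k w" "y k (scale c v) = scale c (y k v)" "y k 0 = 0" "y k (- v) = - y k v"
  "p k (v + w) = p k v + p k w" "p k (scale c v) = scale c (p k v)" "p k 0 = 0" "p k (- v) = - p k v"
  "q k (v + w) = q k v + q k w" "q k (scale c v) = scale c (q k v)" "q k 0 = 0" "q k (- v) = - q k v"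
  "e (v + w) = e v + e w" "e (scale c v) = scale c (e v)" "e 0 = 0" "e (- v) = - e v"
  using lin by (simp_all add: linear_rules)

lemma \<sigma>_sq: "\<sigma> * \<sigma> = 1" using \<sigma> by auto

text \<open>The commutator of \<open>p k q k\<close> with \<open>x k y k\<close>. For j \<noteq> k,
  \<open>p k q k\<close> commutes with \<open>x j y j\<close>, so commuting it with a linear
  combination of these products isolates one multiple of \<open>z k\<close>.\<close>

definition z :: "nat \<Rightarrow> 'm \<Rightarrow> 'm" where
  "z k v = p k (q k (x k (y k v))) - x k (y k (p k (q k v)))"

text \<open>Moving \<open>q k\<close> and \<open>p k\<close> to the right, each meets one partner
  and produces \<open>e\<close> once: \<open>q k\<close> from \<open>y k\<close>, \<open>p k\<close>
  from \<open>x k\<close>.\<close>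

lemma z_eq: "z k v = scale \<alpha> (e (y k (q k v))) + scale (\<sigma> * \<beta>) (p k (x k (e v)))"
  unfolding z_def using \<sigma> by (auto simp: lin_simps px py qx qy ex ey algebra_simps)

lemma z_x_same: "z k (x k v) = x k (z k v) + scale (\<alpha> * \<beta>) (e (e (x k v)))"
proof -
  \<comment> \<open>For odd \<open>k\<close> the operator \<open>x k\<close> anticommutes with
    itself, hence squares to zero.\<close>
  have "x k (x k v) = 0" if "\<sigma> = - 1" for v
  proof -
    have "x k (x k v) = - x k (x k v)" using xx[of k k v] that by simp
    then have "x k (x k v) + x k (x k v) = 0" by (simp only: eq_neg_iff_add_eq_0)
    then have "scale 2 (x k (x k v)) = 0" using scale_left_distrib[of 1 1 "x k (x k v)"] by simp
    then show ?thesis by (simp del: scale_eq_0_iff add: scale_eq_0_iff)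
  qed
  then show ?thesis
    unfolding z_eq using \<sigma> by (auto simp: lin_simps px py qx qy yx ex ey algebra_simps)
qed

lemma z_x_other: "j \<noteq> k \<Longrightarrow> z j (x k v) = x k (z j v)"
  unfolding z_eq using \<sigma> xx[of j k]
  by (auto simp: lin_simps px py qx qy yx ex ey algebra_simps)


text \<open>A relation between the \<open>x j y j\<close> is required on \<open>v\<close> (D
  equations) and on a basis of \<open>W \<nu>\<close>, which contains \<open>p k (q k v)\<close> for
  every \<open>k\<close> (D * D equations). Its commutator with \<open>p k q k\<close> leaves
  \<gamma> k times \<open>z k v\<close>, for an index with \<gamma> k \<noteq> 0.\<close>

lemma good_index:
  assumes v: "v \<in> W \<mu>" and K: "finite K" "D + D * D < card K"
  shows "\<exists>k\<in>K. z k v = 0"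
proof -
  define \<nu> where "\<nu> = \<mu> + (\<eta> + \<eta>)"
  define \<omega> where "\<omega> = \<xi> + \<xi>"
  obtain B where B: "finite B" "card B \<le> D" "W \<nu> \<subseteq> span B" using W_dim by blast
  obtain B\<^sub>0 where B\<^sub>0: "finite B\<^sub>0" "card B\<^sub>0 \<le> D" "W (\<mu> + \<omega>) \<subseteq> span B\<^sub>0" using W_dim by blast
  obtain B\<^sub>1 where B\<^sub>1: "finite B\<^sub>1" "card B\<^sub>1 \<le> D" "W (\<nu> + \<omega>) \<subseteq> span B\<^sub>1" using W_dim by blast
  obtain B' where B': "B' \<subseteq> W \<nu>" "independent B'" "W \<nu> \<subseteq> span B'"
    using basis_exists by metis
  have fin': "finite B'" and card': "card B' \<le> D"
    using independent_span_bound[OF B(1) B'(2)] subset_trans[OF B'(1) B(3)] B(2) by auto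
  have xy: "x k (y k w) \<in> W (\<mu>' + \<omega>)" if "w \<in> W \<mu>'" for w \<mu>' k
    using wt(1)[OF wt(2)[OF that, of k], of k] by (simp add: \<omega>_def algebra_simps)
  have pq: "p k (q k v) \<in> W \<nu>" for k
    using wt(3)[OF wt(4)[OF v, of k], of k] by (simp add: \<nu>_def algebra_simps)
  \<comment> \<open>\<open>None\<close> stands for \<open>v\<close>, \<open>Some b\<close> for the
    basis vector \<open>b\<close> of \<open>W \<nu>\<close>; their images lie in two different
    weight spaces, spanned by \<open>B\<^sub>0\<close> and \<open>B\<^sub>1\<close>.\<close>
  define I where "I = insert None (Some ` B')"
  define vec where "vec = (\<lambda>k i. x k (y k (case i of None \<Rightarrow> v | Some b \<Rightarrow> b)))"
  define BB where "BB = (\<lambda>i :: 'm option. case i of None \<Rightarrow> B\<^sub>0 | Some _ \<Rightarrow> B\<^sub>1)"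
  have "(\<Sum>i\<in>I. card (BB i)) = card B\<^sub>0 + card B' * card B\<^sub>1"
    using fin' by (simp add: I_def BB_def sum.reindex)
  also have "\<dots> \<le> D + D * D" using B\<^sub>0(2) B\<^sub>1(2) card' by (intro add_mono mult_mono) auto
  finally have small: "(\<Sum>i\<in>I. card (BB i)) < card K" using K(2) by simp
  have "\<exists>\<gamma>. (\<exists>k\<in>K. \<gamma> k \<noteq> 0) \<and> (\<forall>i\<in>I. (\<Sum>k\<in>K. scale (\<gamma> k) (vec k i)) = 0)"
  proof (rule common_relation[OF _ K(1) _ _ small])
    show "finite I" using fin' by (simp add: I_def)
    show "finite (BB i)" if "i \<in> I" for i
      using B\<^sub>0 B\<^sub>1 by (auto simp: BB_def split: option.split)
    show "vec k i \<in> span (BB i)" if "i \<in> I" for i k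
    proof (cases i)
      case None
      then show ?thesis using xy[OF v, of k] B\<^sub>0(3) by (auto simp: vec_def BB_def)
    next
      case (Some b)
      then have "b \<in> W \<nu>" using that B'(1) by (auto simp: I_def)
      then show ?thesis using xy[of b \<nu> k] B\<^sub>1(3) Some by (auto simp: vec_def BB_def)
    qed
  qed
  then obtain \<gamma> k where k: "k \<in> K" "\<gamma> k \<noteq> 0"
    and rel: "\<And>i. i \<in> I \<Longrightarrow> (\<Sum>j\<in>K. scale (\<gamma> j) (vec j i)) = 0" by blast
  have rel_v: "(\<Sum>j\<in>K. scale (\<gamma> j) (x j (y j v))) = 0"
    using rel[of None] by (simp add: I_def vec_def)
  have "(\<Sum>j\<in>K. scale (\<gamma> j) (x j (y j w))) = 0" if "w \<in> span B'" for w
    using that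
  proof (induction rule: span_induct_alt)
    case base
    then show ?case by (simp add: lin_simps)
  next
    case (step c b w)
    have "(\<Sum>j\<in>K. scale (\<gamma> j) (x j (y j b))) = 0"
      using rel[of "Some b"] step(1) by (simp add: I_def vec_def)
    then have "(\<Sum>j\<in>K. scale c (scale (\<gamma> j) (x j (y j b)))) = 0"
      by (simp only: scale_sum_right[symmetric]) simp
    then show ?case using step(2)
      by (simp add: lin_simps scale_right_distrib sum.distrib mult.commute)
  qed
  then have rel_w: "(\<Sum>j\<in>K. scale (\<gamma> j) (x j (y j (p k (q k v))))) = 0"
    using pq B'(3) by blast
  have lin_pq: "p k (q k (sum f A)) = (\<Sum>j\<in>A. p k (q k (f j)))" for f and A :: "nat set"
    by (induction A rule: infinite_finite_induct) (auto simp: lin_simps)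
  have comm: "p k (q k (x j (y j v))) - x j (y j (p k (q k v))) = (if j = k then z k v else 0)" for j
    using \<sigma> by (auto simp: z_def lin_simps px py qx qy scale_right_distrib scale_right_diff_distrib mult.commute)
  have "0 = p k (q k (\<Sum>j\<in>K. scale (\<gamma> j) (x j (y j v))))
      - (\<Sum>j\<in>K. scale (\<gamma> j) (x j (y j (p k (q k v)))))"
    using rel_v rel_w by (simp add: lin_simps)
  also have "\<dots> = (\<Sum>j\<in>K. scale (\<gamma> j) (p k (q k (x j (y j v))) - x j (y j (p k (q k v)))))"
    by (simp add: lin_pq lin_simps sum_subtractf scale_right_diff_distrib)
  also have "\<dots> = (\<Sum>j\<in>K. if j = k then scale (\<gamma> k) (z k v) else 0)"
    by (rule sum.cong) (auto simp: comm)
  also have "\<dots> = scale (\<gamma> k) (z k v)" using K(1) k(1) by simp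
  finally show ?thesis using k by auto
qed

definition xs_act :: "nat list \<Rightarrow> 'm \<Rightarrow> 'm" where
  "xs_act ks v = foldr x ks v"

lemma xs_act_simps [simp]: "xs_act [] v = v" "xs_act (k # ks) v = x k (xs_act ks v)"
  by (simp_all add: xs_act_def)

lemma xs_act_lin: "xs_act ks (v + w) = xs_act ks v + xs_act ks w"
  "xs_act ks (scale c v) = scale c (xs_act ks v)" "xs_act ks 0 = 0"
  by (induction ks) (simp_all add: lin_simps)

lemma xs_wt: "v \<in> W \<mu> \<Longrightarrow> \<exists>\<nu>. xs_act ks v \<in> W \<nu>"
  by (induction ks) (auto intro: wt(1))

lemma z_xs_notin: "k \<notin> set ks \<Longrightarrow> z k (xs_act ks v) = xs_act ks (z k v)"
  by (induction ks) (auto simp: z_x_other)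

text \<open>Exactly one factor of the product fails to commute with \<open>z k\<close>, and the
  resulting \<open>e e\<close> passes through the other factors.\<close>

lemma z_xs_in:
  assumes "distinct ks" "k \<in> set ks"
  shows "z k (xs_act ks v) = xs_act ks (z k v) + scale (\<alpha> * \<beta>) (e (e (xs_act ks v)))"
  using assms
proof (induction ks)
  case (Cons j ks)
  show ?case
  proof (cases "j = k")
    case True
    then show ?thesis using Cons.prems z_xs_notin[of k ks v]
      by (simp add: z_x_same)
  next
    case False
    then show ?thesis using Cons by (simp add: z_x_other lin_simps ex)
  qed
qed simp

lemma e_pow_lin: "(e ^^ m) (v + w) = (e ^^ m) v + (e ^^ m) w"
  "(e ^^ m) (scale c v) = scale c ((e ^^ m) v)" "(e ^^ m) 0 = 0"
  by (induction m) (simp_all add: lin_simps)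

lemma lin_zero_on_weights:
  assumes "Vector_Spaces.linear scale scale f" "\<And>\<mu> v. v \<in> W \<mu> \<Longrightarrow> f v = 0"
  shows "f v = 0"
proof -
  have "v \<in> span (\<Union>\<mu>. W \<mu>)" using W_span by simp
  then show ?thesis
    by (induction rule: span_induct_alt) (use assms in \<open>auto simp: linear_rules\<close>)
qed

text \<open>At most D + D * D of the indices are bad for \<open>v\<close>, and as many for
  \<open>xs_act ks v\<close>. With one index more than twice that number, some \<open>k\<close> in
  \<open>ks\<close> is good for both, and \<open>z_xs_in\<close> then leaves only the term with
  \<open>e e\<close>.\<close>

lemma ee_xs:
  assumes "distinct ks" "length ks = 2 * (D + D * D) + 1"
  shows "e (e (xs_act ks v)) = 0"
proof (rule lin_zero_on_weights[of "\<lambda>v. e (e (xs_act ks v))"])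
  show "Vector_Spaces.linear scale scale (\<lambda>v. e (e (xs_act ks v)))"
    by (intro linearI_rules) (simp_all add: lin_simps xs_act_lin)
next
  fix \<mu> v assume v: "v \<in> W \<mu>"
  obtain \<nu> where \<nu>: "xs_act ks v \<in> W \<nu>" using xs_wt[OF v] by blast
  define d where "d = D + D * D"
  define N1 N2 where "N1 = {k \<in> set ks. z k v \<noteq> 0}" and "N2 = {k \<in> set ks. z k (xs_act ks v) \<noteq> 0}"
  have "card N1 \<le> d" using good_index[OF v, of N1] by (force simp: N1_def d_def)
  moreover have "card N2 \<le> d" using good_index[OF \<nu>, of N2] by (force simp: N2_def d_def)
  moreover have "card (N1 \<union> N2) \<le> card N1 + card N2" by (rule card_Un_le)
  moreover have "card (set ks) = 2 * d + 1" using assms by (simp add: distinct_card d_def)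
  ultimately have "N1 \<union> N2 \<noteq> set ks" by auto
  moreover have "N1 \<union> N2 \<subseteq> set ks" by (auto simp: N1_def N2_def)
  ultimately obtain k where "k \<in> set ks" "z k v = 0" "z k (xs_act ks v) = 0"
    by (auto simp: N1_def N2_def)
  then show "e (e (xs_act ks v)) = 0"
    using z_xs_in[OF assms(1), of k v] \<alpha> \<beta> by (simp add: xs_act_lin)
qed

lemma e_pow_y: "(e ^^ m) (y k v) = y k ((e ^^ m) v)"
  by (induction m) (simp_all add: ey)

text \<open>The bracket of \<open>e\<close> with \<open>p k\<close> is a multiple of
  \<open>y k\<close>, which commutes with \<open>e\<close>; so the Leibniz expansion stops after one
  term.\<close>

lemma e_pow_p: "(e ^^ m) (p k v) = p k ((e ^^ m) v) + scale (of_nat m * \<theta>) (y k ((e ^^ (m - 1)) v))"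
proof (induction m)
  case (Suc m)
  have "scale (of_nat (Suc m) * \<theta>) w = scale \<theta> w + scale (of_nat m * \<theta>) w" for w
    by (simp add: algebra_simps flip: scale_left_distrib)
  with Suc show ?case
    by (cases m) (simp_all add: lin_simps ep ey add.assoc)
qed simp

lemma p_xs: "k \<notin> set ks \<Longrightarrow> \<exists>s. s \<noteq> 0 \<and> (\<forall>v. xs_act ks (p k v) = scale s (p k (xs_act ks v)))"
proof (induction ks)
  case Nil
  show ?case by (intro exI[of _ 1]) auto
next
  case (Cons j ks)
  then obtain s where s: "s \<noteq> 0" "\<And>v. xs_act ks (p k v) = scale s (p k (xs_act ks v))" by auto
  have "x j (p k v) = scale \<sigma> (p k (x j v))" for v
    using px[of k j v] Cons.prems \<sigma>_sq by auto
  then show ?case using s \<sigma>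
    by (intro exI[of _ "s * \<sigma>"]) (auto simp: lin_simps)
qed

text \<open>The factor \<open>x k\<close> is traded for \<open>e\<close> through the bracket of
  \<open>p k\<close> with \<open>x k\<close>. This costs two powers of \<open>e\<close>: one because
  moving \<open>e\<close> past \<open>p k\<close> lowers the exponent in the \<theta>-term, one
  because the bracket itself is a multiple of \<open>e\<close>.\<close>

lemma e_pow_xs_step:
  assumes "k \<notin> set ks" "\<And>v. (e ^^ m) (xs_act (k # ks) v) = 0"
  shows "(e ^^ (m + 2)) (xs_act ks v) = 0"
proof -
  define w where "w = xs_act ks v"
  obtain s where s: "s \<noteq> 0" "\<And>v. xs_act ks (p k v) = scale s (p k (xs_act ks v))"
    using p_xs[OF assms(1)] by blast
  have a: "(e ^^ m) (x k w) = 0" using assms(2)[of v] by (simp add: w_def)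
  have "(e ^^ m) (x k (p k w)) = 0"
    using assms(2)[of "p k v"] s by (simp add: w_def lin_simps e_pow_lin)
  then have b: "(e ^^ (m + 1)) (x k (p k w)) = 0" by (simp add: lin_simps)
  have "(e ^^ (m + 1)) (p k (x k w)) = p k ((e ^^ (m + 1)) (x k w)) + scale (of_nat (m + 1) * \<theta>) (y k ((e ^^ m) (x k w)))"
    using e_pow_p[of "m + 1" k "x k w"] by simp
  then have "(e ^^ (m + 1)) (p k (x k w)) = 0" using a by (simp add: lin_simps)
  then have "(e ^^ (m + 1)) (scale \<sigma> (x k (p k w)) + scale \<alpha> (e w)) = 0"
    by (simp add: px)
  then have "scale \<alpha> ((e ^^ (m + 1)) (e w)) = 0"
    using b by (simp only: e_pow_lin) simp
  then show ?thesis using \<alpha> by (simp add: w_def funpow_swap1)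
qed

theorem e_nilpotent: "\<exists>s. \<forall>v. (e ^^ s) v = 0"
proof -
  \<comment> \<open>Here \<open>m\<close> counts the factors already removed from the product of
    \<open>ee_xs\<close>.\<close>
  have "(e ^^ (2 + 2 * m)) (xs_act ks v) = 0"
    if "distinct ks" "length ks + m = 2 * (D + D * D) + 1" for m ks v
    using that
  proof (induction m arbitrary: ks v)
    case 0
    then show ?case using ee_xs[of ks v] by (simp add: numeral_2_eq_2)
  next
    case (Suc m)
    obtain k where k: "k \<notin> set ks"
      using ex_new_if_finite[OF infinite_UNIV_nat, of "set ks"] by auto
    have "(e ^^ ((2 + 2 * m) + 2)) (xs_act ks v) = 0"
    proof (rule e_pow_xs_step[OF k])
      show "(e ^^ (2 + 2 * m)) (xs_act (k # ks) w) = 0" for w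
        using Suc.prems k by (intro Suc.IH) auto
    qed
    then show ?case by (simp add: algebra_simps)
  qed
  from this[of "[]"] have "(e ^^ (2 + 2 * (2 * (D + D * D) + 1))) v = 0" for v by fastforce
  then show ?thesis by blast
qed

end

section \<open>Root vectors of the orthosymplectic superalgebra\<close>

fun neg :: "osp_index \<Rightarrow> osp_index" where
  "neg (Eps i) = Eps_neg i"
| "neg (Eps_neg i) = Eps i"
| "neg Eps_zero = Eps_zero"
| "neg (Del j) = Del_neg j"
| "neg (Del_neg j) = Del j"

lemma neg_neg [simp]: "neg (neg i) = i"
  by (cases i) auto

lemma neg_eq_iff [simp]: "neg i = neg j \<longleftrightarrow> i = j"
  by (metis neg_neg)

lemma parity_neg [simp]: "parity (neg i) = parity i"
  by (cases i) auto

lemma in_range_neg [simp]: "in_range X a b (neg i) \<longleftrightarrow> in_range X a b i"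
  by (cases i) auto

lemma osp_form_nonzero: "osp_form i j \<noteq> 0 \<longleftrightarrow> j = neg i"
  by (cases i; cases j) auto

lemma osp_form_even: "parity i = 0 \<Longrightarrow> osp_form i j = of_bool (j = neg i)"
  by (cases i; cases j) auto

lemma osp_form_sym_even: "parity i = 0 \<Longrightarrow> osp_form j i = osp_form i j"
  by (cases i; cases j) auto

lemma osp_form_parity: "parity i \<noteq> parity j \<Longrightarrow> osp_form i j = 0"
  by (cases i; cases j) auto

lemma koszul_simps [simp]: "koszul_sign 0 p = 1" "koszul_sign p 0 = 1" "koszul_sign 1 1 = - 1"
  by (auto simp: koszul_sign_def)

text \<open>The operator \<open>z \<mapsto> (w, z) u - (u, z) w\<close>. It lies in the superalgebra only if \<open>u\<close> or \<open>w\<close> is even;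
  two odd indices would need a plus sign.\<close>

definition wedge :: "osp_index \<Rightarrow> osp_index \<Rightarrow> smatrix" where
  "wedge u w = (\<lambda>p q. of_bool (p = u) * osp_form w q - of_bool (p = w) * osp_form u q)"

lemma wedge_nonzero:
  "wedge u w p q \<noteq> 0 \<Longrightarrow> p = u \<and> q = neg w \<or> p = w \<and> q = neg u"
  using osp_form_nonzero[of w q] osp_form_nonzero[of u q]
  by (cases "p = u"; cases "p = w") (auto simp: wedge_def)

lemma finite_wedge_row: "finite {k. wedge u w i k \<noteq> 0}"
  by (rule finite_subset[of _ "{neg u, neg w}"]) (auto dest: wedge_nonzero)

lemma sum_support_left:
  fixes f :: "'a \<Rightarrow> 'b::semiring_0"
  assumes "finite S" "{i. f i \<noteq> 0} \<subseteq> S"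
  shows "(\<Sum>i | f i \<noteq> 0. f i * g i) = (\<Sum>i\<in>S. f i * g i)"
    "(\<Sum>i | f i \<noteq> 0. g i * f i) = (\<Sum>i\<in>S. g i * f i)"
  using assms by (auto intro!: sum.mono_neutral_left)

lemma smult_wedge:
  assumes "finite {k. A i k \<noteq> 0}"
  shows "Defs.smult A (wedge x y) i j = A i x * osp_form y j - A i y * osp_form x j"
proof -
  have "Defs.smult A (wedge x y) i j = (\<Sum>k\<in>{k. A i k \<noteq> 0} \<union> {x, y}. A i k * wedge x y k j)"
    unfolding Defs.smult_def by (rule sum_support_left) (use assms in auto)
  also have "\<dots> = (\<Sum>k\<in>{k. A i k \<noteq> 0} \<union> {x, y}. (if k = x then A i x * osp_form y j else 0)
      - (if k = y then A i y * osp_form x j else 0))"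
    by (rule sum.cong) (auto simp: wedge_def)
  also have "\<dots> = A i x * osp_form y j - A i y * osp_form x j"
    using assms by (simp add: sum_subtractf)
  finally show ?thesis .
qed

text \<open>The last hypothesis excludes a nonzero multiple of \<open>wedge w y\<close> with both
  indices odd, where the formula would need a plus sign and \<open>wedge\<close> has a minus
  sign.\<close>

lemma superbracket_wedge:
  assumes "parity u = 0" "parity x = 0"
    and "osp_form u x = 0 \<or> parity w = 0 \<or> parity y = 0"
  shows "superbracket (parity w) (parity y) (wedge u w) (wedge x y) =
    (\<lambda>i j. osp_form w x * wedge u y i j - osp_form u x * wedge w y i j
         + osp_form w y * wedge x u i j - osp_form u y * wedge x w i j)"
proof (intro ext)
  fix i j
  define \<kappa> where "\<kappa> = koszul_sign (parity w) (parity y)"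
  have sym: "osp_form x u = osp_form u x" "osp_form y u = osp_form u y"
    "osp_form x w = osp_form w x"
    using osp_form_sym_even[OF assms(1)] osp_form_sym_even[OF assms(2)] by metis+
  have yw: "osp_form y w = \<kappa> * osp_form w y" "\<kappa> * \<kappa> = 1"
    unfolding \<kappa>_def by (cases w; cases y; auto simp: koszul_sign_def)+
  have \<kappa>: "\<kappa> * osp_form w x = osp_form w x" "\<kappa> * osp_form u y = osp_form u y"
    "\<kappa> * osp_form u x = osp_form u x"
    using assms osp_form_parity[of w x] osp_form_parity[of u y]
    by (auto simp: \<kappa>_def koszul_sign_def)
  obtain du dw dx dy :: complex where
    d: "of_bool (i = u) = du" "of_bool (i = w) = dw" "of_bool (i = x) = dx" "of_bool (i = y) = dy"
    by blast
  have "superbracket (parity w) (parity y) (wedge u w) (wedge x y) i j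
    = (du * osp_form w x - dw * osp_form u x) * osp_form y j
    - (du * osp_form w y - dw * osp_form u y) * osp_form x j
    - \<kappa> * ((dx * osp_form y u - dy * osp_form x u) * osp_form w j
         - (dx * osp_form y w - dy * osp_form x w) * osp_form u j)"
    unfolding superbracket_def smult_wedge[OF finite_wedge_row]
    unfolding wedge_def d \<kappa>_def ..
  also have "\<dots> = (du * osp_form w x - dw * osp_form u x) * osp_form y j
    - (du * osp_form w y - dw * osp_form u y) * osp_form x j
    - ((dx * (\<kappa> * osp_form u y) - dy * (\<kappa> * osp_form u x)) * osp_form w j
         - (dx * (\<kappa> * \<kappa> * osp_form w y) - dy * (\<kappa> * osp_form w x)) * osp_form u j)"
    unfolding sym yw(1) by (simp add: algebra_simps)
  also have "\<dots> = osp_form w x * (du * osp_form y j - dy * osp_form u j)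
     - osp_form u x * (dw * osp_form y j - dy * osp_form w j)
     + osp_form w y * (dx * osp_form u j - du * osp_form x j)
     - osp_form u y * (dx * osp_form w j - dw * osp_form x j)"
    unfolding \<kappa> yw(2) by (simp add: algebra_simps)
  finally show "superbracket (parity w) (parity y) (wedge u w) (wedge x y) i j =
      osp_form w x * wedge u y i j - osp_form u x * wedge w y i j
         + osp_form w y * wedge x u i j - osp_form u y * wedge x w i j"
    unfolding wedge_def d .
qed

lemma sum_pair: 
  fixes f g :: "osp_index \<Rightarrow> complex"
  shows "(\<Sum>i\<in>{u, w}. (of_bool (i = u) * s - of_bool (i = w) * t) * f i) = s * f u - t * f w"
  by (cases "u = w") (auto simp: algebra_simps)

lemma wedge_mem:
  assumes "parity u = 0" "in_range X a b u" "in_range X a b w"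
  shows "wedge u w \<in> osp X a b (parity w)"
  unfolding osp_def
proof (intro CollectI conjI allI impI)
  show "finite {(i, j). wedge u w i j \<noteq> 0}"
    by (rule finite_subset[of _ "{u, w} \<times> {neg u, neg w}"]) (auto dest: wedge_nonzero)
next
  fix i j assume "wedge u w i j \<noteq> 0"
  from wedge_nonzero[OF this] show "in_range X a b i" "in_range X a b j" "parity i = parity j + parity w"
    using assms by auto
next
  fix j k
  have sub: "{i. wedge u w i j \<noteq> 0} \<subseteq> {u, w}" for j by (auto dest: wedge_nonzero)
  have 1: "(\<Sum>i | wedge u w i j \<noteq> 0. wedge u w i j * osp_form i k)
      = osp_form w j * osp_form u k - osp_form u j * osp_form w k"
    unfolding sum_support_left(1)[OF _ sub, simplified] using sum_pair by (simp add: wedge_def)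
  have "(\<Sum>i | wedge u w i k \<noteq> 0. osp_form j i * wedge u w i k)
      = (\<Sum>i\<in>{u, w}. wedge u w i k * osp_form j i)"
    unfolding sum_support_left(2)[OF _ sub, simplified] by (simp add: mult.commute)
  also have "\<dots> = osp_form w k * osp_form j u - osp_form u k * osp_form j w"
    using sum_pair by (simp add: wedge_def)
  finally have 2: "(\<Sum>i | wedge u w i k \<noteq> 0. osp_form j i * wedge u w i k)
      = osp_form w k * osp_form j u - osp_form u k * osp_form j w" .
  have 3: "osp_form j u = osp_form u j" "parity j = 1 \<Longrightarrow> osp_form u j = 0"
    using osp_form_sym_even[OF assms(1)] assms(1) by (metis, auto intro: osp_form_parity)
  have 4: "osp_form j w = koszul_sign (parity w) (parity j) * osp_form w j"
    by (cases w; cases j) (auto simp: koszul_sign_def)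
  have bits: "parity w = 0 \<or> parity w = 1" "parity j = 0 \<or> parity j = 1"
    by (metis bit_not_one_iff)+
  show "(\<Sum>i | wedge u w i j \<noteq> 0. wedge u w i j * osp_form i k)
    + koszul_sign (parity w) (parity j) * (\<Sum>i | wedge u w i k \<noteq> 0. osp_form j i * wedge u w i k) = 0"
    unfolding 1 2 4 3(1) using bits 3(2) by (elim disjE) simp_all
qed

lemma osp_row_finite: "A \<in> osp X a b p \<Longrightarrow> finite {k. A i k \<noteq> 0}"
  and osp_col_finite: "A \<in> osp X a b p \<Longrightarrow> finite {k. A k i \<noteq> 0}"
proof -
  assume "A \<in> osp X a b p"
  then have fin: "finite {(i, j). A i j \<noteq> 0}" by (simp add: osp_def)
  show "finite {k. A i k \<noteq> 0}"
    by (rule finite_subset[OF _ finite_imageI[OF fin, of snd]]) force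
  show "finite {k. A k i \<noteq> 0}"
    by (rule finite_subset[OF _ finite_imageI[OF fin, of fst]]) force
qed

lemma osp_combine:
  assumes A: "A \<in> osp X a b p" and B: "B \<in> osp X a b p"
  shows "(\<lambda>i j. c * A i j + d * B i j) \<in> osp X a b p" (is "?C \<in> _")
  unfolding osp_def
proof (intro CollectI conjI allI impI)
  have "finite {(i, j). A i j \<noteq> 0}" "finite {(i, j). B i j \<noteq> 0}" using A B by (auto simp: osp_def)
  then show "finite {(i, j). ?C i j \<noteq> 0}"
    by (rule_tac finite_subset[of _ "{(i, j). A i j \<noteq> 0} \<union> {(i, j). B i j \<noteq> 0}"]) auto
next
  fix i j assume "?C i j \<noteq> 0"
  then have "A i j \<noteq> 0 \<or> B i j \<noteq> 0" by auto
  then show "in_range X a b i" "in_range X a b j" "parity i = parity j + p"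
    using A B by (auto simp: osp_def)
next
  fix j k
  define S where "S = {i. A i j \<noteq> 0} \<union> {i. A i k \<noteq> 0} \<union> {i. B i j \<noteq> 0} \<union> {i. B i k \<noteq> 0}"
  have fin: "finite S" using osp_col_finite[OF A] osp_col_finite[OF B] by (simp add: S_def)
  have sub: "{i. A i j \<noteq> 0} \<subseteq> S" "{i. A i k \<noteq> 0} \<subseteq> S" "{i. B i j \<noteq> 0} \<subseteq> S" "{i. B i k \<noteq> 0} \<subseteq> S"
    "{i. ?C i j \<noteq> 0} \<subseteq> S" "{i. ?C i k \<noteq> 0} \<subseteq> S"
    by (auto simp: S_def)
  have sk: "(\<Sum>i\<in>S. Z i j * osp_form i k) + koszul_sign p (parity j) * (\<Sum>i\<in>S. osp_form j i * Z i k) = 0"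
    if "Z \<in> osp X a b p" "{i. Z i j \<noteq> 0} \<subseteq> S" "{i. Z i k \<noteq> 0} \<subseteq> S" for Z
  proof -
    have "(\<Sum>i | Z i j \<noteq> 0. Z i j * osp_form i k)
          + koszul_sign p (parity j) * (\<Sum>i | Z i k \<noteq> 0. osp_form j i * Z i k) = 0"
      using that by (auto simp: osp_def)
    then show ?thesis
      unfolding sum_support_left(1)[OF fin that(2)] sum_support_left(2)[OF fin that(3)] .
  qed
  have "(\<Sum>i\<in>S. ?C i j * osp_form i k) + koszul_sign p (parity j) * (\<Sum>i\<in>S. osp_form j i * ?C i k)
     = c * ((\<Sum>i\<in>S. A i j * osp_form i k) + koszul_sign p (parity j) * (\<Sum>i\<in>S. osp_form j i * A i k))
     + d * ((\<Sum>i\<in>S. B i j * osp_form i k) + koszul_sign p (parity j) * (\<Sum>i\<in>S. osp_form j i * B i k))"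
    by (simp add: algebra_simps sum.distrib sum_distrib_left)
  also have "\<dots> = 0" using sk[OF A sub(1,2)] sk[OF B sub(3,4)] by simp
  finally show "(\<Sum>i | ?C i j \<noteq> 0. ?C i j * osp_form i k)
    + koszul_sign p (parity j) * (\<Sum>i | ?C i k \<noteq> 0. osp_form j i * ?C i k) = 0"
    unfolding sum_support_left(1)[OF fin sub(5)] sum_support_left(2)[OF fin sub(6)] .
qed

lemma osp_zero: "(\<lambda>i j. 0) \<in> osp X a b p"
  by (simp add: osp_def)

text \<open>The invariance condition for the basis vectors \<open>s\<close> and
  \<open>neg r\<close>: the form selects one entry from each of the two sums.\<close>

lemma osp_even_skew:
  assumes A: "A \<in> osp X a b 0" and r: "parity r = 0" and s: "parity s = 0"
  shows "A (neg s) (neg r) = - A r s"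
proof -
  have fin: "finite ({i. A i t \<noteq> 0} \<union> {r, neg s})" for t using osp_col_finite[OF A, of t] by simp
  have "(\<Sum>i | A i s \<noteq> 0. A i s * osp_form i (neg r)) = (\<Sum>i\<in>{i. A i s \<noteq> 0} \<union> {r, neg s}. A i s * osp_form i (neg r))"
    by (rule sum_support_left[OF fin]) auto
  also have "\<dots> = (\<Sum>i\<in>{i. A i s \<noteq> 0} \<union> {r, neg s}. if i = r then A r s else 0)"
    using r by (intro sum.cong) (auto simp: osp_form_sym_even[of "neg r"] osp_form_even)
  also have "\<dots> = A r s" using fin[of s] by (simp del: Un_insert_right)
  finally have 1: "(\<Sum>i | A i s \<noteq> 0. A i s * osp_form i (neg r)) = A r s" .
  have "(\<Sum>i | A i (neg r) \<noteq> 0. osp_form s i * A i (neg r))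
      = (\<Sum>i\<in>{i. A i (neg r) \<noteq> 0} \<union> {r, neg s}. osp_form s i * A i (neg r))"
    by (rule sum_support_left[OF fin]) auto
  also have "\<dots> = (\<Sum>i\<in>{i. A i (neg r) \<noteq> 0} \<union> {r, neg s}. if i = neg s then A (neg s) (neg r) else 0)"
    using s by (intro sum.cong) (auto simp: osp_form_even)
  also have "\<dots> = A (neg s) (neg r)" using fin[of "neg r"] by (simp del: Un_insert_right)
  finally have 2: "(\<Sum>i | A i (neg r) \<noteq> 0. osp_form s i * A i (neg r)) = A (neg s) (neg r)" .
  have "(\<Sum>i | A i s \<noteq> 0. A i s * osp_form i (neg r))
          + koszul_sign 0 (parity s) * (\<Sum>i | A i (neg r) \<noteq> 0. osp_form s i * A i (neg r)) = 0"
    using A by (auto simp: osp_def)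
  then show ?thesis unfolding 1 2 by (simp add: add_eq_0_iff)
qed

text \<open>The factor 1/2 compensates for counting twice: by skewness the entries at (p, q) and
  (neg q, neg p) contribute the same matrix.\<close>

lemma orth_decompose:
  assumes A: "A \<in> osp_orth X a b"
  shows "A = (\<lambda>r s. \<Sum>(p, q)\<in>{(p, q). A p q \<noteq> 0}. A p q / 2 * wedge p (neg q) r s)"
proof (intro ext)
  fix r s
  let ?T = "{(p, q). A p q \<noteq> 0}"
  have osp: "A \<in> osp X a b 0" and even: "\<And>p q. A p q \<noteq> 0 \<Longrightarrow> parity p = 0 \<and> parity q = 0"
    using A by (auto simp: osp_orth_def)
  have fin: "finite ?T" using osp by (simp add: osp_def)
  have "(case t of (p, q) \<Rightarrow> A p q / 2 * wedge p (neg q) r s)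
    = (if t = (r, s) then A r s / 2 else 0) - (if t = (neg s, neg r) then A (neg s) (neg r) / 2 else 0)"
    if "t \<in> ?T" for t
  proof -
    obtain p q where t: "t = (p, q)" by force
    then have even': "parity p = 0" "parity q = 0" using that even by auto
    have 1: "wedge p (neg q) r s = of_bool (r = p \<and> s = q) - of_bool (r = neg q \<and> s = neg p)"
      using even' by (simp add: wedge_def osp_form_even of_bool_conj)
    have 2: "r = neg q \<and> s = neg p \<longleftrightarrow> p = neg s \<and> q = neg r" by auto
    have 3: "A p q / 2 * of_bool (r = p \<and> s = q) = (if p = r \<and> q = s then A r s / 2 else 0)" by auto
    have 4: "A p q / 2 * of_bool (p = neg s \<and> q = neg r)
        = (if p = neg s \<and> q = neg r then A (neg s) (neg r) / 2 else 0)" by auto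
    show ?thesis unfolding t prod.case 1 2 prod.inject right_diff_distrib 3 4 ..
  qed
  then have "(\<Sum>(p, q)\<in>?T. A p q / 2 * wedge p (neg q) r s)
    = (\<Sum>t\<in>?T. (if t = (r, s) then A r s / 2 else 0) - (if t = (neg s, neg r) then A (neg s) (neg r) / 2 else 0))"
    by (intro sum.cong refl) blast
  also have "\<dots> = A r s / 2 - A (neg s) (neg r) / 2"
    using fin by (simp add: sum_subtractf)
  also have "A (neg s) (neg r) = - A r s"
  proof (cases "A r s = 0 \<and> A (neg s) (neg r) = 0")
    case False
    then have "parity r = 0" "parity s = 0" using even by force+
    then show ?thesis using osp_even_skew[OF osp] by simp
  qed simp
  finally show "A r s = (\<Sum>(p, q)\<in>?T. A p q / 2 * wedge p (neg q) r s)" by simp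
qed

section \<open>The Cartan subalgebra and its brackets with root vectors\<close>

lemma cartan_subset: "osp_cartan X a b \<subseteq> osp X a b 0"
  by (auto simp: osp_cartan_def)

lemma cartan_offdiag: "H \<in> osp_cartan X a b \<Longrightarrow> i \<noteq> j \<Longrightarrow> H i j = 0"
  by (auto simp: osp_cartan_def)

lemma smult_cartan_left:
  assumes "H \<in> osp_cartan X a b" shows "Defs.smult H A i j = H i i * A i j"
proof -
  have "Defs.smult H A i j = (\<Sum>k\<in>{i}. H i k * A k j)"
    unfolding Defs.smult_def by (rule sum_support_left) (use cartan_offdiag[OF assms, of i] in fastforce)+
  then show ?thesis by simp
qed

lemma smult_cartan_right:
  assumes "H \<in> osp_cartan X a b" "finite {k. A i k \<noteq> 0}" shows "Defs.smult A H i j = A i j * H j j"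
proof -
  have "Defs.smult A H i j = (\<Sum>k\<in>{k. A i k \<noteq> 0} \<union> {j}. A i k * H k j)"
    unfolding Defs.smult_def by (rule sum_support_left) (use assms in auto)
  also have "\<dots> = (\<Sum>k\<in>{k. A i k \<noteq> 0} \<union> {j}. if k = j then A i j * H j j else 0)"
    by (intro sum.cong) (auto simp: cartan_offdiag[OF assms(1)])
  also have "\<dots> = A i j * H j j" using assms(2) by (simp del: Un_insert_right)
  finally show ?thesis .
qed

lemma cartan_neg_diag:
  assumes H: "H \<in> osp_cartan X a b"
  shows "H (neg i) (neg i) = - H i i"
proof -
  have osp: "H \<in> osp X a b 0" using H cartan_subset by blast
  have 1: "(\<Sum>k | H k i \<noteq> 0. H k i * osp_form k (neg i)) = (\<Sum>k\<in>{i}. H k i * osp_form k (neg i))"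
    by (rule sum_support_left) (use cartan_offdiag[OF H] in fastforce)+
  have 2: "(\<Sum>k | H k (neg i) \<noteq> 0. osp_form i k * H k (neg i)) = (\<Sum>k\<in>{neg i}. osp_form i k * H k (neg i))"
    by (rule sum_support_left) (use cartan_offdiag[OF H] in fastforce)+
  have "(\<Sum>k | H k i \<noteq> 0. H k i * osp_form k (neg i))
          + koszul_sign 0 (parity i) * (\<Sum>k | H k (neg i) \<noteq> 0. osp_form i k * H k (neg i)) = 0"
    using osp by (auto simp: osp_def)
  then have "(H i i + H (neg i) (neg i)) * osp_form i (neg i) = 0"
    unfolding 1 2 by (simp add: algebra_simps)
  then show ?thesis using osp_form_nonzero[of i "neg i"] by (simp add: add_eq_0_iff)
qed

lemma superbracket_cartan_wedge:
  assumes H: "H \<in> osp_cartan X a b" and u: "parity u = 0"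
  shows "superbracket 0 (parity w) H (wedge u w) = (\<lambda>i j. (H u u + H w w) * wedge u w i j)"
proof (intro ext)
  fix i j
  show "superbracket 0 (parity w) H (wedge u w) i j = (H u u + H w w) * wedge u w i j"
  proof (cases "wedge u w i j = 0")
    case True
    then show ?thesis
      by (simp add: superbracket_def smult_cartan_left[OF H] smult_cartan_right[OF H finite_wedge_row])
  next
    case False
    then show ?thesis using wedge_nonzero[OF False] cartan_neg_diag[OF H]
      by (auto simp: superbracket_def smult_cartan_left[OF H] smult_cartan_right[OF H finite_wedge_row] algebra_simps)
  qed
qed

lemma superbracket_cartan_cartan:
  assumes H: "H \<in> osp_cartan X a b" and K: "K \<in> osp_cartan X a b"
  shows "superbracket 0 0 H K = (\<lambda>i j. 0)"
proof (intro ext)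
  fix i j
  have "finite {k. K i k \<noteq> 0}" using K cartan_subset osp_row_finite by blast
  then show "superbracket 0 0 H K i j = 0"
    by (cases "i = j") (simp_all add: superbracket_def smult_cartan_left[OF H] smult_cartan_right[OF H] cartan_offdiag[OF K])
qed

lemma cartan_combine:
  assumes "A \<in> osp_cartan X a b" "B \<in> osp_cartan X a b"
  shows "(\<lambda>i j. c * A i j + d * B i j) \<in> osp_cartan X a b"
  using assms osp_combine[of A X a b 0 B c d] by (auto simp: osp_cartan_def)

lemma cartan_zero: "(\<lambda>i j. 0) \<in> osp_cartan X a b"
  by (simp add: osp_cartan_def osp_zero)

text \<open>A diagonal matrix written as a wedge, so that the general bracket formula and the action
  of wedges apply to it.\<close>

definition hm :: "osp_index \<Rightarrow> smatrix" where
  "hm i = wedge i (neg i)"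

lemma hm_diag: "parity i = 0 \<Longrightarrow> hm i j j = of_bool (j = i) - of_bool (j = neg i)"
  by (auto simp: hm_def wedge_def osp_form_even)

lemma hm_cartan:
  assumes "parity i = 0" "in_range X a b i" shows "hm i \<in> osp_cartan X a b"
proof -
  have "hm i \<in> osp X a b 0" using wedge_mem[of i X a b "neg i"] assms by (simp add: hm_def)
  then show ?thesis using wedge_nonzero[of i "neg i"] by (fastforce simp: osp_cartan_def hm_def)
qed

lemma wedge_orth:
  assumes "parity i = 0" "parity j = 0" "in_range X a b i" "in_range X a b j"
  shows "wedge i j \<in> osp_orth X a b"
proof -
  have "wedge i j \<in> osp X a b 0" using wedge_mem[of i X a b j] assms by simp
  then show ?thesis using assms by (auto simp: osp_orth_def dest: wedge_nonzero)
qed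

section \<open>Dixmier's lemma\<close>

text \<open>\<open>S\<close> is covered by its intersections with the spans of finite subsets of
  \<open>B\<close>: countably many sets, each finite by independence.\<close>

lemma (in vector_space) countable_independent:
  assumes "countable B" "independent S" "S \<subseteq> span B"
  shows "countable S"
proof -
  have "S \<subseteq> (\<Union>F\<in>{F. finite F \<and> F \<subseteq> B}. S \<inter> span F)"
  proof
    fix v assume v: "v \<in> S"
    then have "v \<in> span B" using assms by auto
    then obtain F r where "finite F" "F \<subseteq> B" "v = (\<Sum>b\<in>F. scale (r b) b)"
      unfolding span_explicit by auto
    then show "v \<in> (\<Union>F\<in>{F. finite F \<and> F \<subseteq> B}. S \<inter> span F)"
      using v by (auto intro!: exI[of _ F] span_sum span_scale intro: span_base)
  qed
  moreover have "countable (S \<inter> span F)" if "finite F" for F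
  proof -
    have "independent (S \<inter> span F)" using assms(2) independent_mono by blast
    then have "finite (S \<inter> span F)" using independent_span_bound[OF that] by blast
    then show ?thesis by (rule countable_finite)
  qed
  ultimately show ?thesis
    using countable_Collect_finite_subset[OF assms(1)]
    by (intro countable_subset[of S "\<Union>F\<in>{F. finite F \<and> F \<subseteq> B}. S \<inter> span F"] countable_UN) auto
qed

locale complex_vector_space = vector_space scale
  for scale :: "complex \<Rightarrow> 'm::ab_group_add \<Rightarrow> 'm"
begin

text \<open>The vector p(T) v in Horner form.\<close>

definition poly_act :: "('m \<Rightarrow> 'm) \<Rightarrow> complex poly \<Rightarrow> 'm \<Rightarrow> 'm" where
  "poly_act T p v = fold_coeffs (\<lambda>a w. scale a v + T w) p 0"

context
  fixes T assumes T: "Vector_Spaces.linear scale scale T"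
begin

lemma poly_act_0 [simp]: "poly_act T 0 v = 0"
  by (simp add: poly_act_def)

lemma poly_act_pCons [simp]: "poly_act T (pCons a p) v = scale a v + T (poly_act T p v)"
  by (cases "a = 0 \<and> p = 0") (auto simp: poly_act_def linear_rules[OF T])

lemma poly_act_add: "poly_act T (p + q) v = poly_act T p v + poly_act T q v"
  by (induction p q rule: poly_induct2) (simp_all add: linear_rules[OF T] scale_left_distrib algebra_simps)

lemma poly_act_smult: "poly_act T (smult c p) v = scale c (poly_act T p v)"
  by (induction p) (simp_all add: linear_rules[OF T] scale_right_distrib)

lemma poly_act_sum: "poly_act T (\<Sum>i\<in>A. f i) v = (\<Sum>i\<in>A. poly_act T (f i) v)"
  by (induction A rule: infinite_finite_induct) (simp_all add: poly_act_add)

lemma poly_act_linear: "Vector_Spaces.linear scale scale (poly_act T p)"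
proof (rule linearI_rules)
  show "poly_act T p (v + w) = poly_act T p v + poly_act T p w" for v w
    by (induction p) (simp_all add: linear_rules[OF T] scale_right_distrib)
  show "poly_act T p (scale c v) = scale c (poly_act T p v)" for c v
    by (induction p) (simp_all add: linear_rules[OF T] scale_right_distrib mult.commute)
qed

lemma poly_act_T: "poly_act T p (T v) = T (poly_act T p v)"
  by (induction p) (simp_all add: linear_rules[OF T])

lemma poly_act_factor: "poly_act T ([:- c, 1:] * p) v = T (poly_act T p v) - scale c (poly_act T p v)"
proof -
  have "[:- c, 1:] * p = smult (- c) p + pCons 0 p" by simp
  then show ?thesis by (simp only: poly_act_add poly_act_smult poly_act_pCons) simp
qed

lemma poly_act_factor': "poly_act T ([:- c, 1:] * p) v = poly_act T p (T v - scale c v)"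
  unfolding poly_act_factor by (simp add: linear_rules[OF poly_act_linear] poly_act_T)

text \<open>Over the complex numbers p splits into factors T - c, each injective on
  \<open>N\<close>.\<close>

lemma poly_act_injective:
  assumes N: "subspace N" "\<And>v. v \<in> N \<Longrightarrow> T v \<in> N"
    and inj: "\<And>c v. v \<in> N \<Longrightarrow> T v = scale c v \<Longrightarrow> v = 0"
  shows "p \<noteq> 0 \<Longrightarrow> v \<in> N \<Longrightarrow> v \<noteq> 0 \<Longrightarrow> poly_act T p v \<in> N \<and> poly_act T p v \<noteq> 0"
proof (induction "degree p" arbitrary: p rule: less_induct)
  case less
  show ?case
  proof (cases "degree p = 0")
    case True
    then obtain a where "p = [:a:]" by (metis degree_eq_zeroE)
    then show ?thesis using less.prems N(1) by (auto simp: linear_rules[OF T] subspace_scale)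
  next
    case False
    then obtain c where "poly p c = 0"
      using fundamental_theorem_of_algebra[of p] constant_degree[of p] by metis
    then obtain q where q: "p = [:- c, 1:] * q" by (metis poly_eq_0_iff_dvd dvdE)
    have q0: "q \<noteq> 0" using q less.prems(1) by auto
    have "degree p = Suc (degree q)" unfolding q using q0 by (simp add: degree_mult_eq del: mult_pCons_left)
    then have IH: "poly_act T q v \<in> N" "poly_act T q v \<noteq> 0"
      using less.hyps[of q] q0 less.prems by auto
    then have "T (poly_act T q v) - scale c (poly_act T q v) \<noteq> 0"
      using inj[of "poly_act T q v" c] by auto
    moreover have "T (poly_act T q v) - scale c (poly_act T q v) \<in> N"
      using IH N by (auto intro: subspace_diff subspace_scale)
    ultimately show ?thesis unfolding q poly_act_factor by simp
  qed
qed

text \<open>Multiplying a relation between the vectors (T - c)^(-1) v by the product of all T - c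
  clears denominators and gives q(T) v = 0 with a polynomial q \<noteq> 0, against
  injectivity.\<close>

lemma resolvent_independent:
  assumes N: "subspace N" "\<And>v. v \<in> N \<Longrightarrow> T v \<in> N"
    and inj: "\<And>c v. v \<in> N \<Longrightarrow> T v = scale c v \<Longrightarrow> v = 0"
    and v: "v \<in> N" "v \<noteq> 0" and u: "\<And>c. T (u c) - scale c (u c) = v"
  shows "inj u" "independent (range u)"
proof -
  have u0: "u c \<noteq> 0" for c using u[of c] v(2) by (auto simp: linear_rules[OF T])
  show "inj u"
  proof (rule injI)
    fix c d assume "u c = u d"
    then have "T (u c) - scale c (u c) = T (u c) - scale d (u c)" using u[of c] u[of d] by simp
    then have "scale c (u c) = scale d (u c)" by simp
    then show "c = d" using u0[of c] by (simp only: scale_cancel_right) simp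
  qed
  have rel: "\<forall>c\<in>F. a c = 0" if F: "finite F" and 0: "(\<Sum>c\<in>F. scale (a c) (u c)) = 0" for F a
  proof (rule ccontr)
    define P where "P = (\<lambda>G. \<Prod>c\<in>G. [:- c, 1::complex:])"
    \<comment> \<open>The numerator of the sum of the a(c) / (t - c). At \<open>c0\<close> every
      summand but one vanishes, as in Lagrange interpolation.\<close>
    define q where "q = (\<Sum>c\<in>F. smult (a c) (P (F - {c})))"
    assume "\<not> (\<forall>c\<in>F. a c = 0)"
    then obtain c0 where c0: "c0 \<in> F" "a c0 \<noteq> 0" by blast
    have "poly (P G) c = 0 \<longleftrightarrow> c \<in> G" if "finite G" for G c
      using that by (simp add: P_def poly_prod prod_zero_iff)
    then have "poly q c0 = (\<Sum>c\<in>F. if c = c0 then a c0 * poly (P (F - {c0})) c0 else 0)"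
      unfolding q_def poly_sum using F c0(1) by (intro sum.cong) auto
    also have "\<dots> = a c0 * poly (P (F - {c0})) c0" using F c0(1) by simp
    also have "\<dots> \<noteq> 0"
      using c0 F by (simp add: P_def poly_prod prod_zero_iff)
    finally have "q \<noteq> 0" by auto
    then have "poly_act T q v \<noteq> 0" using poly_act_injective[of N q v] N inj v by blast
    moreover have "poly_act T (P F) (u c) = poly_act T (P (F - {c})) v" if "c \<in> F" for c
    proof -
      have "P F = [:- c, 1:] * P (F - {c})" unfolding P_def by (rule prod.remove[OF F that])
      then show ?thesis by (simp only: poly_act_factor' u)
    qed
    then have "poly_act T (P F) (\<Sum>c\<in>F. scale (a c) (u c)) = poly_act T q v"
      unfolding q_def by (simp add: poly_act_sum poly_act_smult linear_rules[OF poly_act_linear])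
    ultimately show False using 0 by (simp add: linear_rules[OF poly_act_linear])
  qed
  show "independent (range u)"
    unfolding dependent_explicit
  proof (clarsimp)
    fix t r w assume t: "finite t" "t \<subseteq> range u" "(\<Sum>x\<in>t. scale (r x) x) = 0" "w \<in> t"
    define F where "F = u -` t"
    have F: "finite F" "t = u ` F"
      using t \<open>inj u\<close> by (auto simp: F_def intro: finite_vimageI)
    have "(\<Sum>c\<in>F. scale (r (u c)) (u c)) = 0"
      using t(3) unfolding F(2) by (subst (asm) sum.reindex) (use \<open>inj u\<close> in \<open>auto intro: inj_on_subset\<close>)
    from rel[OF F(1) this] show "r w = 0" using t(4) F(2) by auto
  qed
qed

end

text \<open>\<open>N\<close> has countable dimension, whereas without an eigenvalue of \<open>T\<close> the
  vectors \<open>(T - c)\<inverse> v\<close>, \<open>c \<in> \<complex>\<close>, would be linearly independent.\<close>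

lemma commuting_simple_scalar:
  fixes f :: "'k::countable \<Rightarrow> 'm \<Rightarrow> 'm"
  assumes f: "\<And>k. Vector_Spaces.linear scale scale (f k)"
    and N: "subspace N" "\<And>k v. v \<in> N \<Longrightarrow> f k v \<in> N" "N \<noteq> {0}"
    and simple: "\<And>N'. subspace N' \<Longrightarrow> N' \<subseteq> N \<Longrightarrow> (\<And>k v. v \<in> N' \<Longrightarrow> f k v \<in> N') \<Longrightarrow> N' = {0} \<or> N' = N"
    and T: "Vector_Spaces.linear scale scale T" "\<And>v. v \<in> N \<Longrightarrow> T v \<in> N"
    and comm: "\<And>k v. v \<in> N \<Longrightarrow> T (f k v) = f k (T v)"
  shows "\<exists>c. \<forall>v\<in>N. T v = scale c v"
proof (rule ccontr)
  assume no: "\<not> ?thesis"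
  note rules = linear_rules[OF T(1)] linear_rules[OF f]
  obtain v where v: "v \<in> N" "v \<noteq> 0" using N(1,3) subspace_0 by blast
  have inj: "w = 0" if "w \<in> N" "T w = scale c w" for c w
  proof -
    let ?K = "{w \<in> N. T w = scale c w}"
    have "subspace ?K" using N(1)
      by (auto simp: subspace_def rules scale_right_distrib mult.commute)
    moreover have "f k w \<in> ?K" if "w \<in> ?K" for k w
      using that N(2) comm by (auto simp: rules)
    moreover have "?K \<noteq> N" using no by blast
    ultimately have "?K = {0}" using simple[of ?K] by blast
    then show ?thesis using that by blast
  qed
  \<comment> \<open>The image of T - c is a nonzero submodule of \<open>N\<close>, hence
    \<open>N\<close> itself; this supplies the resolvent vectors.\<close>
  have "\<exists>w\<in>N. T w - scale c w = v" for c
  proof -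
    let ?I = "(\<lambda>w. T w - scale c w) ` N"
    have lin: "Vector_Spaces.linear scale scale (\<lambda>w. T w - scale c w)"
      by (rule linearI_rules) (simp_all add: rules scale_right_distrib scale_right_diff_distrib mult.commute)
    interpret L: Vector_Spaces.linear scale scale "\<lambda>w. T w - scale c w" by (rule lin)
    have "subspace ?I" using N(1) by (rule L.subspace_image)
    moreover have "?I \<subseteq> N" using N(1) T(2) by (auto intro: subspace_diff subspace_scale)
    moreover have "f k w \<in> ?I" if "w \<in> ?I" for k w
    proof -
      from that obtain y where y: "y \<in> N" "w = T y - scale c y" by blast
      then have "f k w = T (f k y) - scale c (f k y)" by (simp add: rules comm)
      then show ?thesis using N(2) y by blast
    qed
    moreover have "?I \<noteq> {0}"
    proof
      assume "?I = {0}"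
      then have "\<forall>w\<in>N. T w - scale c w = 0" by blast
      then have "\<forall>w\<in>N. T w = scale c w" by simp
      then show False using no by blast
    qed
    ultimately have "?I = N" using simple[of ?I] by blast
    then have "v \<in> ?I" using v(1) by simp
    then show ?thesis by auto
  qed
  then obtain u where u: "\<And>c. T (u c) - scale c (u c) = v" and uN: "range u \<subseteq> N"
    by (metis image_subsetI)
  \<comment> \<open>The words in the operators \<open>f k\<close> applied to \<open>v\<close>: they
    span a nonzero submodule, hence \<open>N\<close>, and a countable index type admits only
    countably many words.\<close>
  define B where "B = range (\<lambda>ks. foldr f ks v)"
  have B: "countable B" by (simp add: B_def)
  have BN: "B \<subseteq> N"
  proof -
    have "foldr f ks v \<in> N" for ks by (induction ks) (auto intro: v N(2))
    then show ?thesis by (auto simp: B_def)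
  qed
  have "f k w \<in> span B" if "w \<in> span B" for k w
    using that
  proof (induction rule: span_induct_alt)
    case base then show ?case by (simp add: rules span_zero)
  next
    case (step c b w)
    then obtain ks where "b = foldr f ks v" by (auto simp: B_def)
    then have "f k b = foldr f (k # ks) v" by simp
    then have "f k b \<in> B" unfolding B_def by (metis rangeI)
    then show ?case using step by (auto simp: rules intro!: span_add span_scale intro: span_base)
  qed
  moreover have "span B \<subseteq> N" using BN N(1) by (rule span_minimal)
  moreover have "span B \<noteq> {0}"
  proof -
    have "foldr f [] v \<in> B" unfolding B_def by blast
    then have "v \<in> span B" by (auto intro: span_base)
    then show ?thesis using v(2) by auto
  qed
  ultimately have spB: "span B = N" using simple[of "span B"] by auto
  have ind: "inj u" "independent (range u)"
    by (rule resolvent_independent[OF T(1) N(1) T(2) _ v u]; use inj in blast)+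
  have "countable (range u)"
    by (rule countable_independent[OF B ind(2)]) (use uN spB in auto)
  then have "countable (UNIV :: complex set)"
    using ind(1) by (simp add: countable_image_inj_eq)
  then show False using uncountable_UNIV_complex by blast
qed

end

section \<open>Weight spaces of a bounded module\<close>

instance osp_index :: countable by countable_datatype

text \<open>The diagonal generators for even and odd indices alike; \<open>hm\<close> offers them
  only for even ones, because \<open>wedge\<close> needs an even index.\<close>

definition dg :: "osp_index \<Rightarrow> smatrix" where
  "dg i = (\<lambda>p q. of_bool (p = q) * (of_bool (p = i) - of_bool (p = neg i)))"

lemma dg_cartan:
  assumes "in_range X a b i" shows "dg i \<in> osp_cartan X a b"
proof -
  have nz: "dg i p q \<noteq> 0 \<Longrightarrow> p = q \<and> (p = i \<or> p = neg i)" for p q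
    by (auto simp: dg_def split: if_splits)
  have "dg i \<in> osp X a b 0"
    unfolding osp_def
  proof (intro CollectI conjI allI impI)
    show "finite {(p, q). dg i p q \<noteq> 0}"
      by (rule finite_subset[of _ "{i, neg i} \<times> {i, neg i}"]) (auto dest: nz)
    show "in_range X a b p" "in_range X a b q" "parity p = parity q + 0" if "dg i p q \<noteq> 0" for p q
      using nz[OF that] assms by auto
    fix j k
    have 1: "(\<Sum>p | dg i p j \<noteq> 0. dg i p j * osp_form p k) = (\<Sum>p\<in>{j}. dg i p j * osp_form p k)"
      by (rule sum_support_left) (auto dest: nz)
    have 2: "(\<Sum>p | dg i p k \<noteq> 0. osp_form j p * dg i p k) = (\<Sum>p\<in>{k}. osp_form j p * dg i p k)"
      by (rule sum_support_left) (auto dest: nz)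
    have "dg i j j + dg i (neg j) (neg j) = 0"
      by (cases "j = i"; cases "j = neg i") (auto simp: dg_def)
    moreover have "osp_form j k = 0 \<or> k = neg j" using osp_form_nonzero by blast
    ultimately have "dg i j j * osp_form j k + osp_form j k * dg i k k = 0"
      by (auto simp: mult.commute simp flip: distrib_left)
    then show "(\<Sum>p | dg i p j \<noteq> 0. dg i p j * osp_form p k)
        + koszul_sign 0 (parity j) * (\<Sum>p | dg i p k \<noteq> 0. osp_form j p * dg i p k) = 0"
      unfolding 1 2 by simp
  qed
  then show ?thesis by (auto simp: osp_cartan_def dg_def)
qed

text \<open>The factor 1/2 again: \<open>i\<close> and \<open>neg i\<close> contribute equally, as
  both the diagonal entry and \<open>dg\<close> change sign.\<close>

lemma cartan_decompose:
  assumes H: "H \<in> osp_cartan X a b"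
  shows "H = (\<lambda>p q. \<Sum>i\<in>{i. H i i \<noteq> 0}. H i i / 2 * dg i p q)"
proof (intro ext)
  fix p q
  have "finite {(i, j). H i j \<noteq> 0}" using H by (auto simp: osp_cartan_def osp_def)
  then have fin: "finite {i. H i i \<noteq> 0}"
    by (rule finite_subset[rotated, OF finite_imageI[of _ fst]]) force
  have "(\<Sum>i\<in>{i. H i i \<noteq> 0}. H i i / 2 * dg i p q)
    = of_bool (p = q) * (\<Sum>i\<in>{i. H i i \<noteq> 0}. (if i = p then H p p / 2 else 0) - (if i = neg p then H (neg p) (neg p) / 2 else 0))"
    unfolding sum_distrib_left by (rule sum.cong) (auto simp: dg_def)
  also have "\<dots> = of_bool (p = q) * H p p"
    using fin by (auto simp: sum_subtractf cartan_neg_diag[OF H])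
  also have "\<dots> = H p q" using cartan_offdiag[OF H] by auto
  finally show "H p q = (\<Sum>i\<in>{i. H i i \<noteq> 0}. H i i / 2 * dg i p q)" by simp
qed

locale osp_module = lie_supermodule scale "osp X a b" M \<rho>
  for X :: osp_type and a b :: enat and scale :: "complex \<Rightarrow> 'm::ab_group_add \<Rightarrow> 'm"
    and M :: "bit \<Rightarrow> 'm set" and \<rho> :: "smatrix \<Rightarrow> 'm \<Rightarrow> 'm" +
  assumes infinite_rank: "a = \<infinity> \<or> b = \<infinity>"
    and bounded: "bounded_weight_module scale M \<rho> (osp_cartan X a b)"
begin

sublocale complex_vector_space scale ..

abbreviation "\<gg> \<equiv> super_total (osp X a b)"
abbreviation "\<hh> \<equiv> osp_cartan X a b"

lemma total_mem: "A \<in> osp X a b p \<Longrightarrow> A \<in> \<gg>"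
proof -
  assume A: "A \<in> osp X a b p"
  have "p = 0 \<or> p = 1" by (metis bit_not_one_iff)
  then show ?thesis
  proof
    assume "p = 0"
    then show ?thesis using A osp_zero[of X a b 1] unfolding super_total_def
      by (intro CollectI exI[of _ A] exI[of _ "\<lambda>i j. 0"]) auto
  next
    assume "p = 1"
    then show ?thesis using A osp_zero[of X a b 0] unfolding super_total_def
      by (intro CollectI exI[of _ "\<lambda>i j. 0"] exI[of _ A]) auto
  qed
qed

lemma total_combine:
  assumes "A \<in> \<gg>" "B \<in> \<gg>" shows "(\<lambda>i j. c * A i j + d * B i j) \<in> \<gg>"
proof -
  obtain A0 A1 B0 B1 where "A0 \<in> osp X a b 0" "A1 \<in> osp X a b 1" "B0 \<in> osp X a b 0" "B1 \<in> osp X a b 1"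
    "A = (\<lambda>i j. A0 i j + A1 i j)" "B = (\<lambda>i j. B0 i j + B1 i j)"
    using assms unfolding super_total_def by auto
  then show ?thesis
    unfolding super_total_def using osp_combine[of A0 X a b 0 B0 c d] osp_combine[of A1 X a b 1 B1 c d]
    by (intro CollectI exI[of _ "\<lambda>i j. c * A0 i j + d * B0 i j"] exI[of _ "\<lambda>i j. c * A1 i j + d * B1 i j"])
      (auto simp: algebra_simps)
qed

lemma total_zero: "(\<lambda>i j. 0) \<in> \<gg>"
  using total_mem osp_zero by blast

lemma total_scale: "A \<in> \<gg> \<Longrightarrow> (\<lambda>i j. c * A i j) \<in> \<gg>"
  using total_combine[of A "\<lambda>i j. 0" c 0] total_zero by simp

lemma rho_zero: "\<rho> (\<lambda>i j. 0) m = 0"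
  using action_scale[OF total_zero, of 0] by simp

lemma rho_combine:
  assumes "A \<in> \<gg>" "B \<in> \<gg>"
  shows "\<rho> (\<lambda>i j. c * A i j + d * B i j) m = scale c (\<rho> A m) + scale d (\<rho> B m)"
  using assms by (simp add: action_add[OF total_scale total_scale] action_scale)

lemma rho_sum:
  assumes "finite T" "\<And>t. t \<in> T \<Longrightarrow> B t \<in> \<gg>"
  shows "(\<lambda>i j. \<Sum>t\<in>T. c t * B t i j) \<in> \<gg> \<and>
    \<rho> (\<lambda>i j. \<Sum>t\<in>T. c t * B t i j) m = (\<Sum>t\<in>T. scale (c t) (\<rho> (B t) m))"
  using assms
proof (induction T rule: finite_induct)
  case empty
  then show ?case by (simp add: total_zero rho_zero)
next
  case (insert t T)
  then have IH: "(\<lambda>i j. \<Sum>t\<in>T. c t * B t i j) \<in> \<gg>"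
    "\<rho> (\<lambda>i j. \<Sum>t\<in>T. c t * B t i j) m = (\<Sum>t\<in>T. scale (c t) (\<rho> (B t) m))" by auto
  have t: "B t \<in> \<gg>" using insert by simp
  show ?case
    using total_combine[OF t IH(1), of "c t" 1] rho_combine[OF t IH(1), of "c t" 1 m] IH(2) insert.hyps
    by simp
qed

section \<open>Root vectors acting on the module\<close>

definition ev :: "osp_index \<Rightarrow> bool" where
  "ev i \<longleftrightarrow> parity i = 0 \<and> in_range X a b i"

text \<open>Extended by zero outside the admissible indices, so that linearity and the shift of
  weights hold without side conditions.\<close>

definition act :: "osp_index \<Rightarrow> osp_index \<Rightarrow> 'm \<Rightarrow> 'm" where
  "act i j = (if ev i \<and> in_range X a b j then \<rho> (wedge i j) else (\<lambda>_. 0))"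

lemma ev_neg [simp]: "ev (neg i) \<longleftrightarrow> ev i"
  by (simp add: ev_def)

lemma ev_in_range: "ev i \<Longrightarrow> in_range X a b i"
  by (simp add: ev_def)

lemma wedge_total: "ev i \<Longrightarrow> in_range X a b j \<Longrightarrow> wedge i j \<in> \<gg>"
  using wedge_mem[of i X a b j] total_mem by (auto simp: ev_def)

lemma act_linear: "Vector_Spaces.linear scale scale (act i j)"
proof (cases "ev i \<and> in_range X a b j")
  case True
  then show ?thesis using action_linear[OF wedge_total] by (simp add: act_def)
next
  case False
  then have "act i j = (\<lambda>_. 0)" unfolding act_def by (rule if_not_P)
  then show ?thesis by (auto intro: linearI_rules)
qed

lemmas act_rules = linear_rules[OF act_linear]

lemma act_self: "act u u m = 0"
proof -
  have "wedge u u = (\<lambda>i j. 0)" by (simp add: wedge_def)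
  then show ?thesis by (simp add: act_def rho_zero)
qed

lemma act_swap: "ev u \<Longrightarrow> ev w \<Longrightarrow> act w u m = - act u w m"
proof -
  assume *: "ev u" "ev w"
  have "wedge w u = (\<lambda>i j. (- 1) * wedge u w i j)" by (auto simp: wedge_def fun_eq_iff)
  then show ?thesis using * action_scale[OF wedge_total[of u w], of "- 1" m]
    by (simp add: act_def ev_in_range)
qed

lemma act_bracket:
  assumes u: "ev u" and x: "ev x" and w: "in_range X a b w" and y: "in_range X a b y"
    and ux: "osp_form u x = 0 \<or> parity w = 0"
  shows "act u w (act x y m) = scale (koszul_sign (parity w) (parity y)) (act x y (act u w m))
    + scale (osp_form w x) (act u y m) - scale (osp_form u x) (act w y m)
    + scale (osp_form w y) (act x u m) - scale (osp_form u y) (act x w m)"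
proof -
  have mem: "wedge u w \<in> osp X a b (parity w)" "wedge x y \<in> osp X a b (parity y)"
    using assms by (auto simp: ev_def intro: wedge_mem)
  \<comment> \<open>If both \<open>w\<close> and \<open>y\<close> are odd, \<open>wedge w y\<close>
    may lie outside the superalgebra; its coefficient is then zero and it is replaced by the zero
    matrix.\<close>
  define T where "T = (if osp_form u x = 0 then (\<lambda>i j. 0) else wedge w y)"
  have T: "T \<in> \<gg>" using ux w y by (auto simp: T_def total_zero intro!: wedge_total) (auto simp: ev_def)
  have rT: "scale (osp_form u x) (\<rho> T m) = scale (osp_form u x) (act w y m)"
    using ux w y by (auto simp: T_def act_def ev_def)
  have tot: "wedge u y \<in> \<gg>" "wedge x u \<in> \<gg>" "wedge x w \<in> \<gg>"
    using assms by (auto intro: wedge_total ev_in_range)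
  define C1 where "C1 = (\<lambda>i j. osp_form w x * wedge u y i j + (- osp_form u x) * T i j)"
  define C2 where "C2 = (\<lambda>i j. osp_form w y * wedge x u i j + (- osp_form u y) * wedge x w i j)"
  have C: "C1 \<in> \<gg>" "C2 \<in> \<gg>" unfolding C1_def C2_def by (intro total_combine T tot)+
  have "superbracket (parity w) (parity y) (wedge u w) (wedge x y)
      = (\<lambda>i j. 1 * C1 i j + 1 * C2 i j)"
    using u x ux by (subst superbracket_wedge) (auto simp: ev_def C1_def C2_def T_def algebra_simps)
  then have "\<rho> (superbracket (parity w) (parity y) (wedge u w) (wedge x y)) m
      = \<rho> C1 m + \<rho> C2 m"
    using rho_combine[OF C, of 1 1 m] by simp
  also have "\<rho> C1 m = scale (osp_form w x) (\<rho> (wedge u y) m) - scale (osp_form u x) (act w y m)"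
    unfolding C1_def rT[symmetric] by (subst rho_combine[OF tot(1) T]) simp
  also have "\<rho> C2 m = scale (osp_form w y) (\<rho> (wedge x u) m) - scale (osp_form u y) (\<rho> (wedge x w) m)"
    unfolding C2_def by (subst rho_combine[OF tot(2,3)]) simp
  finally show ?thesis
    unfolding action_bracket[OF mem] using assms by (simp add: act_def ev_in_range algebra_simps)
qed

section \<open>Weight vectors: existence, grading and multiplicity bound\<close>

definition W :: "(smatrix \<Rightarrow> complex) \<Rightarrow> 'm set" where
  "W \<mu> = {m. \<forall>H\<in>\<hh>. \<rho> H m = scale (\<mu> H) m}"

lemma W_eq: "W \<mu> = weight_space scale \<rho> \<hh> \<mu>"
  by (simp add: W_def weight_space_def)

text \<open>Weights are extended by zero outside the Cartan subalgebra, so that distinct ones differ on it.\<close>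

definition wts :: "(smatrix \<Rightarrow> complex) set" where
  "wts = {\<mu>. \<forall>H. H \<notin> \<hh> \<longrightarrow> \<mu> H = 0}"

definition rt :: "osp_index \<Rightarrow> smatrix \<Rightarrow> complex" where
  "rt i = (\<lambda>H. if H \<in> \<hh> then H i i else 0)"

lemma rt_wts: "rt i \<in> wts"
  by (simp add: wts_def rt_def)

lemma wts_add: "\<mu> \<in> wts \<Longrightarrow> \<nu> \<in> wts \<Longrightarrow> \<mu> + \<nu> \<in> wts"
  and wts_diff: "\<mu> \<in> wts \<Longrightarrow> \<nu> \<in> wts \<Longrightarrow> \<mu> - \<nu> \<in> wts"
  by (auto simp: wts_def)

lemma rt_neg: "rt (neg i) = - rt i"
  by (auto simp: rt_def fun_eq_iff cartan_neg_diag)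

lemma cartan_total: "H \<in> \<hh> \<Longrightarrow> H \<in> \<gg>"
  using cartan_subset total_mem by blast

lemma rho_H_linear: "H \<in> \<hh> \<Longrightarrow> Vector_Spaces.linear scale scale (\<rho> H)"
  by (intro action_linear cartan_total)

lemma subspace_W: "subspace (W \<mu>)"
  unfolding W_def subspace_def
  by (auto simp: linear_rules[OF rho_H_linear] scale_right_distrib mult.commute)

lemma rho_H_comm: "H \<in> \<hh> \<Longrightarrow> K \<in> \<hh> \<Longrightarrow> \<rho> H (\<rho> K m) = \<rho> K (\<rho> H m)"
  using action_bracket[of H 0 K 0 m] superbracket_cartan_cartan[of H X a b K] cartan_subset[of X a b]
  by (auto simp: rho_zero)

lemma rho_H_act:
  assumes "H \<in> \<hh>"
  shows "\<rho> H (act u w m) = act u w (\<rho> H m) + scale (H u u + H w w) (act u w m)"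
proof (cases "ev u \<and> in_range X a b w")
  case True
  then have mem: "wedge u w \<in> osp X a b (parity w)" by (auto simp: ev_def intro: wedge_mem)
  have "H \<in> osp X a b 0" using assms cartan_subset by blast
  from action_bracket[OF this mem, of m] show ?thesis
    using True superbracket_cartan_wedge[OF assms, of u w] action_scale[OF wedge_total[of u w], of "H u u + H w w" m]
    by (simp add: act_def ev_def algebra_simps)
next
  case False
  then show ?thesis by (auto simp: act_def linear_rules[OF rho_H_linear[OF assms]])
qed

lemma act_W: "m \<in> W \<mu> \<Longrightarrow> act u w m \<in> W (\<mu> + (rt u + rt w))"
  unfolding W_def by (auto simp: rho_H_act act_rules rt_def simp flip: scale_left_distrib)

text \<open>The bound on dimensions is assumed for linear functionals, whereas \<open>W\<close>
  takes arbitrary functions. A nonzero weight vector forces linearity, so the bound extends to all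
  of them.\<close>

lemma W_functional:
  assumes "v \<in> W \<mu>" "v \<noteq> 0" shows "\<mu> \<in> functionals \<hh>"
  unfolding functionals_def
proof (intro CollectI conjI ballI allI)
  fix A B c assume AB: "A \<in> \<hh>" "B \<in> \<hh>"
  have "(\<lambda>i j. A i j + B i j) \<in> \<hh>" using cartan_combine[OF AB, of 1 1] by simp
  then have "scale (\<mu> (\<lambda>i j. A i j + B i j)) v = scale (\<mu> A + \<mu> B) v"
    using assms(1) AB action_add[OF cartan_total cartan_total, OF AB, of v]
    by (auto simp: W_def scale_left_distrib)
  then show "\<mu> (\<lambda>i j. A i j + B i j) = \<mu> A + \<mu> B" using assms(2) by simp
next
  fix A c assume A: "A \<in> \<hh>"
  have "(\<lambda>i j. c * A i j) \<in> \<hh>" using cartan_combine[OF A cartan_zero, of c 0] by simp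
  then have "scale (\<mu> (\<lambda>i j. c * A i j)) v = scale (c * \<mu> A) v"
    using assms(1) A action_scale[OF cartan_total[OF A], of c v] by (auto simp: W_def)
  then show "\<mu> (\<lambda>i j. c * A i j) = c * \<mu> A" using assms(2) by simp
qed

text \<open>Semisimplicity over the Cartan subalgebra supplies simple submodules, not yet weights.
  As countably many elements \<open>dg i\<close> span it, Dixmier's lemma makes each Cartan element
  act on a simple submodule by a scalar.\<close>

lemma simple_in_W:
  assumes N: "simple_submodule scale \<rho> \<hh> N"
  shows "\<exists>\<mu>\<in>wts. N \<subseteq> W \<mu>"
proof -
  define f where "f = (\<lambda>i. if in_range X a b i then \<rho> (dg i) else (\<lambda>_. 0))"
  have f_lin: "Vector_Spaces.linear scale scale (f i)" for i
  proof (cases "in_range X a b i")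
    case True
    then show ?thesis by (simp add: f_def rho_H_linear dg_cartan)
  next
    case False
    then have "f i = (\<lambda>_. 0)" by (simp add: f_def)
    then show ?thesis by (auto intro: linearI_rules)
  qed
  have sub: "subspace N" and stable: "\<And>H v. H \<in> \<hh> \<Longrightarrow> v \<in> N \<Longrightarrow> \<rho> H v \<in> N" and "N \<noteq> {0}"
    and min: "\<And>N'. subspace N' \<Longrightarrow> \<forall>H\<in>\<hh>. \<forall>v\<in>N'. \<rho> H v \<in> N' \<Longrightarrow> N' \<subseteq> N \<Longrightarrow> N' = {0} \<or> N' = N"
    using N unfolding simple_submodule_def submodule_def by blast+
  have fN: "f i v \<in> N" if "v \<in> N" for i v
    using that stable[OF dg_cartan] sub by (auto simp: f_def subspace_0)
  have H_stable: "\<rho> H v \<in> N'" if H: "H \<in> \<hh>" and N': "subspace N'" "\<And>i v. v \<in> N' \<Longrightarrow> f i v \<in> N'" and v: "v \<in> N'" for H v N'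
  proof -
    have rng: "in_range X a b i" if "H i i \<noteq> 0" for i
      using H that by (auto simp: osp_cartan_def osp_def)
    have "finite {(i, j). H i j \<noteq> 0}" using H by (auto simp: osp_cartan_def osp_def)
    then have fin: "finite {i. H i i \<noteq> 0}"
      by (rule finite_subset[rotated, OF finite_imageI[of _ fst]]) force
    have "\<rho> H v = \<rho> (\<lambda>p q. \<Sum>i\<in>{i. H i i \<noteq> 0}. H i i / 2 * dg i p q) v"
      using cartan_decompose[OF H] by simp
    also have "\<dots> = (\<Sum>i\<in>{i. H i i \<noteq> 0}. scale (H i i / 2) (\<rho> (dg i) v))"
      using rho_sum[OF fin, of dg "\<lambda>i. H i i / 2" v] rng cartan_total[OF dg_cartan] by auto
    also have "\<dots> = (\<Sum>i\<in>{i. H i i \<noteq> 0}. scale (H i i / 2) (f i v))"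
      by (rule sum.cong) (auto simp: f_def rng)
    also have "\<dots> \<in> N'" using N' v by (auto intro!: subspace_sum subspace_scale)
    finally show ?thesis .
  qed
  have "\<exists>c. \<forall>v\<in>N. \<rho> H v = scale c v" if H: "H \<in> \<hh>" for H
  proof (rule commuting_simple_scalar[where f = f])
    show "N' = {0} \<or> N' = N" if "subspace N'" "N' \<subseteq> N" "\<And>k v. v \<in> N' \<Longrightarrow> f k v \<in> N'" for N'
      using min[OF that(1) _ that(2)] H_stable that(1,3) by blast
    show "\<rho> H (f k v) = f k (\<rho> H v)" for k v
      using rho_H_comm[OF H dg_cartan] linear_rules(3)[OF rho_H_linear[OF H]] by (auto simp: f_def)
  qed (use f_lin sub fN \<open>N \<noteq> {0}\<close> rho_H_linear[OF H] stable[OF H] in auto)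
  then obtain c where c: "\<And>H v. H \<in> \<hh> \<Longrightarrow> v \<in> N \<Longrightarrow> \<rho> H v = scale (c H) v" by metis
  show ?thesis
    by (rule bexI[of _ "\<lambda>H. if H \<in> \<hh> then c H else 0"]) (auto simp: W_def wts_def c)
qed

lemma W_spanning: "span (\<Union>\<mu>\<in>wts. W \<mu>) = UNIV"
proof -
  have "span (\<Union>{N. simple_submodule scale \<rho> \<hh> N}) = UNIV"
    using bounded by (simp add: bounded_weight_module_def weight_module_def semisimple_module_def)
  moreover have "\<Union>{N. simple_submodule scale \<rho> \<hh> N} \<subseteq> (\<Union>\<mu>\<in>wts. W \<mu>)"
    using simple_in_W by blast
  ultimately show ?thesis using span_mono top.extremum_unique by metis
qed

text \<open>Cartan elements are even, so the eigenvalue equation splits into its homogeneous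
  parts.\<close>

lemma W_graded:
  assumes m: "m \<in> W \<mu>" and uv: "m = u + v" "u \<in> M 0" "v \<in> M 1"
  shows "u \<in> W \<mu>" "v \<in> W \<mu>"
proof -
  have "\<rho> H u = scale (\<mu> H) u \<and> \<rho> H v = scale (\<mu> H) v" if H: "H \<in> \<hh>" for H
  proof -
    have H0: "H \<in> osp X a b 0" using H cartan_subset by blast
    have "\<rho> H u + \<rho> H v = scale (\<mu> H) u + scale (\<mu> H) v"
      using m H uv(1) by (auto simp: W_def linear_rules[OF rho_H_linear] scale_right_distrib)
    then have eq: "\<rho> H u - scale (\<mu> H) u = scale (\<mu> H) v - \<rho> H v" by (simp add: algebra_simps)
    have "\<rho> H u - scale (\<mu> H) u \<in> M 0"
      using action_parity[OF H0 uv(2)] uv(2) grading_subspace[of 0] by (auto intro: subspace_diff subspace_scale)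
    moreover have "scale (\<mu> H) v - \<rho> H v \<in> M 1"
      using action_parity[OF H0 uv(3)] uv(3) grading_subspace[of 1] by (auto intro: subspace_diff subspace_scale)
    ultimately have "\<rho> H u - scale (\<mu> H) u \<in> M 0 \<inter> M 1" using eq by simp
    then have "\<rho> H u - scale (\<mu> H) u = 0" unfolding grading_disjoint by simp
    then show ?thesis using eq by auto
  qed
  then show "u \<in> W \<mu>" "v \<in> W \<mu>" by (auto simp: W_def)
qed

lemma W_dim: "\<exists>D. \<forall>\<mu>. \<exists>B. finite B \<and> card B \<le> D \<and> W \<mu> \<subseteq> span B"
proof -
  obtain d :: "bit \<Rightarrow> nat" where d: "\<And>\<mu> p. \<mu> \<in> functionals \<hh> \<Longrightarrow> finite_dim scale (W \<mu> \<inter> M p) \<and> dim (W \<mu> \<inter> M p) \<le> d p"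
    using bounded unfolding bounded_weight_module_def W_eq by blast
  have basis: "\<exists>B. finite B \<and> card B \<le> d p \<and> W \<mu> \<inter> M p \<subseteq> span B" if \<mu>: "\<mu> \<in> functionals \<hh>" for \<mu> p
  proof -
    obtain B where B: "B \<subseteq> W \<mu> \<inter> M p" "independent B" "W \<mu> \<inter> M p \<subseteq> span B" "card B = dim (W \<mu> \<inter> M p)"
      using basis_exists by metis
    obtain B' where "finite B'" "W \<mu> \<inter> M p \<subseteq> span B'" using d[OF \<mu>, of p] by (auto simp: finite_dim_def)
    then have "finite B" using independent_span_bound[OF _ B(2)] B(1) by (meson subset_trans)
    then show ?thesis using B d[OF \<mu>, of p] by auto
  qed
  have "\<exists>B. finite B \<and> card B \<le> d 0 + d 1 \<and> W \<mu> \<subseteq> span B" for \<mu>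
  proof (cases "W \<mu> \<subseteq> {0}")
    case True
    then show ?thesis by (intro exI[of _ "{}"]) auto
  next
    case False
    then have \<mu>: "\<mu> \<in> functionals \<hh>" using W_functional by blast
    obtain B0 where B0: "finite B0" "card B0 \<le> d 0" "W \<mu> \<inter> M 0 \<subseteq> span B0" using basis[OF \<mu>] by blast
    obtain B1 where B1: "finite B1" "card B1 \<le> d 1" "W \<mu> \<inter> M 1 \<subseteq> span B1" using basis[OF \<mu>] by blast
    have "W \<mu> \<subseteq> span (B0 \<union> B1)"
    proof
      fix m assume m: "m \<in> W \<mu>"
      obtain u v where uv: "u \<in> M 0" "v \<in> M 1" "m = u + v" using grading_sum by blast
      then have "u \<in> span B0" "v \<in> span B1" using W_graded[OF m] B0 B1 by auto
      then have "u \<in> span (B0 \<union> B1)" "v \<in> span (B0 \<union> B1)"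
        using span_mono[of B0 "B0 \<union> B1"] span_mono[of B1 "B0 \<union> B1"] by auto
      then show "m \<in> span (B0 \<union> B1)" unfolding uv(3) by (rule span_add)
    qed
    moreover have "card (B0 \<union> B1) \<le> d 0 + d 1"
      using card_Un_le[of B0 B1] B0(2) B1(2) by linarith
    ultimately show ?thesis using B0(1) B1(1) by blast
  qed
  then show ?thesis by blast
qed

fun nr :: "osp_index \<Rightarrow> nat" where
  "nr (Eps i) = i" | "nr (Eps_neg i) = i" | "nr Eps_zero = 0" | "nr (Del j) = 0" | "nr (Del_neg j) = 0"

theorem act_nilpotent:
  assumes u: "ev u" and c: "ev c" and uu: "osp_form u u = 0" and uc: "osp_form u c = 0"
  shows "\<exists>s. \<forall>v. (act u c ^^ s) v = 0"
proof -
  \<comment> \<open>Infinitely many indices orthogonal to \<open>u\<close> and \<open>c\<close>: odd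
    ones are so automatically; if b is finite, then a is infinite and the even ones start beyond the
    positions of \<open>u\<close> and \<open>c\<close>.\<close>
  define ix where "ix = (\<lambda>t. if b = \<infinity> then Del t else Eps (Suc (max (nr u) (nr c)) + t))"
  define \<sigma> :: complex where "\<sigma> = (if b = \<infinity> then - 1 else 1)"
  have rng: "in_range X a b (ix t)" for t using infinite_rank by (auto simp: ix_def)
  have par: "koszul_sign (parity (ix s)) (parity (ix t)) = \<sigma>" for s t
    by (auto simp: ix_def \<sigma>_def)
  have u0: "osp_form u (ix t) = 0" "osp_form u (neg (ix t)) = 0" "osp_form (ix t) u = 0" "osp_form (neg (ix t)) u = 0" for t
    using u by (cases u; auto simp: ix_def ev_def)+
  have c0: "osp_form c (ix t) = 0" "osp_form c (neg (ix t)) = 0" "osp_form (ix t) c = 0" "osp_form (neg (ix t)) c = 0" for t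
    using c by (cases c; auto simp: ix_def ev_def)+
  have kk: "osp_form (ix s) (ix t) = 0" "osp_form (neg (ix s)) (neg (ix t)) = 0"
    "osp_form (ix s) (neg (ix t)) = (if s = t then 1 else 0)"
    "osp_form (neg (ix s)) (ix t) = (if s = t then \<sigma> else 0)" for s t
    by (auto simp: ix_def \<sigma>_def)
  have cu: "osp_form c u = 0" using uc u osp_form_sym_even[of u c] by (simp add: ev_def)
  have ep: "parity u = 0" "parity c = 0" using u c by (auto simp: ev_def)
  obtain D where D: "\<And>\<mu>. \<exists>B. finite B \<and> card B \<le> D \<and> W \<mu> \<subseteq> span B" using W_dim by blast
  note rr = ev_in_range[OF u] ev_in_range[OF c]
  \<comment> \<open>Here \<alpha> = \<sigma> because the form is antisymmetric on odd indices, and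
    \<theta> is the form on (c, c), nonzero only for \<open>Eps_zero\<close>.\<close>
  interpret heisenberg_action scale W D "\<lambda>t. act u (ix t)" "\<lambda>t. act u (neg (ix t))"
    "\<lambda>t. act c (neg (ix t))" "\<lambda>t. act c (ix t)" "act u c" \<sigma> \<sigma> 1 "osp_form c c" "rt u" "rt c" "\<lambda>t. rt (ix t)"
  proof
    show "\<exists>B. finite B \<and> card B \<le> D \<and> W \<mu> \<subseteq> span B" for \<mu> by (rule D)
    have "span (\<Union>\<mu>\<in>wts. W \<mu>) \<subseteq> span (\<Union>\<mu>. W \<mu>)" by (rule span_mono) blast
    then show "span (\<Union>\<mu>. W \<mu>) = UNIV" using W_spanning by auto
    show "act u (ix k) v \<in> W (\<mu> + (rt u + rt (ix k)))" if "v \<in> W \<mu>" for v \<mu> k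
      using act_W[OF that] .
    show "act u (neg (ix k)) v \<in> W (\<mu> + (rt u - rt (ix k)))" if "v \<in> W \<mu>" for v \<mu> k
      using act_W[OF that, of u "neg (ix k)"] by (simp add: rt_neg)
    show "act c (neg (ix k)) v \<in> W (\<mu> + (rt c - rt (ix k)))" if "v \<in> W \<mu>" for v \<mu> k
      using act_W[OF that, of c "neg (ix k)"] by (simp add: rt_neg)
    show "act c (ix k) v \<in> W (\<mu> + (rt c + rt (ix k)))" if "v \<in> W \<mu>" for v \<mu> k
      using act_W[OF that] .
    show "act u (ix j) (act u (ix k) v) = scale \<sigma> (act u (ix k) (act u (ix j) v))" for j k v
      using act_bracket[OF u u rng rng, of j k v] by (simp add: uu u0 kk par)
    show "act u (neg (ix j)) (act u (ix k) v) = scale \<sigma> (act u (ix k) (act u (neg (ix j)) v))" for j k v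
      using act_bracket[OF u u _ rng, of "neg (ix j)" k v] rng by (simp add: uu u0 kk par act_self)
    show "act c (neg (ix j)) (act u (ix k) v) = scale \<sigma> (act u (ix k) (act c (neg (ix j)) v))
        + (if j = k then scale \<sigma> (act u c v) else 0)" for j k v
      using act_bracket[OF c u _ rng, of "neg (ix j)" k v] rng by (simp add: cu u0 c0 kk par)
    show "act c (neg (ix j)) (act u (neg (ix k)) v) = scale \<sigma> (act u (neg (ix k)) (act c (neg (ix j)) v))" for j k v
      using act_bracket[OF c u, of "neg (ix j)" "neg (ix k)" v] rng by (simp add: cu u0 c0 kk par)
    show "act c (ix j) (act u (ix k) v) = scale \<sigma> (act u (ix k) (act c (ix j) v))" for j k v
      using act_bracket[OF c u rng rng, of j k v] by (simp add: cu u0 c0 kk par)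
    show "act c (ix j) (act u (neg (ix k)) v) = scale \<sigma> (act u (neg (ix k)) (act c (ix j) v))
        + (if j = k then scale 1 (act u c v) else 0)" for j k v
      using act_bracket[OF c u rng, of "neg (ix k)" j v] rng by (simp add: cu u0 c0 kk par)
    show "act u c (act u (ix k) v) = act u (ix k) (act u c v)" for k v
      using act_bracket[OF u u _ rng, of c k v] rr by (simp add: cu uu u0 c0 kk ep)
    show "act u c (act u (neg (ix k)) v) = act u (neg (ix k)) (act u c v)" for k v
      using act_bracket[OF u u, of c "neg (ix k)" v] rng rr by (simp add: cu uu u0 c0 kk ep)
    show "act u c (act c (neg (ix k)) v) = act c (neg (ix k)) (act u c v) + scale (osp_form c c) (act u (neg (ix k)) v)" for k v
      using act_bracket[OF u c, of c "neg (ix k)" v] rng rr by (simp add: uc u0 c0 kk ep)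
  qed (auto simp: \<sigma>_def act_rules)
  show ?thesis by (rule e_nilpotent)
qed

end

section \<open>Local finiteness\<close>

context complex_vector_space
begin

text \<open>The standard sl2 computation in the quotient by \<open>S\<close>, with \<open>h\<close>
  the bracket of \<open>e\<close> and \<open>f\<close> and an arbitrary \<kappa> in place of 2, as
  short roots come with \<kappa> = 1.\<close>

lemma sl2_lower:
  assumes e: "Vector_Spaces.linear scale scale e" and f: "Vector_Spaces.linear scale scale f"
    and S: "subspace S" "\<And>v. v \<in> S \<Longrightarrow> f v \<in> S"
    and ef: "\<And>v. e (f v) = f (e v) + h v" and hf: "\<And>v. h (f v) = f (h v) - scale \<kappa> (f v)"
    and v: "h v = scale c v" "e v \<in> S"
  shows "h ((f ^^ j) v) = scale (c - \<kappa> * of_nat j) ((f ^^ j) v) \<and>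
    e ((f ^^ Suc j) v) - scale (of_nat (Suc j) * (c - \<kappa> * of_nat j / 2)) ((f ^^ j) v) \<in> S"
proof (induction j)
  case 0
  show ?case using S(2)[OF v(2)] v(1) by (simp add: ef)
next
  case (Suc j)
  let ?w = "(f ^^ j) v"
  have h: "h (f ?w) = scale (c - \<kappa> * of_nat (Suc j)) (f ?w)"
  proof -
    have "c - \<kappa> * of_nat (Suc j) = (c - \<kappa> * of_nat j) - \<kappa>" by (simp add: algebra_simps)
    moreover have "h ?w = scale (c - \<kappa> * of_nat j) ?w" using Suc by (rule conjunct1)
    then have "h (f ?w) = scale (c - \<kappa> * of_nat j) (f ?w) - scale \<kappa> (f ?w)"
      by (simp only: hf linear_rules(2)[OF f])
    ultimately show ?thesis by (simp only: scale_left_diff_distrib)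
  qed
  have "e (f ?w) - scale (of_nat (Suc j) * (c - \<kappa> * of_nat j / 2)) ?w \<in> S" using Suc by simp
  from S(2)[OF this]
  have "f (e (f ?w)) - scale (of_nat (Suc j) * (c - \<kappa> * of_nat j / 2)) (f ?w) \<in> S"
    by (simp add: linear_rules[OF f])
  moreover have "e (f (f ?w)) - scale (of_nat (Suc (Suc j)) * (c - \<kappa> * of_nat (Suc j) / 2)) (f ?w)
    = f (e (f ?w)) - scale (of_nat (Suc j) * (c - \<kappa> * of_nat j / 2)) (f ?w)"
  proof -
    have "of_nat (Suc (Suc j)) * (c - \<kappa> * of_nat (Suc j) / 2)
        = of_nat (Suc j) * (c - \<kappa> * of_nat j / 2) + (c - \<kappa> * of_nat (Suc j))"
      by (simp add: field_simps)
    then show ?thesis unfolding ef h by (simp add: scale_left_distrib)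
  qed
  ultimately show ?case using h by simp
qed

text \<open>At the last \<open>(f ^^ j) v\<close> outside \<open>S\<close>, applying
  \<open>e\<close> to the next vector of the string gives an element of \<open>S\<close>, so the
  coefficient in \<open>sl2_lower\<close> must vanish.\<close>

lemma sl2_highest:
  assumes e: "Vector_Spaces.linear scale scale e" and f: "Vector_Spaces.linear scale scale f"
    and S: "subspace S" "\<And>v. v \<in> S \<Longrightarrow> f v \<in> S" "\<And>v. v \<in> S \<Longrightarrow> e v \<in> S"
    and ef: "\<And>v. e (f v) = f (e v) + h v" and hf: "\<And>v. h (f v) = f (h v) - scale \<kappa> (f v)"
    and v: "h v = scale c v" "e v \<in> S" "v \<notin> S" and nil: "(f ^^ N) v \<in> S"
  shows "\<exists>j<N. c = \<kappa> * of_nat j / 2"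
proof -
  define l where "l = (LEAST l. (f ^^ l) v \<in> S)"
  have l: "(f ^^ l) v \<in> S" "l \<le> N" unfolding l_def using nil by (auto intro: LeastI Least_le)
  have "l \<noteq> 0" using l(1) v(3) by (intro notI) simp
  then obtain j where j: "l = Suc j" by (cases l) auto
  then have "(f ^^ j) v \<notin> S" unfolding l_def by (intro not_less_Least) auto
  moreover have "e ((f ^^ Suc j) v) \<in> S" using l(1) S(3) j by blast
  then have "scale (of_nat (Suc j) * (c - \<kappa> * of_nat j / 2)) ((f ^^ j) v) \<in> S"
    using sl2_lower[OF e f S(1,2) ef hf v(1,2), of j] S(1)
    by (metis (no_types, lifting) diff_diff_eq2 add_diff_cancel_left' subspace_diff)
  ultimately have "of_nat (Suc j) * (c - \<kappa> * of_nat j / 2) = 0"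
    using S(1) subspace_scale[of S _ "inverse (of_nat (Suc j) * (c - \<kappa> * of_nat j / 2))"]
    by (metis left_inverse scale_one scale_scale)
  then have "c = \<kappa> * of_nat j / 2" by (simp del: of_nat_Suc)
  then show ?thesis using l(2) j by (intro exI[of _ j]) auto
qed

text \<open>Fewer than \<open>s\<close> applications of \<open>e\<close> lead to a highest weight
  vector, whose weight \<open>sl2_highest\<close> restricts to \<kappa> j / 2 with j < s;
  subtracting the raising steps bounds \<open>c\<close>.\<close>

lemma sl2_weight_bound:
  assumes e: "Vector_Spaces.linear scale scale e" and f: "Vector_Spaces.linear scale scale f"
    and ef: "\<And>v. e (f v) = f (e v) + h v" and hf: "\<And>v. h (f v) = f (h v) - scale \<kappa> (f v)"
    and he: "\<And>v. h (e v) = e (h v) + scale \<kappa> (e v)"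
    and nil: "(e ^^ s) v = 0" "\<And>v. (f ^^ s) v = 0" and v: "h v = scale c v" "v \<noteq> 0"
  shows "cmod c \<le> 2 * cmod \<kappa> * real s"
proof -
  define l where "l = (LEAST l. (e ^^ l) v = 0)"
  have l: "(e ^^ l) v = 0" "l \<le> s" unfolding l_def using nil by (auto intro: LeastI Least_le)
  have "l \<noteq> 0" using l(1) v(2) by (intro notI) simp
  then obtain k where k: "l = Suc k" by (cases l) auto
  have hk: "h ((e ^^ i) v) = scale (c + \<kappa> * of_nat i) ((e ^^ i) v)" for i
    by (induction i) (simp_all add: v he linear_rules[OF e] algebra_simps)
  have nz: "(e ^^ k) v \<noteq> 0" using k unfolding l_def by (intro not_less_Least) auto
  have "\<exists>j<s. c + \<kappa> * of_nat k = \<kappa> * of_nat j / 2"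
  proof (rule sl2_highest[OF e f, of "{0}" h])
    show "e ((e ^^ k) v) \<in> {0}" using l(1) k by simp
  qed (use nz nil hk in \<open>auto simp: linear_rules[OF e] linear_rules[OF f] ef hf\<close>)
  then obtain j where j: "j < s" "c = \<kappa> * of_nat j / 2 - \<kappa> * of_nat k"
    by (auto simp: algebra_simps)
  have "cmod c \<le> cmod \<kappa> * real j / 2 + cmod \<kappa> * real k"
    unfolding j(2) using norm_triangle_ineq4[of "\<kappa> * of_nat j / 2" "\<kappa> * of_nat k"]
    by (simp add: norm_mult norm_divide)
  also have "\<dots> \<le> cmod \<kappa> * real s + cmod \<kappa> * real s"
  proof (rule add_mono)
    have "cmod \<kappa> * real j \<le> cmod \<kappa> * real s" using j(1) by (intro mult_left_mono) auto
    moreover have "0 \<le> cmod \<kappa> * real s" by simp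
    ultimately show "cmod \<kappa> * real j / 2 \<le> cmod \<kappa> * real s" by linarith
    show "cmod \<kappa> * real k \<le> cmod \<kappa> * real s" using k l(2) by (intro mult_left_mono) auto
  qed
  finally show ?thesis by (simp add: mult_ac)
qed

end

section \<open>Separation of weight components\<close>

context osp_module
begin

definition h_stable :: "'m set \<Rightarrow> bool" where
  "h_stable N \<longleftrightarrow> (\<forall>H\<in>\<hh>. \<forall>v\<in>N. \<rho> H v \<in> N)"

text \<open>The Vandermonde argument as an induction: a Cartan element on which \<nu> and \<nu>0
  differ removes the component of weight \<nu>0 and rescales the one of weight \<nu> by a nonzero
  factor.\<close>

lemma weight_components:
  assumes "finite \<Phi>" "\<Phi> \<subseteq> wts" "\<forall>\<nu>\<in>\<Phi>. g \<nu> \<in> W \<nu>"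
    and N: "subspace N" "h_stable N" and "(\<Sum>\<nu>\<in>\<Phi>. g \<nu>) \<in> N"
  shows "\<forall>\<nu>\<in>\<Phi>. g \<nu> \<in> N"
  using assms(1-3,6)
proof (induction \<Phi> arbitrary: g rule: finite_induct)
  case (insert \<nu>0 \<Phi>)
  have others: "g \<nu> \<in> N" if \<nu>: "\<nu> \<in> \<Phi>" for \<nu>
  proof -
    have "\<nu> \<noteq> \<nu>0" using insert.hyps \<nu> by auto
    then obtain H where H: "\<nu> H \<noteq> \<nu>0 H" by (auto simp: fun_eq_iff)
    have Hh: "H \<in> \<hh>"
    proof (rule ccontr)
      assume "H \<notin> \<hh>"
      then have "\<nu> H = 0" "\<nu>0 H = 0" using insert.prems(1) \<nu> by (auto simp: wts_def)
      then show False using H by simp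
    qed
    define g' where "g' = (\<lambda>\<mu>. scale (\<mu> H - \<nu>0 H) (g \<mu>))"
    have y: "\<rho> H (\<Sum>\<mu>\<in>insert \<nu>0 \<Phi>. g \<mu>) - scale (\<nu>0 H) (\<Sum>\<mu>\<in>insert \<nu>0 \<Phi>. g \<mu>) \<in> N"
      using N Hh insert.prems(3) by (auto simp: h_stable_def intro: subspace_diff subspace_scale)
    have "\<rho> H (\<Sum>\<mu>\<in>insert \<nu>0 \<Phi>. g \<mu>) = (\<Sum>\<mu>\<in>insert \<nu>0 \<Phi>. scale (\<mu> H) (g \<mu>))"
      unfolding linear_rules(6)[OF rho_H_linear[OF Hh]]
      by (rule sum.cong) (use insert.prems(2) Hh in \<open>auto simp: W_def\<close>)
    then have "\<rho> H (\<Sum>\<mu>\<in>insert \<nu>0 \<Phi>. g \<mu>) - scale (\<nu>0 H) (\<Sum>\<mu>\<in>insert \<nu>0 \<Phi>. g \<mu>)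
        = (\<Sum>\<mu>\<in>insert \<nu>0 \<Phi>. g' \<mu>)"
      by (simp only: scale_sum_right g'_def scale_left_diff_distrib sum_subtractf)
    also have "\<dots> = (\<Sum>\<mu>\<in>\<Phi>. g' \<mu>)" using insert.hyps by (simp add: g'_def)
    finally have "(\<Sum>\<mu>\<in>\<Phi>. g' \<mu>) \<in> N" using y by simp
    moreover have "g' \<mu> \<in> W \<mu>" if "\<mu> \<in> \<Phi>" for \<mu>
      using insert.prems(2) that subspace_W[of \<mu>] by (auto simp: g'_def intro: subspace_scale)
    ultimately have "g' \<nu> \<in> N" using insert.IH[of g'] insert.prems(1) \<nu> by simp
    then have "scale (inverse (\<nu> H - \<nu>0 H)) (g' \<nu>) \<in> N" using N(1) by (rule subspace_scale[rotated])
    then show ?thesis using H by (simp add: g'_def)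
  qed
  have "g \<nu>0 = (\<Sum>\<nu>\<in>insert \<nu>0 \<Phi>. g \<nu>) - (\<Sum>\<nu>\<in>\<Phi>. g \<nu>)" using insert.hyps by simp
  moreover have "(\<Sum>\<nu>\<in>\<Phi>. g \<nu>) \<in> N" using others by (intro subspace_sum N(1))
  ultimately have first: "g \<nu>0 \<in> N" using subspace_diff[OF N(1) insert.prems(3)] by simp
  show ?case using first others by (intro ballI) (elim insertE, simp_all)
qed simp

lemma h_stable_zero: "h_stable {0}"
  by (auto simp: h_stable_def linear_rules[OF rho_H_linear])

lemma graded_span_sum:
  assumes "y \<in> span (\<Union>\<nu>\<in>\<Psi>. S \<nu>)"
  shows "\<exists>\<Phi> g. finite \<Phi> \<and> \<Phi> \<subseteq> \<Psi> \<and> (\<forall>\<nu>. g \<nu> \<in> span (S \<nu>)) \<and> y = (\<Sum>\<nu>\<in>\<Phi>. g \<nu>)"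
  using assms
proof (induction rule: span_induct_alt)
  case base
  show ?case by (intro exI[of _ "{}"] exI[of _ "\<lambda>_. 0"]) (auto simp: span_zero)
next
  case (step c b y)
  then obtain \<nu> \<Phi> g where b: "\<nu> \<in> \<Psi>" "b \<in> S \<nu>" and g: "finite \<Phi>" "\<Phi> \<subseteq> \<Psi>" "\<And>\<nu>. g \<nu> \<in> span (S \<nu>)"
    "y = (\<Sum>\<nu>\<in>\<Phi>. g \<nu>)" by blast
  define g' where "g' = (\<lambda>\<mu>. (if \<mu> = \<nu> then scale c b else 0) + (if \<mu> \<in> \<Phi> then g \<mu> else 0))"
  have "(\<Sum>\<mu>\<in>insert \<nu> \<Phi>. g' \<mu>) = scale c b + (\<Sum>\<mu>\<in>insert \<nu> \<Phi>. if \<mu> \<in> \<Phi> then g \<mu> else 0)"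
    using g(1) by (simp add: g'_def sum.distrib sum.delta)
  also have "(\<Sum>\<mu>\<in>insert \<nu> \<Phi>. if \<mu> \<in> \<Phi> then g \<mu> else 0) = (\<Sum>\<mu>\<in>\<Phi>. g \<mu>)"
    using g(1) by (intro sum.mono_neutral_cong_right) auto
  finally have "scale c b + y = (\<Sum>\<mu>\<in>insert \<nu> \<Phi>. g' \<mu>)" using g(4) by simp
  moreover have "g' \<mu> \<in> span (S \<mu>)" for \<mu>
    using b(2) g(3)[of \<mu>] unfolding g'_def
    by (intro span_add) (auto simp: span_zero intro: span_scale span_base)
  ultimately show ?case using g(1,2) b(1) by (intro exI[of _ "insert \<nu> \<Phi>"] exI[of _ g']) auto
qed

lemma span_subset_W: "S \<subseteq> W \<nu> \<Longrightarrow> span S \<subseteq> W \<nu>"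
  using span_minimal subspace_W by blast

text \<open>Comparing components: \<open>y\<close> minus its expansion is a vanishing sum of weight
  vectors, so each component vanishes by \<open>weight_components\<close> with \<open>N\<close> =
  {0}.\<close>

lemma graded_span_weight:
  assumes y: "y \<in> span (\<Union>\<nu>\<in>\<Psi>. S \<nu>)" "y \<in> W \<mu>" "\<mu> \<in> wts" and \<Psi>: "\<Psi> \<subseteq> wts"
    and S: "\<And>\<nu>. \<nu> \<in> \<Psi> \<Longrightarrow> S \<nu> \<subseteq> W \<nu>"
  shows "(\<mu> \<in> \<Psi> \<and> y \<in> span (S \<mu>)) \<or> y = 0"
proof -
  obtain \<Phi> g where g: "finite \<Phi>" "\<Phi> \<subseteq> \<Psi>" "\<And>\<nu>. g \<nu> \<in> span (S \<nu>)" "y = (\<Sum>\<nu>\<in>\<Phi>. g \<nu>)"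
    using graded_span_sum[OF y(1)] by blast
  define g' where "g' = (\<lambda>\<nu>. (if \<nu> \<in> \<Phi> then g \<nu> else 0) - (if \<nu> = \<mu> then y else 0))"
  have "(\<Sum>\<nu>\<in>insert \<mu> \<Phi>. if \<nu> \<in> \<Phi> then g \<nu> else 0) = (\<Sum>\<nu>\<in>\<Phi>. g \<nu>)"
    using g(1) by (intro sum.mono_neutral_cong_right) auto
  then have "(\<Sum>\<nu>\<in>insert \<mu> \<Phi>. g' \<nu>) = 0"
    using g(1,4) by (simp add: g'_def sum_subtractf sum.delta)
  moreover have "g' \<nu> \<in> W \<nu>" if "\<nu> \<in> insert \<mu> \<Phi>" for \<nu>
  proof -
    have "(if \<nu> \<in> \<Phi> then g \<nu> else 0) \<in> W \<nu>"
      using g(3)[of \<nu>] span_subset_W[OF S] g(2) subspace_W[of \<nu>] by (auto simp: subspace_0)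
    moreover have "(if \<nu> = \<mu> then y else 0) \<in> W \<nu>" using y(2) subspace_W[of \<nu>] by (auto simp: subspace_0)
    ultimately show ?thesis unfolding g'_def using subspace_W by (intro subspace_diff)
  qed
  ultimately have "g' \<mu> = 0"
    using weight_components[of "insert \<mu> \<Phi>" g' "{0}"] g(1,2) \<Psi> y(3) h_stable_zero by auto
  then have "(if \<mu> \<in> \<Phi> then g \<mu> else 0) = y" by (simp add: g'_def)
  then show ?thesis using g(2,3) by (auto split: if_splits)
qed

lemma weight_sum: "\<exists>\<Phi> g. finite \<Phi> \<and> \<Phi> \<subseteq> wts \<and> (\<forall>\<nu>. g \<nu> \<in> W \<nu>) \<and> m = (\<Sum>\<nu>\<in>\<Phi>. g \<nu>)"
proof -
  have "m \<in> span (\<Union>\<mu>\<in>wts. W \<mu>)" using W_spanning by simp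
  note sum = graded_span_sum[OF this]
  have "span (W \<nu>) = W \<nu>" for \<nu> by (rule span_eq_iff[THEN iffD2, OF subspace_W])
  then show ?thesis using sum by (simp only:)
qed

lemma weight_vector_exists:
  assumes "subspace N" "h_stable N" "N \<noteq> {0}"
  shows "\<exists>\<mu>\<in>wts. \<exists>x\<in>W \<mu>. x \<in> N \<and> x \<noteq> 0"
proof -
  obtain y where y: "y \<in> N" "y \<noteq> 0" using assms subspace_0 by blast
  from weight_sum[of y] obtain \<Psi> g where
    g': "finite \<Psi> \<and> \<Psi> \<subseteq> wts \<and> (\<forall>\<nu>. g \<nu> \<in> W \<nu>) \<and> y = (\<Sum>\<nu>\<in>\<Psi>. g \<nu>)" by (elim exE)
  then have g: "finite \<Psi>" "\<Psi> \<subseteq> wts" "\<forall>\<nu>\<in>\<Psi>. g \<nu> \<in> W \<nu>" "(\<Sum>\<nu>\<in>\<Psi>. g \<nu>) \<in> N" using y by auto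
  have gN: "\<forall>\<nu>\<in>\<Psi>. g \<nu> \<in> N" by (rule weight_components[OF g(1-3) assms(1,2) g(4)])
  have "\<exists>\<nu>\<in>\<Psi>. g \<nu> \<noteq> 0"
  proof (rule ccontr)
    assume "\<not> ?thesis"
    then have "y = 0" using g' by simp
    then show False using y by simp
  qed
  then obtain \<nu> where "\<nu> \<in> \<Psi>" "g \<nu> \<noteq> 0" by blast
  then show ?thesis using gN g by blast
qed

section \<open>Coordinates of weights and the sl2-triples of the even roots\<close>

definition crd :: "(smatrix \<Rightarrow> complex) \<Rightarrow> osp_index \<Rightarrow> complex" where
  "crd \<nu> i = \<nu> (hm i)"

lemma act_hm: "ev i \<Longrightarrow> act i (neg i) = \<rho> (hm i)"
  by (simp add: act_def hm_def ev_in_range)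

lemma hm_mem: "ev i \<Longrightarrow> hm i \<in> \<hh>"
  by (simp add: hm_cartan ev_def)

lemma act_hm_weight: "v \<in> W \<nu> \<Longrightarrow> ev i \<Longrightarrow> act i (neg i) v = scale (crd \<nu> i) v"
  using hm_mem[of i] by (auto simp: act_hm W_def crd_def)

text \<open>As \<nu> is an arbitrary function, this relation is forced only by a nonzero vector of
  that weight.\<close>

lemma crd_neg:
  assumes "v \<in> W \<nu>" "v \<noteq> 0" "ev i" shows "crd \<nu> (neg i) = - crd \<nu> i"
proof -
  have "scale (crd \<nu> (neg i)) v = act (neg i) (neg (neg i)) v"
    using act_hm_weight[OF assms(1), of "neg i"] assms(3) by simp
  also have "\<dots> = - act i (neg i) v" using act_swap[of i "neg i" v] assms(3) by simp
  also have "\<dots> = scale (- crd \<nu> i) v" using act_hm_weight[OF assms(1,3)] by simp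
  finally show ?thesis using assms(2) by (simp only: scale_cancel_right) simp
qed

lemma crd_add: "crd (\<mu> + \<nu>) i = crd \<mu> i + crd \<nu> i"
  and crd_diff: "crd (\<mu> - \<nu>) i = crd \<mu> i - crd \<nu> i"
  by (simp_all add: crd_def)

lemma crd_rt: "ev i \<Longrightarrow> crd (rt j) i = of_bool (j = i) - of_bool (j = neg i)"
  using hm_mem[of i] by (simp add: crd_def rt_def hm_diag ev_def)

lemma act_hm_act:
  assumes "ev i"
  shows "act i (neg i) (act u w m) = act u w (act i (neg i) m) + scale (crd (rt u) i + crd (rt w) i) (act u w m)"
  using rho_H_act[OF hm_mem[OF assms], of u w m] hm_mem[OF assms] by (simp add: act_hm[OF assms] crd_def rt_def)

lemma act_bracket_even:
  assumes "ev u" "ev w" "ev x" "ev y"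
  shows "act u w (act x y m) = act x y (act u w m)
    + scale (of_bool (x = neg w)) (act u y m) - scale (of_bool (x = neg u)) (act w y m)
    + scale (of_bool (y = neg w)) (act x u m) - scale (of_bool (y = neg u)) (act x w m)"
  using act_bracket[OF assms(1,3) ev_in_range[OF assms(2)] ev_in_range[OF assms(4)], of m] assms
  by (simp add: osp_form_even ev_def)

definition sl2_h :: "osp_index \<Rightarrow> osp_index \<Rightarrow> 'm \<Rightarrow> 'm" where
  "sl2_h u c v = act u (neg u) v + act c (neg c) v"

text \<open>The value of the root on \<open>sl2_h u c\<close>. For a short root
  (\<open>c = Eps_zero\<close>) the latter is half the coroot, hence 1 in place of 2.\<close>

definition sl2_scale :: "osp_index \<Rightarrow> complex" where
  "sl2_scale c = (if c = Eps_zero then 1 else 2)"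

lemma neg_fixed: "neg i = i \<longleftrightarrow> i = Eps_zero" "i = neg i \<longleftrightarrow> i = Eps_zero"
  by (cases i; simp)+

lemma sl2_relations:
  assumes "ev u" "ev c" "u \<noteq> Eps_zero" "c \<noteq> u" "c \<noteq> neg u"
  shows "act u c (act (neg c) (neg u) v) = act (neg c) (neg u) (act u c v) + sl2_h u c v"
    and "sl2_h u c (act (neg c) (neg u) v) = act (neg c) (neg u) (sl2_h u c v) - scale (sl2_scale c) (act (neg c) (neg u) v)"
    and "sl2_h u c (act u c v) = act u c (sl2_h u c v) + scale (sl2_scale c) (act u c v)"
proof -
  have ne: "neg u \<noteq> u" "u \<noteq> neg u" "u \<noteq> neg c" "neg u \<noteq> c" "u \<noteq> c"
    using assms by (auto simp: neg_fixed)
  show "act u c (act (neg c) (neg u) v) = act (neg c) (neg u) (act u c v) + sl2_h u c v"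
    using act_bracket_even[of u c "neg c" "neg u" v] act_swap[of c "neg c" v] assms ne
    by (simp add: sl2_h_def)
  have k: "crd (rt (neg c)) u + crd (rt (neg u)) u + (crd (rt (neg c)) c + crd (rt (neg u)) c) = - sl2_scale c"
    "crd (rt u) u + crd (rt c) u + (crd (rt u) c + crd (rt c) c) = sl2_scale c"
    using assms ne by (auto simp: crd_rt sl2_scale_def neg_fixed)
  have "sl2_h u c (act (neg c) (neg u) v) = act (neg c) (neg u) (sl2_h u c v)
     + scale (crd (rt (neg c)) u + crd (rt (neg u)) u + (crd (rt (neg c)) c + crd (rt (neg u)) c)) (act (neg c) (neg u) v)"
    unfolding sl2_h_def act_hm_act[OF assms(1)] act_hm_act[OF assms(2)] by (simp add: act_rules scale_left_distrib)
  then show "sl2_h u c (act (neg c) (neg u) v) = act (neg c) (neg u) (sl2_h u c v) - scale (sl2_scale c) (act (neg c) (neg u) v)"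
    unfolding k by simp
  have "sl2_h u c (act u c v) = act u c (sl2_h u c v)
     + scale (crd (rt u) u + crd (rt c) u + (crd (rt u) c + crd (rt c) c)) (act u c v)"
    unfolding sl2_h_def act_hm_act[OF assms(1)] act_hm_act[OF assms(2)] by (simp add: act_rules scale_left_distrib)
  then show "sl2_h u c (act u c v) = act u c (sl2_h u c v) + scale (sl2_scale c) (act u c v)"
    unfolding k .
qed

lemma root_nilpotent:
  assumes "ev u" "ev c" "u \<noteq> Eps_zero" "c \<noteq> neg u"
  shows "\<exists>s. \<forall>v. (act u c ^^ s) v = 0" "\<exists>s. \<forall>v. (act (neg c) (neg u) ^^ s) v = 0"
proof -
  have z: "u \<noteq> neg u" using assms(3) by (simp add: neg_fixed)
  show "\<exists>s. \<forall>v. (act u c ^^ s) v = 0"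
    using assms z by (intro act_nilpotent) (auto simp: ev_def osp_form_even)
  have "\<exists>s. \<forall>v. (act (neg u) (neg c) ^^ s) v = 0"
    using assms z by (intro act_nilpotent) (auto simp: ev_def osp_form_even)
  then obtain s where s: "\<And>v. (act (neg u) (neg c) ^^ s) v = 0" by blast
  have "(act (neg c) (neg u) ^^ k) v = scale ((- 1) ^ k) ((act (neg u) (neg c) ^^ k) v)" for k v
    by (induction k) (use act_swap[of "neg u" "neg c"] assms in \<open>auto simp: act_rules\<close>)
  then show "\<exists>s. \<forall>v. (act (neg c) (neg u) ^^ s) v = 0" using s by (intro exI[of _ s]) simp
qed

text \<open>One nilpotency exponent holds on the whole module, so a single R serves all
  weights.\<close>

lemma root_weight_bound:
  assumes "ev u" "ev c" "u \<noteq> Eps_zero" "c \<noteq> u" "c \<noteq> neg u"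
  shows "\<exists>R. \<forall>\<nu> v. v \<in> W \<nu> \<longrightarrow> v \<noteq> 0 \<longrightarrow> cmod (crd \<nu> u + crd \<nu> c) \<le> R"
proof -
  obtain s t where st: "\<And>v. (act u c ^^ s) v = 0" "\<And>v. (act (neg c) (neg u) ^^ t) v = 0"
    using root_nilpotent[of u c] assms by blast
  have pow0: "(act i j ^^ n) 0 = 0" for i j n by (induction n) (simp_all add: act_rules)
  have st': "(act u c ^^ (t + s)) v = 0" "(act (neg c) (neg u) ^^ (s + t)) v = 0" for v
    unfolding funpow_add by (simp_all add: st pow0)
  have "cmod (crd \<nu> u + crd \<nu> c) \<le> 2 * cmod (sl2_scale c) * real (s + t)" if "v \<in> W \<nu>" "v \<noteq> 0" for \<nu> v
  proof (rule sl2_weight_bound[where e = "act u c" and f = "act (neg c) (neg u)" and h = "sl2_h u c" and v = v,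
        OF act_linear act_linear])
    show "sl2_h u c v = scale (crd \<nu> u + crd \<nu> c) v"
      using act_hm_weight[OF that(1)] assms by (simp add: sl2_h_def scale_left_distrib)
  qed (use sl2_relations[OF assms] st' that in \<open>auto simp: add.commute\<close>)
  then show ?thesis by blast
qed

lemma crd_zero:
  assumes "v \<in> W \<nu>" "v \<noteq> 0" "ev Eps_zero" shows "crd \<nu> Eps_zero = 0"
  using crd_neg[OF assms] by simp

text \<open>The indices of o(2n) or o(2n+1), cut off at a; \<open>Eps_zero\<close> belongs to every
  stage in type B.\<close>

definition idx :: "nat \<Rightarrow> osp_index set" where
  "idx n = {i. ev i \<and> (i = Eps_zero \<or> nr i < n)}"

lemma idx_ev: "i \<in> idx n \<Longrightarrow> ev i"
  by (simp add: idx_def)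

lemma nr_neg [simp]: "nr (neg i) = nr i"
  by (cases i) auto

lemma idx_neg [simp]: "neg i \<in> idx n \<longleftrightarrow> i \<in> idx n"
  by (cases i) (auto simp: idx_def ev_def)

lemma idx_cases:
  assumes "i \<in> idx n"
  obtains (pos) k where "i = Eps k" "k < n" | (neg) k where "i = Eps_neg k" "k < n" | (zero) "i = Eps_zero"
  using assms by (cases i) (auto simp: idx_def ev_def)

lemma finite_idx [simp]: "finite (idx n)"
  by (rule finite_subset[of _ "Eps ` {..<n} \<union> Eps_neg ` {..<n} \<union> {Eps_zero}"]) (auto elim!: idx_cases)

lemma idx_mono: "m \<le> n \<Longrightarrow> idx m \<subseteq> idx n"
  by (auto simp: idx_def)

definition fs :: "(smatrix \<Rightarrow> complex) set \<Rightarrow> 'm set" where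
  "fs \<Phi> = span (\<Union>\<nu>\<in>\<Phi>. W \<nu>)"

text \<open>Submodules over the algebra spanned by the wedges on \<open>idx n\<close>. The whole
  Cartan subalgebra is larger than the part it contains, hence the separate notion
  \<open>h_stable\<close>.\<close>

definition stable :: "nat \<Rightarrow> 'm set \<Rightarrow> bool" where
  "stable n N \<longleftrightarrow> subspace N \<and> (\<forall>i\<in>idx n. \<forall>j\<in>idx n. \<forall>v\<in>N. act i j v \<in> N)"

lemma stableD: "stable n N \<Longrightarrow> i \<in> idx n \<Longrightarrow> j \<in> idx n \<Longrightarrow> v \<in> N \<Longrightarrow> act i j v \<in> N"
  by (simp add: stable_def)

lemma stable_spanI:
  assumes "\<And>i j v. i \<in> idx n \<Longrightarrow> j \<in> idx n \<Longrightarrow> v \<in> S \<Longrightarrow> act i j v \<in> span S"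
  shows "stable n (span S)"
  unfolding stable_def
proof (intro conjI ballI subspace_span)
  fix i j v assume "i \<in> idx n" "j \<in> idx n" "v \<in> span S"
  show "act i j v \<in> span S" using \<open>v \<in> span S\<close>
    by (induction rule: span_induct_alt)
      (auto simp: act_rules span_zero intro!: span_add span_scale assms \<open>i \<in> idx n\<close> \<open>j \<in> idx n\<close>)
qed

lemma h_stable_spanI:
  assumes "\<And>v. v \<in> S \<Longrightarrow> \<exists>\<mu>. v \<in> W \<mu>"
  shows "h_stable (span S)"
  unfolding h_stable_def
proof (intro ballI)
  fix H v assume H: "H \<in> \<hh>" and "v \<in> span S"
  show "\<rho> H v \<in> span S" using \<open>v \<in> span S\<close>
  proof (induction rule: span_induct_alt)
    case base
    then show ?case by (simp add: linear_rules[OF rho_H_linear[OF H]] span_zero)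
  next
    case (step c b y)
    then obtain \<mu> where "b \<in> W \<mu>" using assms by blast
    then have "\<rho> H b \<in> span S" using H step(1) by (auto simp: W_def intro: span_scale span_base)
    then show ?case using step(2) by (auto simp: linear_rules[OF rho_H_linear[OF H]] intro!: span_add span_scale)
  qed
qed

lemma fs_finite_dim: "finite \<Phi> \<Longrightarrow> \<exists>B. finite B \<and> fs \<Phi> \<subseteq> span B"
proof -
  assume fin: "finite \<Phi>"
  obtain B where B: "\<And>\<mu>. finite (B \<mu>) \<and> W \<mu> \<subseteq> span (B \<mu>)" using W_dim by metis
  have "(\<Union>\<nu>\<in>\<Phi>. W \<nu>) \<subseteq> span (\<Union>\<nu>\<in>\<Phi>. B \<nu>)"
  proof
    fix v assume "v \<in> (\<Union>\<nu>\<in>\<Phi>. W \<nu>)"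
    then obtain \<nu> where "\<nu> \<in> \<Phi>" "v \<in> span (B \<nu>)" using B by blast
    then show "v \<in> span (\<Union>\<nu>\<in>\<Phi>. B \<nu>)" using span_mono[of "B \<nu>" "\<Union>\<nu>\<in>\<Phi>. B \<nu>"] by auto
  qed
  then have "fs \<Phi> \<subseteq> span (\<Union>\<nu>\<in>\<Phi>. B \<nu>)" unfolding fs_def by (rule span_minimal) (rule subspace_span)
  then show ?thesis using fin B by (intro exI[of _ "\<Union>\<nu>\<in>\<Phi>. B \<nu>"]) simp
qed

lemma fs_weight:
  assumes "y \<in> fs \<Phi>" "y \<in> W \<mu>" "y \<noteq> 0" "\<mu> \<in> wts" "\<Phi> \<subseteq> wts" shows "\<mu> \<in> \<Phi>"
  using graded_span_weight[where \<Psi> = \<Phi> and S = W and y = y and \<mu> = \<mu>] assms by (auto simp: fs_def)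

text \<open>In type B the short root \<epsilon>_k bounds the coordinate directly. In type D a second
  index is used: 2 \<epsilon>_k is the sum of the roots \<epsilon>_k + \<epsilon>_l and \<epsilon>_k
  - \<epsilon>_l.\<close>

lemma crd_bound:
  assumes "k < n" "enat k < a" and big: "X = Type_B \<or> (\<exists>l<n. l \<noteq> k \<and> enat l < a)"
  shows "\<exists>R. \<forall>\<nu> v. v \<in> W \<nu> \<longrightarrow> v \<noteq> 0 \<longrightarrow> cmod (crd \<nu> (Eps k)) \<le> R"
proof (cases "X = Type_B")
  case True
  then have e: "ev (Eps k)" "ev Eps_zero" unfolding ev_def using assms by simp_all
  obtain R where "\<And>\<nu> v. v \<in> W \<nu> \<Longrightarrow> v \<noteq> 0 \<Longrightarrow> cmod (crd \<nu> (Eps k) + crd \<nu> Eps_zero) \<le> R"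
    using root_weight_bound[OF e] by auto
  then show ?thesis using crd_zero[OF _ _ e(2)] by (intro exI[of _ R]) fastforce
next
  case False
  then obtain l where l: "l < n" "l \<noteq> k" "enat l < a" using big by blast
  have e: "ev (Eps k)" "ev (Eps l)" "ev (Eps_neg l)" using assms l by (auto simp: ev_def)
  obtain R where R: "\<And>\<nu> v. v \<in> W \<nu> \<Longrightarrow> v \<noteq> 0 \<Longrightarrow> cmod (crd \<nu> (Eps k) + crd \<nu> (Eps l)) \<le> R"
    using root_weight_bound[OF e(1,2)] l by auto
  obtain R' where R': "\<And>\<nu> v. v \<in> W \<nu> \<Longrightarrow> v \<noteq> 0 \<Longrightarrow> cmod (crd \<nu> (Eps k) + crd \<nu> (Eps_neg l)) \<le> R'"
    using root_weight_bound[OF e(1,3)] l by auto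
  have "cmod (crd \<nu> (Eps k)) \<le> (R + R') / 2" if v: "v \<in> W \<nu>" "v \<noteq> 0" for \<nu> v
  proof -
    have "crd \<nu> (Eps_neg l) = - crd \<nu> (Eps l)" using crd_neg[OF v e(2)] by simp
    then have "2 * crd \<nu> (Eps k) = (crd \<nu> (Eps k) + crd \<nu> (Eps l)) + (crd \<nu> (Eps k) + crd \<nu> (Eps_neg l))"
      by simp
    then have "cmod (2 * crd \<nu> (Eps k)) \<le> R + R'"
      using norm_triangle_mono[OF R[OF v] R'[OF v]] by simp
    then show ?thesis by (simp add: norm_mult)
  qed
  then show ?thesis by blast
qed

text \<open>Root vectors on \<open>idx n\<close> move \<mu> within a coset of a lattice of finite
  rank, and the coordinate bounds leave finitely many weights there. Only for o(2) is the coordinate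
  unbounded, but then the weight space is itself stable.\<close>

lemma locally_finite:
  assumes v: "v \<in> W \<mu>" and \<mu>: "\<mu> \<in> wts"
  shows "\<exists>\<Phi>. finite \<Phi> \<and> \<Phi> \<subseteq> wts \<and> \<mu> \<in> \<Phi> \<and> stable n (fs \<Phi>)"
proof (cases "\<forall>k<n. enat k < a \<longrightarrow> X = Type_B \<or> (\<exists>l<n. l \<noteq> k \<and> enat l < a)")
  case True
  define A where "A = {k. k < n \<and> enat k < a}"
  have finA: "finite A" by (simp add: A_def)
  define lat where "lat = (\<lambda>z :: nat \<Rightarrow> int. \<mu> + (\<lambda>H. \<Sum>k\<in>A. of_int (z k) * rt (Eps k) H))"
  have lat_wts: "lat z \<in> wts" for z using \<mu> by (auto simp: lat_def wts_def rt_def)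
  have evA: "ev (Eps k)" if "k \<in> A" for k using that by (simp add: A_def ev_def)
  have crd_lat: "crd (lat z) (Eps k) = crd \<mu> (Eps k) + of_int (z k)" if "k \<in> A" for z k
  proof -
    have "crd (lat z) (Eps k) = crd \<mu> (Eps k) + (\<Sum>l\<in>A. of_int (z l) * crd (rt (Eps l)) (Eps k))"
      by (simp add: lat_def crd_def)
    also have "(\<Sum>l\<in>A. of_int (z l) * crd (rt (Eps l)) (Eps k)) = (\<Sum>l\<in>A. if l = k then of_int (z k) else (0 :: complex))"
      by (rule sum.cong) (auto simp: crd_rt[OF evA[OF that]])
    finally show ?thesis using that finA by simp
  qed
  have lat_upd: "lat z + (if s then rt (Eps k) else rt (Eps_neg k)) = lat (z(k := z k + (if s then 1 else - 1)))"
    if "k \<in> A" for z k s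
  proof
    fix H
    have "(\<Sum>l\<in>A. of_int ((z(k := z k + (if s then 1 else - 1))) l) * rt (Eps l) H)
      = (\<Sum>l\<in>A. of_int (z l) * rt (Eps l) H + (if l = k then (if s then 1 else - 1) * rt (Eps k) H else 0))"
      by (rule sum.cong) (auto simp: algebra_simps)
    also have "\<dots> = (\<Sum>l\<in>A. of_int (z l) * rt (Eps l) H) + (if s then 1 else - 1) * rt (Eps k) H"
      using finA that by (simp add: sum.distrib)
    finally show "(lat z + (if s then rt (Eps k) else rt (Eps_neg k))) H = lat (z(k := z k + (if s then 1 else - 1))) H"
      using rt_neg[of "Eps k"] by (simp add: lat_def)
  qed
  have lat_step: "\<exists>z'. lat z + rt i = lat z'" if "i \<in> idx n" for z i
    using that
  proof (cases rule: idx_cases)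
    case (pos k)
    then have "k \<in> A" using that by (auto simp: A_def idx_def ev_def)
    then show ?thesis using lat_upd[of k z True] pos by auto
  next
    case (neg k)
    then have "k \<in> A" using that by (auto simp: A_def idx_def ev_def)
    then show ?thesis using lat_upd[of k z False] neg by auto
  next
    case zero
    have "rt Eps_zero = 0"
    proof
      fix H show "rt Eps_zero H = 0 H"
        using fun_cong[OF rt_neg[of Eps_zero], of H] by simp
    qed
    then show ?thesis using zero by auto
  qed
  \<comment> \<open>\<open>\<mu>\<close> is added explicitly because \<open>v\<close> may be zero
    and \<open>W \<mu>\<close> trivial.\<close>
  define \<Phi> where "\<Phi> = insert \<mu> {\<nu>. (\<exists>z. \<nu> = lat z) \<and> W \<nu> \<noteq> {0}}"
  have "\<exists>R. \<forall>k\<in>A. \<forall>\<nu> v. v \<in> W \<nu> \<longrightarrow> v \<noteq> 0 \<longrightarrow> cmod (crd \<nu> (Eps k)) \<le> R k"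
    using crd_bound True by (intro bchoice) (auto simp: A_def)
  then obtain R where R: "\<And>k \<nu> v. k \<in> A \<Longrightarrow> v \<in> W \<nu> \<Longrightarrow> v \<noteq> 0 \<Longrightarrow> cmod (crd \<nu> (Eps k)) \<le> R k"
    by blast
  define K where "K = (\<Sum>k\<in>A. \<lceil>\<bar>R k\<bar> + cmod (crd \<mu> (Eps k))\<rceil>)"
  \<comment> \<open>Coefficients outside \<open>A\<close> do not affect \<open>lat\<close>; setting
    them to zero makes this set finite.\<close>
  define Z where "Z = {z :: nat \<Rightarrow> int. \<forall>k. (k \<in> A \<longrightarrow> z k \<in> {- K..K}) \<and> (k \<notin> A \<longrightarrow> z k = 0)}"
  have finZ: "finite Z" unfolding Z_def by (rule finite_set_of_finite_funs[OF finA]) simp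
  have "\<nu> \<in> lat ` Z" if nu: "\<nu> = lat z" "W \<nu> \<noteq> {0}" for \<nu> z
  proof -
    obtain w where w: "w \<in> W \<nu>" "w \<noteq> 0" using nu(2) subspace_W[of \<nu>] subspace_0 by blast
    define z' where "z' = (\<lambda>k. if k \<in> A then z k else 0)"
    have "lat z = lat z'" by (auto simp: lat_def z'_def fun_eq_iff intro!: sum.cong)
    moreover have "z' \<in> Z"
    proof -
      have "z k \<in> {- K..K}" if k: "k \<in> A" for k
      proof -
        have "cmod (of_int (z k)) = cmod (crd \<nu> (Eps k) - crd \<mu> (Eps k))"
          using crd_lat[OF k] nu(1) by simp
        also have "\<dots> \<le> cmod (crd \<nu> (Eps k)) + cmod (crd \<mu> (Eps k))" by (rule norm_triangle_ineq4)
        also have "\<dots> \<le> \<bar>R k\<bar> + cmod (crd \<mu> (Eps k))" using R[OF k w] by linarith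
        finally have "of_int \<bar>z k\<bar> \<le> \<bar>R k\<bar> + cmod (crd \<mu> (Eps k))" by simp
        then have "\<bar>z k\<bar> \<le> \<lceil>\<bar>R k\<bar> + cmod (crd \<mu> (Eps k))\<rceil>" by linarith
        also have "\<dots> \<le> K"
          unfolding K_def
        proof (rule member_le_sum[OF k _ finA])
          fix l
          have "0 \<le> \<bar>R l\<bar> + cmod (crd \<mu> (Eps l))" by simp
          then show "0 \<le> \<lceil>\<bar>R l\<bar> + cmod (crd \<mu> (Eps l))\<rceil>" by linarith
        qed
        finally show ?thesis by auto
      qed
      then show ?thesis by (auto simp: Z_def z'_def)
    qed
    ultimately show ?thesis using nu(1) by blast
  qed
  then have "\<Phi> \<subseteq> insert \<mu> (lat ` Z)" by (auto simp: \<Phi>_def)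
  then have "finite \<Phi>" using finZ finite_subset by blast
  moreover have "\<Phi> \<subseteq> wts" using \<mu> lat_wts by (auto simp: \<Phi>_def)
  moreover have "stable n (fs \<Phi>)"
    unfolding fs_def
  proof (rule stable_spanI)
    fix i j w assume ij: "i \<in> idx n" "j \<in> idx n" and "w \<in> (\<Union>\<nu>\<in>\<Phi>. W \<nu>)"
    then obtain \<nu> where \<nu>: "\<nu> \<in> \<Phi>" "w \<in> W \<nu>" by blast
    have "lat (\<lambda>_. 0) = \<mu>" by (auto simp: lat_def fun_eq_iff)
    then obtain z where z: "\<nu> = lat z" using \<nu>(1) by (auto simp: \<Phi>_def)
    obtain z' where z': "lat z + rt i = lat z'" using lat_step[OF ij(1)] by blast
    obtain z'' where z'': "lat z' + rt j = lat z''" using lat_step[OF ij(2)] by blast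
    have aw: "act i j w \<in> W (lat z'')"
      using act_W[OF \<nu>(2), of i j] z z' z'' by (simp add: add.assoc[symmetric])
    show "act i j w \<in> span (\<Union>\<nu>\<in>\<Phi>. W \<nu>)"
    proof (cases "act i j w = 0")
      case True then show ?thesis by (simp add: span_zero)
    next
      case False
      then have "lat z'' \<in> \<Phi>" using aw by (auto simp: \<Phi>_def)
      then show ?thesis using aw by (auto intro: span_base)
    qed
  qed
  ultimately show ?thesis by (intro exI[of _ \<Phi>]) (auto simp: \<Phi>_def)
next
  case False
  \<comment> \<open>The case o(2): one index and its negative, with every action zero or by a
    scalar.\<close>
  then obtain k where k: "k < n" "enat k < a" "X \<noteq> Type_B" "\<And>l. l < n \<Longrightarrow> enat l < a \<Longrightarrow> l = k" by blast
  have idx: "i = Eps k \<or> i = Eps_neg k" if "i \<in> idx n" for i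
    using that
  proof (cases rule: idx_cases)
    case (pos l)
    then have "enat l < a" using idx_ev[OF that] by (simp add: ev_def)
    then show ?thesis using k(4)[OF pos(2)] pos(1) by blast
  next
    case (neg l)
    then have "enat l < a" using idx_ev[OF that] by (simp add: ev_def)
    then show ?thesis using k(4)[OF neg(2)] neg(1) by blast
  next
    case zero
    then show ?thesis using idx_ev[OF that] k(3) by (simp add: ev_def)
  qed
  have "stable n (fs {\<mu>})"
    unfolding fs_def
  proof (rule stable_spanI)
    fix i j w assume ij: "i \<in> idx n" "j \<in> idx n" and w: "w \<in> (\<Union>\<nu>\<in>{\<mu>}. W \<nu>)"
    have "i = j \<or> j = neg i" using idx[OF ij(1)] idx[OF ij(2)] by auto
    then have "act i j w = 0 \<or> act i j w = scale (crd \<mu> i) w"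
      using act_self act_hm_weight[of w \<mu> i] w idx_ev[OF ij(1)] by auto
    then show "act i j w \<in> span (\<Union>\<nu>\<in>{\<mu>}. W \<nu>)"
      using span_base[OF w] span_scale span_zero by metis
  qed
  then show ?thesis using \<mu> by (intro exI[of _ "{\<mu>}"]) auto
qed

lemma fs_base: "\<nu> \<in> \<Phi> \<Longrightarrow> w \<in> W \<nu> \<Longrightarrow> w \<in> fs \<Phi>"
  by (auto simp: fs_def intro: span_base)

lemma fs_mono: "\<Phi> \<subseteq> \<Psi> \<Longrightarrow> fs \<Phi> \<subseteq> fs \<Psi>"
  unfolding fs_def by (intro span_mono) blast

lemma subspace_fs: "subspace (fs \<Phi>)"
  by (simp add: fs_def)

lemma locally_finite_vector: "\<exists>\<Phi>. finite \<Phi> \<and> \<Phi> \<subseteq> wts \<and> m \<in> fs \<Phi> \<and> stable n (fs \<Phi>)"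
proof -
  from weight_sum[of m] obtain \<Psi> g where
    g': "finite \<Psi> \<and> \<Psi> \<subseteq> wts \<and> (\<forall>\<nu>. g \<nu> \<in> W \<nu>) \<and> m = (\<Sum>\<nu>\<in>\<Psi>. g \<nu>)"
    by (elim exE)
  then have g: "finite \<Psi>" "\<Psi> \<subseteq> wts" "\<And>\<nu>. g \<nu> \<in> W \<nu>" "m = (\<Sum>\<nu>\<in>\<Psi>. g \<nu>)"
    by simp_all
  have "\<forall>\<nu>\<in>\<Psi>. \<exists>\<Phi>. finite \<Phi> \<and> \<Phi> \<subseteq> wts \<and> \<nu> \<in> \<Phi> \<and> stable n (fs \<Phi>)"
    using locally_finite[OF g(3)] g(2) by blast
  then obtain \<Phi> where \<Phi>: "\<And>\<nu>. \<nu> \<in> \<Psi> \<Longrightarrow> finite (\<Phi> \<nu>) \<and> \<Phi> \<nu> \<subseteq> wts \<and> \<nu> \<in> \<Phi> \<nu> \<and> stable n (fs (\<Phi> \<nu>))"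
    by metis
  let ?\<Phi> = "\<Union>\<nu>\<in>\<Psi>. \<Phi> \<nu>"
  have "m \<in> fs ?\<Phi>" unfolding g(4)
    using g(3) \<Phi> by (intro subspace_sum[OF subspace_fs] fs_base) auto
  moreover have "stable n (fs ?\<Phi>)"
    unfolding fs_def
  proof (rule stable_spanI)
    fix i j w assume ij: "i \<in> idx n" "j \<in> idx n" and "w \<in> (\<Union>\<nu>\<in>?\<Phi>. W \<nu>)"
    then obtain \<nu> \<kappa> where "\<nu> \<in> \<Psi>" "\<kappa> \<in> \<Phi> \<nu>" "w \<in> W \<kappa>" by blast
    moreover from this have "w \<in> fs (\<Phi> \<nu>)" by (intro fs_base)
    ultimately have "act i j w \<in> fs (\<Phi> \<nu>)" using \<Phi>[of \<nu>] ij stableD by blast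
    then show "act i j w \<in> span (\<Union>\<nu>\<in>?\<Phi>. W \<nu>)"
      using fs_mono[of "\<Phi> \<nu>" ?\<Phi>] \<open>\<nu> \<in> \<Psi>\<close> by (auto simp: fs_def)
  qed
  ultimately show ?thesis using \<Phi> g(1) by (intro exI[of _ ?\<Phi>]) auto
qed

text \<open>A matrix of finite support already belongs to one of the finite stages; \<open>n\<close>
  depends on \<open>A\<close> only.\<close>

lemma orth_stable:
  assumes A: "A \<in> osp_orth X a b"
  shows "\<exists>n. \<forall>N. stable n N \<longrightarrow> (\<forall>v\<in>N. \<rho> A v \<in> N)"
proof -
  let ?T = "{(p, q). A p q \<noteq> 0}"
  have osp: "A \<in> osp X a b 0" and even: "\<And>p q. A p q \<noteq> 0 \<Longrightarrow> parity p = 0 \<and> parity q = 0"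
    using A by (auto simp: osp_orth_def)
  have fin: "finite ?T" using osp by (simp add: osp_def)
  have evT: "ev p \<and> ev q" if "A p q \<noteq> 0" for p q
    using osp even[OF that] that by (auto simp: osp_def ev_def)
  obtain n where n: "\<And>t. t \<in> ?T \<Longrightarrow> nr (fst t) < n \<and> nr (snd t) < n"
  proof
    fix t assume "t \<in> ?T"
    then have "nr (fst t) + nr (snd t) \<le> (\<Sum>t\<in>?T. nr (fst t) + nr (snd t))"
      using fin by (intro member_le_sum) auto
    then show "nr (fst t) < Suc (\<Sum>t\<in>?T. nr (fst t) + nr (snd t)) \<and> nr (snd t) < Suc (\<Sum>t\<in>?T. nr (fst t) + nr (snd t))"
      by auto
  qed
  have "\<rho> A v \<in> N" if N: "stable n N" and v: "v \<in> N" for N v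
  proof -
    define B where "B = (\<lambda>t. wedge (fst t) (neg (snd t)))"
    define c where "c = (\<lambda>t. A (fst t) (snd t) / 2)"
    have A_eq: "A = (\<lambda>r s. \<Sum>t\<in>?T. c t * B t r s)"
      using orth_decompose[OF A] by (simp add: c_def B_def case_prod_beta)
    have B_mem: "B t \<in> \<gg>" if "t \<in> ?T" for t
      using evT[of "fst t" "snd t"] that unfolding B_def by (intro wedge_total) (auto intro: ev_in_range)
    have "\<rho> A v = (\<Sum>t\<in>?T. scale (c t) (\<rho> (B t) v))"
      by (subst A_eq) (rule conjunct2[OF rho_sum[OF fin B_mem]])
    also have "\<dots> = (\<Sum>t\<in>?T. scale (c t) (act (fst t) (neg (snd t)) v))"
      by (rule sum.cong) (use evT in \<open>auto simp: B_def act_def ev_in_range\<close>)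
    also have "\<dots> \<in> N"
    proof (rule subspace_sum)
      show "subspace N" using N by (simp add: stable_def)
      fix t assume t: "t \<in> ?T"
      then have "fst t \<in> idx n" "neg (snd t) \<in> idx n" using n[OF t] evT by (auto simp: idx_def)
      then show "scale (c t) (act (fst t) (neg (snd t)) v) \<in> N"
        using N v by (auto simp: stable_def intro: subspace_scale)
    qed
    finally show ?thesis .
  qed
  then show ?thesis by blast
qed

theorem orth_integrable: "integrable_module scale \<rho> (osp_orth X a b)"
  unfolding integrable_module_def
proof (intro ballI allI)
  fix A m assume A: "A \<in> osp_orth X a b"
  obtain n where n: "\<And>N v. stable n N \<Longrightarrow> v \<in> N \<Longrightarrow> \<rho> A v \<in> N" using orth_stable[OF A] by blast
  obtain \<Phi> where \<Phi>: "finite \<Phi>" "m \<in> fs \<Phi>" "stable n (fs \<Phi>)" using locally_finite_vector by blast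
  have "(\<rho> A ^^ k) m \<in> fs \<Phi>" for k by (induction k) (auto intro: \<Phi>(2) n[OF \<Phi>(3)])
  then have "span (range (\<lambda>k. (\<rho> A ^^ k) m)) \<subseteq> fs \<Phi>" by (intro span_minimal subspace_fs) auto
  then show "finite_dim scale (span (range (\<lambda>k. (\<rho> A ^^ k) m)))"
    using fs_finite_dim[OF \<Phi>(1)] by (auto simp: finite_dim_def)
qed

end

section \<open>Complete reducibility over finite index sets\<close>

text \<open>Sums of weights are to stay in point-free form.\<close>

declare plus_fun_apply [simp del] zero_fun_apply [simp del] minus_apply [simp del]

text \<open>A regular functional fixing the positive roots. The shift by one separates
  \<open>Eps 0\<close>, \<open>Eps_zero\<close> and \<open>Eps_neg 0\<close>, so that two even
  indices have heights summing to 0 only if they are negatives of each other.\<close>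

fun ht :: "osp_index \<Rightarrow> int" where
  "ht (Eps i) = int i + 1"
| "ht (Eps_neg i) = - (int i + 1)"
| "ht _ = 0"

lemma ht_neg [simp]: "ht (neg i) = - ht i"
  by (cases i) auto

definition nonneg :: "complex \<Rightarrow> bool" where
  "nonneg z \<longleftrightarrow> Im z = 0 \<and> 0 \<le> Re z"

lemma nonneg_add: "nonneg x \<Longrightarrow> nonneg y \<Longrightarrow> nonneg (x + y)"
  by (simp add: nonneg_def)

lemma nonneg_add_zero: "nonneg x \<Longrightarrow> nonneg y \<Longrightarrow> x + y = 0 \<Longrightarrow> x = 0 \<and> y = 0"
  by (auto simp: nonneg_def complex_eq_iff)

lemma (in vector_space) dim_strict_mono:
  assumes "finite B" "U \<subseteq> span B" "subspace V" "V \<subset> U"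
  shows "dim V < dim U"
proof -
  obtain C where C: "C \<subseteq> V" "independent C" "V \<subseteq> span C" "card C = dim V"
    using basis_exists by metis
  obtain E where E: "E \<subseteq> U" "independent E" "U \<subseteq> span E" "card E = dim U"
    using basis_exists by metis
  have "E \<subseteq> span B" using E(1) assms(2) by (rule subset_trans)
  then have E_fin: "finite E" using independent_span_bound[OF assms(1) E(2)] by simp
  obtain x where x: "x \<in> U" "x \<notin> V" using assms(4) by blast
  have "span C \<subseteq> V" using C(1) assms(3) by (rule span_minimal)
  then have xC: "x \<notin> span C" using x by blast
  then have "independent (insert x C)" using C(2) by (simp add: independent_insert)
  moreover have "insert x C \<subseteq> span E" using x(1) C(1) assms(4) E(3) by blast
  ultimately have "finite (insert x C) \<and> card (insert x C) \<le> card E"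
    by (rule independent_span_bound[OF E_fin])
  then have fin: "finite (insert x C)" and le: "card (insert x C) \<le> card E" by simp_all
  have "x \<notin> C" using xC span_base by blast
  then have "card (insert x C) = Suc (card C)" using fin by simp
  then show ?thesis using le C(4) E(4) by simp
qed

section \<open>Positive roots and the Casimir operator\<close>

context osp_module
begin

definition roots :: "nat \<Rightarrow> (osp_index \<times> osp_index) set" where
  "roots n = {(i, j). i \<in> idx n \<and> j \<in> idx n \<and> i \<noteq> j \<and> ht i + ht j > 0}"

lemma ht_inj: "i \<in> idx n \<Longrightarrow> j \<in> idx n \<Longrightarrow> ht i = ht j \<Longrightarrow> i = j"
  by (auto elim!: idx_cases)

text \<open>For odd \<open>x\<close> and odd coordinates this is twice the usual bilinear form,
  since the sum contains both \<open>k\<close> and \<open>neg k\<close>.\<close>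

definition pair :: "nat \<Rightarrow> (osp_index \<Rightarrow> complex) \<Rightarrow> (smatrix \<Rightarrow> complex) \<Rightarrow> complex" where
  "pair n x \<nu> = (\<Sum>k\<in>idx n. x k * crd \<nu> k)"

definition odd_on :: "nat \<Rightarrow> (osp_index \<Rightarrow> complex) \<Rightarrow> bool" where
  "odd_on n x \<longleftrightarrow> (\<forall>i\<in>idx n. x (neg i) = - x i)"

lemma pair_add: "pair n x (\<mu> + \<nu>) = pair n x \<mu> + pair n x \<nu>"
  and pair_diff: "pair n x (\<mu> - \<nu>) = pair n x \<mu> - pair n x \<nu>"
  by (simp_all add: pair_def crd_add crd_diff algebra_simps sum.distrib sum_subtractf)

lemma crd_0: "crd 0 i = 0"
  by (simp add: crd_def zero_fun_apply)

lemma pair_zero: "pair n x 0 = 0"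
  by (simp add: pair_def crd_0)

lemma pair_rt:
  assumes "odd_on n x" "i \<in> idx n" shows "pair n x (rt i) = 2 * x i"
proof -
  have "pair n x (rt i) = (\<Sum>k\<in>idx n. (if k = i then x i else 0) - (if k = neg i then x (neg i) else 0))"
    unfolding pair_def by (rule sum.cong) (auto simp: crd_rt idx_ev)
  also have "\<dots> = x i - x (neg i)" using assms(2) by (simp add: sum_subtractf)
  finally show ?thesis using assms by (simp add: odd_on_def)
qed

definition root_sum :: "(osp_index \<times> osp_index) list \<Rightarrow> smatrix \<Rightarrow> complex" where
  "root_sum rs = sum_list (map (\<lambda>(i, j). rt i + rt j) rs)"

lemma root_sum_simps: "root_sum [] = 0" "root_sum ((i, j) # rs) = root_sum rs + (rt i + rt j)"
  by (simp_all add: root_sum_def add.commute)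

definition posq :: "nat \<Rightarrow> (smatrix \<Rightarrow> complex) \<Rightarrow> bool" where
  "posq n \<beta> \<longleftrightarrow> (\<exists>rs. set rs \<subseteq> roots n \<and> \<beta> = root_sum rs)"

lemma posq_0: "posq n 0"
  unfolding posq_def by (intro exI[of _ "[]"]) (simp add: root_sum_simps)

lemma posq_step: "posq n \<beta> \<Longrightarrow> (i, j) \<in> roots n \<Longrightarrow> posq n (\<beta> + (rt i + rt j))"
proof -
  assume *: "posq n \<beta>" "(i, j) \<in> roots n"
  then obtain rs where "set rs \<subseteq> roots n" "\<beta> = root_sum rs" by (auto simp: posq_def)
  then show ?thesis
    unfolding posq_def using *(2) by (intro exI[of _ "(i, j) # rs"]) (simp add: root_sum_simps)
qed

lemma posq_induct [consumes 1, case_names posq_zero posq_root]: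
  assumes "posq n \<beta>" and "P 0"
    and step: "\<And>\<beta> i j. posq n \<beta> \<Longrightarrow> (i, j) \<in> roots n \<Longrightarrow> P \<beta> \<Longrightarrow> P (\<beta> + (rt i + rt j))"
  shows "P \<beta>"
proof -
  have "P (root_sum rs)" if "set rs \<subseteq> roots n" for rs
    using that
  proof (induction rs)
    case Nil
    then show ?case using assms(2) by (simp add: root_sum_simps)
  next
    case (Cons r rs)
    obtain i j where ij: "r = (i, j)" by force
    have "posq n (root_sum rs)" using Cons.prems by (auto simp: posq_def)
    then show ?case using step[of "root_sum rs" i j] Cons by (simp add: ij root_sum_simps)
  qed
  then show ?thesis using assms(1) by (auto simp: posq_def)
qed

lemma posq_pair:
  assumes "posq n \<beta>" "odd_on n x" "\<And>i j. (i, j) \<in> roots n \<Longrightarrow> nonneg (x i + x j)"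
  shows "nonneg (pair n x \<beta>)"
  using assms(1)
proof (induction rule: posq_induct)
  case posq_zero
  show ?case by (simp add: pair_zero nonneg_def)
next
  case (posq_root \<beta> i j)
  have "pair n x (rt i + rt j) = 2 * (x i + x j)"
    using posq_root.hyps(2) by (simp add: pair_add pair_rt[OF assms(2)] roots_def)
  then have "nonneg (pair n x (rt i + rt j))" using assms(3)[OF posq_root.hyps(2)] by (simp add: nonneg_def)
  then show ?case using posq_root.IH unfolding pair_add[of n x \<beta>] by (intro nonneg_add)
qed

definition height :: "nat \<Rightarrow> (smatrix \<Rightarrow> complex) \<Rightarrow> real" where
  "height n \<nu> = Re (pair n (\<lambda>i. of_int (ht i)) \<nu>)"

lemma height_odd: "odd_on n (\<lambda>i. of_int (ht i))"
  by (simp add: odd_on_def)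

lemma height_root: "(i, j) \<in> roots n \<Longrightarrow> height n (\<mu> + (rt i + rt j)) > height n \<mu>"
  by (simp add: height_def pair_add pair_rt[OF height_odd] roots_def)

lemma posq_height: "posq n \<beta> \<Longrightarrow> \<beta> = 0 \<or> height n \<beta> > 0"
proof (induction rule: posq_induct)
  case (posq_root \<beta> i j)
  then show ?case using height_root[OF posq_root.hyps(2), of \<beta>]
    by (auto simp: height_def pair_zero)
qed simp

lemma posq_real: "posq n \<beta> \<Longrightarrow> k \<in> idx n \<Longrightarrow> Im (crd \<beta> k) = 0"
proof (induction rule: posq_induct)
  case posq_zero
  then show ?case by (simp add: crd_0)
next
  case (posq_root \<beta> i j)
  then show ?case by (simp add: crd_add crd_rt idx_ev)
qed

lemma posq_single: "(i, j) \<in> roots n \<Longrightarrow> posq n (rt i + rt j)"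
  using posq_step[OF posq_0] by simp

text \<open>Twice the Casimir operator.\<close>

definition cas :: "nat \<Rightarrow> 'm \<Rightarrow> 'm" where
  "cas n v = (\<Sum>i\<in>idx n. \<Sum>j\<in>idx n. act i j (act (neg j) (neg i) v))"

lemma cas_linear: "Vector_Spaces.linear scale scale (cas n)"
  by (rule linearI_rules) (simp_all add: cas_def act_rules sum.distrib scale_sum_right)

lemmas cas_rules = linear_rules[OF cas_linear]

lemma sum_delta_left:
  "c \<in> idx n \<Longrightarrow> (\<Sum>i\<in>idx n. \<Sum>j\<in>idx n. scale (of_bool (i = c)) (f i j)) = (\<Sum>j\<in>idx n. f c j)"
proof -
  assume c: "c \<in> idx n"
  have "(\<Sum>i\<in>idx n. \<Sum>j\<in>idx n. scale (of_bool (i = c)) (f i j))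
      = (\<Sum>i\<in>idx n. if i = c then (\<Sum>j\<in>idx n. f c j) else 0)"
    by (rule sum.cong) auto
  then show ?thesis using c by simp
qed

lemma sum_delta_right:
  assumes c: "c \<in> idx n"
  shows "(\<Sum>i\<in>idx n. \<Sum>j\<in>idx n. scale (of_bool (j = c)) (f i j)) = (\<Sum>i\<in>idx n. f i c)"
proof -
  have "(\<Sum>j\<in>idx n. scale (of_bool (j = c)) (f i j)) = (\<Sum>j\<in>idx n. if j = c then f i c else 0)" for i
    by (rule sum.cong) auto
  then show ?thesis using c by simp
qed

text \<open>Invariance of the form: the brackets with the left factors cancel those with the right
  factors in the double sum.\<close>

lemma cas_comm:
  assumes x: "x \<in> idx n" and y: "y \<in> idx n"
  shows "act x y (cas n v) = cas n (act x y v)"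
proof -
  note e = idx_ev[OF x] idx_ev[OF y]
  \<comment> \<open>\<open>T\<close> collects the brackets with the left factor, \<open>U\<close>
    those with the right one.\<close>
  define T where "T = (\<lambda>i j. scale (of_bool (i = neg y)) (act x j (act (neg j) (neg i) v))
    - scale (of_bool (i = neg x)) (act y j (act (neg j) (neg i) v))
    + scale (of_bool (j = neg y)) (act i x (act (neg j) (neg i) v))
    - scale (of_bool (j = neg x)) (act i y (act (neg j) (neg i) v)))"
  define U where "U = (\<lambda>i j. scale (of_bool (j = y)) (act i j (act x (neg i) v))
    - scale (of_bool (j = x)) (act i j (act y (neg i) v))
    + scale (of_bool (i = y)) (act i j (act (neg j) x v))
    - scale (of_bool (i = x)) (act i j (act (neg j) y v)))"
  have step: "act x y (act i j (act (neg j) (neg i) v)) = act i j (act (neg j) (neg i) (act x y v)) + (T i j + U i j)"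
    if "i \<in> idx n" "j \<in> idx n" for i j
  proof -
    have "act x y (act i j (act (neg j) (neg i) v)) = act i j (act x y (act (neg j) (neg i) v)) + T i j"
      using act_bracket_even[OF e idx_ev[OF that(1)] idx_ev[OF that(2)], of "act (neg j) (neg i) v"]
      by (simp add: T_def algebra_simps)
    also have "act x y (act (neg j) (neg i) v) = act (neg j) (neg i) (act x y v)
      + scale (of_bool (j = y)) (act x (neg i) v) - scale (of_bool (j = x)) (act y (neg i) v)
      + scale (of_bool (i = y)) (act (neg j) x v) - scale (of_bool (i = x)) (act (neg j) y v)"
      using act_bracket_even[OF e, of "neg j" "neg i" v] idx_ev[OF that(1)] idx_ev[OF that(2)] by simp
    finally show ?thesis by (simp add: U_def act_rules algebra_simps)
  qed
  have "act x y (cas n v) = (\<Sum>i\<in>idx n. \<Sum>j\<in>idx n. act x y (act i j (act (neg j) (neg i) v)))"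
    by (simp add: cas_def act_rules)
  also have "\<dots> = (\<Sum>i\<in>idx n. \<Sum>j\<in>idx n. act i j (act (neg j) (neg i) (act x y v)) + (T i j + U i j))"
    by (intro sum.cong refl step)
  also have "\<dots> = cas n (act x y v) + ((\<Sum>i\<in>idx n. \<Sum>j\<in>idx n. T i j) + (\<Sum>i\<in>idx n. \<Sum>j\<in>idx n. U i j))"
    by (simp add: sum.distrib cas_def)
  also have "(\<Sum>i\<in>idx n. \<Sum>j\<in>idx n. T i j) = (\<Sum>j\<in>idx n. act x j (act (neg j) y v)) - (\<Sum>j\<in>idx n. act y j (act (neg j) x v))
     + (\<Sum>i\<in>idx n. act i x (act y (neg i) v)) - (\<Sum>i\<in>idx n. act i y (act x (neg i) v))"
    using x y unfolding T_def by (simp only: sum.distrib sum_subtractf sum_delta_left sum_delta_right idx_neg neg_neg)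
  also have "(\<Sum>i\<in>idx n. \<Sum>j\<in>idx n. U i j) = (\<Sum>i\<in>idx n. act i y (act x (neg i) v)) - (\<Sum>i\<in>idx n. act i x (act y (neg i) v))
     + (\<Sum>j\<in>idx n. act y j (act (neg j) x v)) - (\<Sum>j\<in>idx n. act x j (act (neg j) y v))"
    using x y unfolding U_def by (simp only: sum.distrib sum_subtractf sum_delta_left sum_delta_right idx_neg neg_neg)
  finally show ?thesis by simp
qed

lemma cas_W: "v \<in> W \<mu> \<Longrightarrow> cas n v \<in> W \<mu>"
proof -
  assume v: "v \<in> W \<mu>"
  have "act i j (act (neg j) (neg i) v) \<in> W \<mu>" for i j
    using act_W[OF act_W[OF v, of "neg j" "neg i"], of i j] by (simp add: rt_neg algebra_simps)
  then show ?thesis unfolding cas_def by (intro subspace_sum subspace_W)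
qed

lemma cas_stable: "stable n N \<Longrightarrow> v \<in> N \<Longrightarrow> cas n v \<in> N"
  unfolding cas_def by (intro subspace_sum) (auto simp: stable_def)

text \<open>The eigenvalue of \<open>cas\<close> on a highest weight vector: pairs (i, neg i) give
  squares of coordinates, positive roots give the bracket of raising and lowering operator, negative
  ones give 0 because their right factor raises.\<close>

definition casval :: "nat \<Rightarrow> (smatrix \<Rightarrow> complex) \<Rightarrow> complex" where
  "casval n \<nu> = (\<Sum>i\<in>idx n. \<Sum>j\<in>idx n. of_bool (j = neg i \<and> i \<noteq> j) * (crd \<nu> i)\<^sup>2
     + of_bool ((i, j) \<in> roots n) * (crd \<nu> i + crd \<nu> j))"

lemma stable_zero: "stable n {0}"
  by (simp add: stable_def act_rules)

text \<open>Stated modulo \<open>S\<close> so as to cover both true highest weight vectors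
  (\<open>S\<close> = {0}) and vectors that are highest only in a quotient.\<close>

lemma cas_highest:
  assumes S: "stable n S" and x: "x \<in> W \<mu>" and high: "\<And>i j. (i, j) \<in> roots n \<Longrightarrow> act i j x \<in> S"
  shows "cas n x - scale (casval n \<mu>) x \<in> S"
proof -
  have sub: "subspace S" using S by (simp add: stable_def)
  define c where "c = (\<lambda>i j. of_bool (j = neg i \<and> i \<noteq> j) * (crd \<mu> i)\<^sup>2
     + of_bool ((i, j) \<in> roots n) * (crd \<mu> i + crd \<mu> j))"
  have summand: "act i j (act (neg j) (neg i) x) - scale (c i j) x \<in> S" if ij: "i \<in> idx n" "j \<in> idx n" for i j
  proof -
    note e = idx_ev[OF ij(1)] idx_ev[OF ij(2)]
    consider "i = j" | "i \<noteq> j" "j = neg i" | "i \<noteq> j" "j \<noteq> neg i" "ht i + ht j > 0"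
      | "i \<noteq> j" "j \<noteq> neg i" "ht i + ht j < 0"
      using ht_inj[OF ij(2), of "neg i"] ij by fastforce
    then show ?thesis
    proof cases
      case 1
      then show ?thesis using sub by (simp add: act_self c_def roots_def subspace_0)
    next
      case 2
      then have "c i j = (crd \<mu> i)\<^sup>2" by (simp add: c_def roots_def)
      then show ?thesis using 2 act_hm_weight[OF x e(1)] sub
        by (simp add: act_rules power2_eq_square subspace_0)
    next
      case 3
      then have r: "(i, j) \<in> roots n" using ij by (simp add: roots_def)
      have "act (neg j) j x = - scale (crd \<mu> j) x"
        using act_swap[of j "neg j" x] act_hm_weight[OF x e(2)] e by simp
      then have "act i j (act (neg j) (neg i) x) = act (neg j) (neg i) (act i j x) + scale (crd \<mu> i + crd \<mu> j) x"
        using act_bracket_even[OF e, of "neg j" "neg i" x] act_hm_weight[OF x e(1)] e 3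
        by (simp add: scale_left_distrib)
      moreover have "c i j = crd \<mu> i + crd \<mu> j" using 3 r by (simp add: c_def)
      moreover have "act (neg j) (neg i) (act i j x) \<in> S"
        using stableD[OF S, of "neg j" "neg i"] high[OF r] ij by simp
      ultimately show ?thesis by simp
    next
      case 4
      then have "(neg j, neg i) \<in> roots n" "(i, j) \<notin> roots n" using ij by (auto simp: roots_def)
      then have "act i j (act (neg j) (neg i) x) \<in> S" "c i j = 0"
        using high ij 4 by (auto simp: c_def intro: stableD[OF S])
      then show ?thesis by simp
    qed
  qed
  have "casval n \<mu> = (\<Sum>i\<in>idx n. \<Sum>j\<in>idx n. c i j)" by (simp add: casval_def c_def)
  then have "cas n x - scale (casval n \<mu>) x = (\<Sum>i\<in>idx n. \<Sum>j\<in>idx n. act i j (act (neg j) (neg i) x) - scale (c i j) x)"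
    unfolding cas_def by (simp add: sum_subtractf scale_sum_left)
  also have "\<dots> \<in> S" by (intro subspace_sum sub summand)
  finally show ?thesis .
qed

lemma odd_crd:
  assumes "v \<in> W \<nu>" "v \<noteq> 0" shows "odd_on n (crd \<nu>)"
  using crd_neg[OF assms] idx_ev by (auto simp: odd_on_def)

text \<open>The coordinates of \<open>2\<rho>\<close>, the sum of the positive roots; pairs \<open>(i, j)\<close> and \<open>(j, i)\<close> give the same root.\<close>

definition rho_vec :: "nat \<Rightarrow> osp_index \<Rightarrow> complex" where
  "rho_vec n i = of_nat (card {j. (i, j) \<in> roots n}) - of_nat (card {j. (neg i, j) \<in> roots n})"

lemma finite_root_row [simp]: "finite {j. (i, j) \<in> roots n}"
  by (rule finite_subset[of _ "idx n"]) (auto simp: roots_def)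

text \<open>Increasing the height of the first index preserves positivity of the sum; only the
  excluded diagonal pair obstructs an inclusion, so the injection sends \<open>i\<close> to
  \<open>i'\<close>.\<close>

lemma card_root_row_mono:
  assumes "i \<in> idx n" "i' \<in> idx n" "ht i' < ht i"
  shows "card {j. (i', j) \<in> roots n} \<le> card {j. (i, j) \<in> roots n}"
proof (rule card_inj_on_le[where f = "\<lambda>j. if j = i then i' else j"])
  show "inj_on (\<lambda>j. if j = i then i' else j) {j. (i', j) \<in> roots n}"
    by (auto simp: inj_on_def roots_def)
  show "(\<lambda>j. if j = i then i' else j) ` {j. (i', j) \<in> roots n} \<subseteq> {j. (i, j) \<in> roots n}"
    using assms by (auto simp: roots_def)
qed simp

text \<open>Positivity of the root means that \<open>neg j\<close> lies below \<open>i\<close> and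
  \<open>neg i\<close> below \<open>j\<close> in height, so the counts can be compared row by
  row.\<close>

lemma rho_vec_dominant:
  assumes "(i, j) \<in> roots n" shows "nonneg (rho_vec n i + rho_vec n j)"
proof -
  have "card {k. (neg j, k) \<in> roots n} \<le> card {k. (i, k) \<in> roots n}"
    "card {k. (neg i, k) \<in> roots n} \<le> card {k. (j, k) \<in> roots n}"
    by (rule card_root_row_mono; use assms in \<open>simp add: roots_def\<close>)+
  then show ?thesis by (simp add: nonneg_def rho_vec_def)
qed

lemma rho_vec_odd: "odd_on n (rho_vec n)"
  by (simp add: odd_on_def rho_vec_def)

lemma roots_sym: "(i, j) \<in> roots n \<longleftrightarrow> (j, i) \<in> roots n"
  by (auto simp: roots_def)

text \<open>By symmetry of \<open>roots\<close> both summands contribute the same; replacing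
  \<open>i\<close> by \<open>neg i\<close> in one of the two copies yields the difference in
  \<open>rho_vec\<close>.\<close>

lemma sum_roots_pair:
  assumes "odd_on n y"
  shows "(\<Sum>i\<in>idx n. \<Sum>j\<in>idx n. of_bool ((i, j) \<in> roots n) * (y i + y j)) = (\<Sum>i\<in>idx n. rho_vec n i * y i)"
proof -
  let ?g = "\<lambda>i. of_nat (card {j. (i, j) \<in> roots n}) :: complex"
  have g: "(\<Sum>j\<in>idx n. of_bool ((i, j) \<in> roots n)) = ?g i" for i
  proof -
    have "idx n \<inter> {j. (i, j) \<in> roots n} = {j. (i, j) \<in> roots n}" by (auto simp: roots_def)
    then show ?thesis by (simp add: of_bool_def sum.If_cases)
  qed
  have 1: "(\<Sum>i\<in>idx n. \<Sum>j\<in>idx n. of_bool ((i, j) \<in> roots n) * y i) = (\<Sum>i\<in>idx n. ?g i * y i)"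
    by (simp add: g sum_distrib_right[symmetric])
  have 2: "(\<Sum>i\<in>idx n. \<Sum>j\<in>idx n. of_bool ((i, j) \<in> roots n) * y j) = (\<Sum>i\<in>idx n. ?g i * y i)"
    by (subst sum.swap, subst roots_sym) (rule 1)
  have 3: "(\<Sum>i\<in>idx n. ?g i * y i) = - (\<Sum>i\<in>idx n. ?g (neg i) * y i)"
  proof -
    have "(\<Sum>i\<in>idx n. ?g i * y i) = (\<Sum>i\<in>idx n. ?g (neg i) * y (neg i))"
      by (rule sum.reindex_bij_witness[of _ neg neg]) auto
    also have "\<dots> = (\<Sum>i\<in>idx n. - (?g (neg i) * y i))"
      by (rule sum.cong) (use assms in \<open>auto simp: odd_on_def\<close>)
    finally show ?thesis by (simp add: sum_negf)
  qed
  have "(\<Sum>i\<in>idx n. \<Sum>j\<in>idx n. of_bool ((i, j) \<in> roots n) * (y i + y j))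
      = (\<Sum>i\<in>idx n. ?g i * y i) + (\<Sum>i\<in>idx n. ?g i * y i)"
    by (simp only: distrib_left sum.distrib 1 2)
  also have "\<dots> = (\<Sum>i\<in>idx n. ?g i * y i) - (\<Sum>i\<in>idx n. ?g (neg i) * y i)" using 3 by simp
  also have "\<dots> = (\<Sum>i\<in>idx n. rho_vec n i * y i)"
    by (simp add: rho_vec_def sum_subtractf left_diff_distrib)
  finally show ?thesis .
qed

text \<open>The familiar (\<nu>, \<nu> + 2\<rho>), doubled. \<open>Eps_zero\<close>, the only index
  equal to its negative, has coordinate 0 by oddness, so its square may be included.\<close>

lemma casval_eq:
  assumes "odd_on n (crd \<nu>)"
  shows "casval n \<nu> = (\<Sum>i\<in>idx n. (crd \<nu> i)\<^sup>2) + (\<Sum>i\<in>idx n. rho_vec n i * crd \<nu> i)"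
proof -
  have "(\<Sum>j\<in>idx n. of_bool (j = neg i \<and> i \<noteq> j) * (crd \<nu> i)\<^sup>2) = (crd \<nu> i)\<^sup>2" if i: "i \<in> idx n" for i
  proof -
    have "crd \<nu> (neg i) = - crd \<nu> i" using assms i by (simp add: odd_on_def)
    then have z: "crd \<nu> i = 0" if "i = Eps_zero" using that by simp
    have "(\<Sum>j\<in>idx n. of_bool (j = neg i \<and> i \<noteq> j) * (crd \<nu> i)\<^sup>2) = (\<Sum>j\<in>idx n. if j = neg i then (crd \<nu> i)\<^sup>2 else 0)"
      by (rule sum.cong) (use z in \<open>auto simp: neg_fixed\<close>)
    then show ?thesis using i by simp
  qed
  then have "(\<Sum>i\<in>idx n. \<Sum>j\<in>idx n. of_bool (j = neg i \<and> i \<noteq> j) * (crd \<nu> i)\<^sup>2) = (\<Sum>i\<in>idx n. (crd \<nu> i)\<^sup>2)"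
    by (rule sum.cong[OF refl])
  then show ?thesis
    unfolding casval_def sum.distrib sum_roots_pair[OF assms] by (rule arg_cong)
qed

text \<open>\<open>|\<mu> + \<beta> + \<rho>|\<^sup>2 - |\<mu> + \<rho>|\<^sup>2\<close> is the sum of the pairings of \<open>\<beta>\<close> with \<open>\<mu> + \<beta>\<close>, \<open>\<mu>\<close> and \<open>2\<rho>\<close>, all
  nonnegative; if they vanish, so does \<open>(\<beta>, \<beta>)\<close>.\<close>

lemma casval_injective:
  assumes \<beta>: "posq n \<beta>" and odd: "odd_on n (crd \<mu>)" "odd_on n (crd (\<mu> + \<beta>))"
    and dom: "\<And>i j. (i, j) \<in> roots n \<Longrightarrow> nonneg (crd \<mu> i + crd \<mu> j)"
      "\<And>i j. (i, j) \<in> roots n \<Longrightarrow> nonneg (crd (\<mu> + \<beta>) i + crd (\<mu> + \<beta>) j)"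
    and eq: "casval n (\<mu> + \<beta>) = casval n \<mu>"
  shows "\<beta> = 0"
proof -
  have "casval n (\<mu> + \<beta>) - casval n \<mu> = pair n (crd (\<mu> + \<beta>)) \<beta> + pair n (crd \<mu>) \<beta> + pair n (rho_vec n) \<beta>"
    unfolding casval_eq[OF odd(1)] casval_eq[OF odd(2)] pair_def sum_subtractf[symmetric] sum.distrib[symmetric]
    by (rule sum.cong) (auto simp: crd_add algebra_simps power2_eq_square)
  then have sum0: "(pair n (crd (\<mu> + \<beta>)) \<beta> + pair n (crd \<mu>) \<beta>) + pair n (rho_vec n) \<beta> = 0"
    using eq by simp
  have nn: "nonneg (pair n (crd (\<mu> + \<beta>)) \<beta>)" "nonneg (pair n (crd \<mu>) \<beta>)" "nonneg (pair n (rho_vec n) \<beta>)"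
    by (rule posq_pair[OF \<beta> odd(2) dom(2)] posq_pair[OF \<beta> odd(1) dom(1)]
        posq_pair[OF \<beta> rho_vec_odd rho_vec_dominant], assumption)+
  have "pair n (crd (\<mu> + \<beta>)) \<beta> + pair n (crd \<mu>) \<beta> = 0"
    using nonneg_add_zero[OF nonneg_add[OF nn(1,2)] nn(3) sum0] by simp
  then have "pair n (crd (\<mu> + \<beta>)) \<beta> = 0" "pair n (crd \<mu>) \<beta> = 0"
    using nonneg_add_zero[OF nn(1,2)] by auto
  then have "pair n (crd \<beta>) \<beta> = 0"
    by (simp add: pair_def crd_add distrib_right sum.distrib)
  then have "Re (\<Sum>k\<in>idx n. crd \<beta> k * crd \<beta> k) = 0" by (simp add: pair_def)
  then have "(\<Sum>k\<in>idx n. (Re (crd \<beta> k))\<^sup>2) = 0"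
    using posq_real[OF \<beta>] by (simp add: power2_eq_square)
  then have "\<forall>k\<in>idx n. Re (crd \<beta> k) = 0" by (simp add: sum_nonneg_eq_0_iff)
  then have "crd \<beta> k = 0" if "k \<in> idx n" for k
    using posq_real[OF \<beta> that] that by (simp add: complex_eq_iff)
  \<comment> \<open>Coordinates on \<open>idx n\<close> do not determine a weight, but a nonempty
    sum of positive roots has positive height.\<close>
  then have "height n \<beta> = 0" by (simp add: height_def pair_def)
  then show ?thesis using posq_height[OF \<beta>] by simp
qed

text \<open>The lowering operator is nilpotent, so \<open>sl2_highest\<close> in the quotient by
  \<open>S\<close> makes the value a nonnegative multiple of 1/2. The index in first position must
  be isotropic, hence the swap for \<open>Eps_zero\<close>.\<close>

lemma highest_dominant:
  assumes S: "stable n S" and x: "x \<in> W \<mu>" "x \<notin> S"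
    and high: "\<And>i j. (i, j) \<in> roots n \<Longrightarrow> act i j x \<in> S"
    and ij: "(i, j) \<in> roots n"
  shows "nonneg (crd \<mu> i + crd \<mu> j)"
proof -
  have sub: "subspace S" using S by (simp add: stable_def)
  have main: "nonneg (crd \<mu> u + crd \<mu> c)"
    if uc: "u \<in> idx n" "c \<in> idx n" "u \<noteq> Eps_zero" "c \<noteq> u" "c \<noteq> neg u" "act u c x \<in> S" for u c
  proof -
    note e = idx_ev[OF uc(1)] idx_ev[OF uc(2)]
    obtain t where t: "\<And>v. (act (neg c) (neg u) ^^ t) v = 0"
      using root_nilpotent(2)[OF e uc(3,5)] by blast
    have "\<exists>k<t. crd \<mu> u + crd \<mu> c = sl2_scale c * of_nat k / 2"
    proof (rule sl2_highest[where e = "act u c" and f = "act (neg c) (neg u)" and h = "sl2_h u c" and v = x,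
          OF act_linear act_linear sub])
      show "sl2_h u c x = scale (crd \<mu> u + crd \<mu> c) x"
        using act_hm_weight[OF x(1)] e by (simp add: sl2_h_def scale_left_distrib)
      show "(act (neg c) (neg u) ^^ t) x \<in> S" using t sub by (simp add: subspace_0)
    qed (use sl2_relations[OF e uc(3-5)] uc stableD[OF S] x in auto)
    then obtain k where k: "crd \<mu> u + crd \<mu> c = sl2_scale c * of_nat k / 2" by blast
    show ?thesis unfolding k by (simp add: nonneg_def sl2_scale_def)
  qed
  have ij': "i \<in> idx n" "j \<in> idx n" "i \<noteq> j" "j \<noteq> neg i" "i \<noteq> neg j" using ij by (auto simp: roots_def)
  show ?thesis
  proof (cases "i = Eps_zero")
    case False
    then show ?thesis using main[of i j] ij' high[OF ij] by auto
  next
    case True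
    have "act j i x \<in> S" using high[of j i] ij roots_sym by blast
    then have "nonneg (crd \<mu> j + crd \<mu> i)" using main[of j i] ij' True by auto
    then show ?thesis by (simp add: add.commute)
  qed
qed

text \<open>The weights in question lie in a finite set, so one of maximal height exists; any
  positive root vector leading outside \<open>S\<close> would exceed it.\<close>

lemma raise:
  assumes "finite \<Phi>" and P: "\<And>\<mu> w. P \<mu> w \<Longrightarrow> \<mu> \<in> \<Phi>" "P \<mu>\<^sub>0 w\<^sub>0"
    and step: "\<And>\<mu> w i j. P \<mu> w \<Longrightarrow> (i, j) \<in> roots n \<Longrightarrow> act i j w \<notin> S \<Longrightarrow> P (\<mu> + (rt i + rt j)) (act i j w)"
  shows "\<exists>\<mu> w. P \<mu> w \<and> (\<forall>(i, j)\<in>roots n. act i j w \<in> S)"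
proof -
  define A where "A = {\<mu>. \<exists>w. P \<mu> w}"
  have A: "finite A" "A \<noteq> {}" using assms(1) P by (auto simp: A_def intro: finite_subset[of _ \<Phi>])
  have "Max (height n ` A) \<in> height n ` A" using A by (intro Max_in) auto
  then obtain \<mu> where "\<mu> \<in> A" "height n \<mu> = Max (height n ` A)" by auto
  then have \<mu>: "\<mu> \<in> A" "\<And>\<nu>. \<nu> \<in> A \<Longrightarrow> height n \<nu> \<le> height n \<mu>" using A(1) by simp_all
  then obtain w where w: "P \<mu> w" by (auto simp: A_def)
  have "act i j w \<in> S" if ij: "(i, j) \<in> roots n" for i j
  proof (rule ccontr)
    assume "act i j w \<notin> S"
    then have "\<mu> + (rt i + rt j) \<in> A" using step[OF w ij] by (auto simp: A_def)
    then show False using \<mu>(2) height_root[OF ij, of \<mu>] by force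
  qed
  then show ?thesis using w by blast
qed

section \<open>Submodules generated by highest weight vectors\<close>

inductive_set gw :: "nat \<Rightarrow> 'm \<Rightarrow> 'm set" for n v where
  gw_base: "v \<in> gw n v"
| gw_act: "w \<in> gw n v \<Longrightarrow> i \<in> idx n \<Longrightarrow> j \<in> idx n \<Longrightarrow> act i j w \<in> gw n v"

definition gen :: "nat \<Rightarrow> 'm \<Rightarrow> 'm set" where
  "gen n v = span (gw n v)"

lemma gen_stable: "stable n (gen n v)"
  unfolding gen_def by (rule stable_spanI) (auto intro: span_base gw_act)

lemma gen_base: "v \<in> gen n v"
  by (simp add: gen_def span_base gw_base)

lemma subspace_gen: "subspace (gen n v)"
  by (simp add: gen_def)

lemma gen_minimal: "stable n N \<Longrightarrow> v \<in> N \<Longrightarrow> gen n v \<subseteq> N"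
  unfolding gen_def
proof (rule span_minimal)
  assume *: "stable n N" "v \<in> N"
  show "gw n v \<subseteq> N"
  proof
    fix w assume "w \<in> gw n v"
    then show "w \<in> N" by induction (auto intro: * stableD[OF *(1)])
  qed
  show "subspace N" using * by (simp add: stable_def)
qed

lemma gw_weight: "w \<in> gw n v \<Longrightarrow> v \<in> W \<mu> \<Longrightarrow> \<exists>\<nu>. w \<in> W \<nu>"
  by (induction rule: gw.induct) (auto dest: act_W)

lemma gen_h_stable: "v \<in> W \<mu> \<Longrightarrow> h_stable (gen n v)"
  unfolding gen_def by (rule h_stable_spanI) (auto dest: gw_weight)

definition highest :: "nat \<Rightarrow> (smatrix \<Rightarrow> complex) \<Rightarrow> 'm \<Rightarrow> bool" where
  "highest n \<omega> v \<longleftrightarrow> \<omega> \<in> wts \<and> v \<in> W \<omega> \<and> v \<noteq> 0 \<and> (\<forall>(i, j)\<in>roots n. act i j v = 0)"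

lemma highest_cas: "highest n \<omega> v \<Longrightarrow> cas n v = scale (casval n \<omega>) v"
  using cas_highest[OF stable_zero, of v \<omega> n] by (auto simp: highest_def)

lemma cas_gw: "w \<in> gw n v \<Longrightarrow> cas n v = scale c v \<Longrightarrow> cas n w = scale c w"
  by (induction rule: gw.induct) (simp_all add: cas_comm[symmetric] act_rules)

lemma cas_gen:
  assumes "cas n v = scale c v" "w \<in> gen n v" shows "cas n w = scale c w"
  using assms(2) unfolding gen_def
  by (induction rule: span_induct_alt)
    (simp_all add: cas_rules cas_gw[OF _ assms(1)] scale_right_distrib mult.commute)

definition lower_word :: "(osp_index \<times> osp_index) list \<Rightarrow> 'm \<Rightarrow> 'm" where
  "lower_word rs v = foldr (\<lambda>(i, j). act (neg j) (neg i)) rs v"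

text \<open>Words in lowering operators. The weight is recorded separately because a word may give
  the zero vector.\<close>

definition nw :: "nat \<Rightarrow> (smatrix \<Rightarrow> complex) \<Rightarrow> 'm \<Rightarrow> (smatrix \<Rightarrow> complex) \<Rightarrow> 'm \<Rightarrow> bool" where
  "nw n \<omega> v \<mu> y \<longleftrightarrow> (\<exists>rs. set rs \<subseteq> roots n \<and> \<mu> = \<omega> - root_sum rs \<and> y = lower_word rs v)"

lemma nw_start: "nw n \<omega> v \<omega> v"
  unfolding nw_def by (intro exI[of _ "[]"]) (simp add: root_sum_simps lower_word_def)

lemma nw_step: "nw n \<omega> v \<mu> y \<Longrightarrow> (i, j) \<in> roots n \<Longrightarrow> nw n \<omega> v (\<mu> - (rt i + rt j)) (act (neg j) (neg i) y)"
proof -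
  assume *: "nw n \<omega> v \<mu> y" "(i, j) \<in> roots n"
  then obtain rs where "set rs \<subseteq> roots n" "\<mu> = \<omega> - root_sum rs" "y = lower_word rs v" by (auto simp: nw_def)
  then show ?thesis
    unfolding nw_def using *(2)
    by (intro exI[of _ "(i, j) # rs"]) (simp add: root_sum_simps lower_word_def algebra_simps)
qed

lemma nw_induct [consumes 1, case_names nw_base nw_act]:
  assumes "nw n \<omega> v \<mu> y" and "P \<omega> v"
    and step: "\<And>\<mu> y i j. nw n \<omega> v \<mu> y \<Longrightarrow> (i, j) \<in> roots n \<Longrightarrow> P \<mu> y \<Longrightarrow> P (\<mu> - (rt i + rt j)) (act (neg j) (neg i) y)"
  shows "P \<mu> y"
proof -
  have "P (\<omega> - root_sum rs) (lower_word rs v)" if "set rs \<subseteq> roots n" for rs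
    using that
  proof (induction rs)
    case Nil
    then show ?case using assms(2) by (simp add: root_sum_simps lower_word_def)
  next
    case (Cons r rs)
    obtain i j where ij: "r = (i, j)" by force
    have "nw n \<omega> v (\<omega> - root_sum rs) (lower_word rs v)" using Cons.prems by (auto simp: nw_def)
    then have "P (\<omega> - root_sum rs - (rt i + rt j)) (act (neg j) (neg i) (lower_word rs v))"
      using step Cons ij by simp
    then show ?case by (simp add: ij root_sum_simps lower_word_def diff_diff_eq)
  qed
  then show ?thesis using assms(1) by (auto simp: nw_def)
qed

lemma nw_weight: "nw n \<omega> v \<mu> y \<Longrightarrow> v \<in> W \<omega> \<Longrightarrow> \<omega> \<in> wts \<Longrightarrow> y \<in> W \<mu> \<and> \<mu> \<in> wts"
proof (induction rule: nw_induct)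
  case (nw_act \<mu> y i j)
  then have "act (neg j) (neg i) y \<in> W (\<mu> - (rt i + rt j))"
    using act_W[of y \<mu> "neg j" "neg i"] by (simp add: rt_neg algebra_simps)
  then show ?case using nw_act by (auto intro!: wts_diff wts_add rt_wts)
qed simp

lemma nw_posq: "nw n \<omega> v \<mu> y \<Longrightarrow> posq n (\<omega> - \<mu>)"
proof (induction rule: nw_induct)
  case nw_base
  show ?case by (simp add: posq_0)
next
  case (nw_act \<mu> y i j)
  have "\<omega> - (\<mu> - (rt i + rt j)) = (\<omega> - \<mu>) + (rt i + rt j)" by (simp add: algebra_simps)
  then show ?case by (rule ssubst) (rule posq_step[OF nw_act.IH nw_act.hyps(2)])
qed

lemma nw_height: "nw n \<omega> v \<mu> y \<Longrightarrow> (\<mu> = \<omega> \<and> y = v) \<or> height n \<mu> < height n \<omega>"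
proof (induction rule: nw_induct)
  case (nw_act \<mu> y i j)
  have "height n (\<mu> - (rt i + rt j)) < height n \<mu>"
    using height_root[OF nw_act.hyps(2), of "\<mu> - (rt i + rt j)"] by simp
  then show ?case using nw_act.IH by auto
qed simp

text \<open>A substitute for the Poincare-Birkhoff-Witt theorem: the span of the lowering words is
  stable under all root vectors.\<close>

lemma gen_highest:
  assumes v: "highest n \<omega> v"
  shows "gen n v \<subseteq> span (\<Union>\<mu>\<in>wts. {y. nw n \<omega> v \<mu> y})" (is "_ \<subseteq> span ?N")
proof -
  have vW: "v \<in> W \<omega>" "\<omega> \<in> wts" using v by (auto simp: highest_def)
  have mem: "y \<in> span ?N" if "nw n \<omega> v \<mu> y" for \<mu> y
    using that nw_weight[OF that vW] by (auto intro: span_base)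
  have lower: "act (neg j) (neg i) y \<in> span ?N" if "(i, j) \<in> roots n" "y \<in> span ?N" for i j y
    using that(2)
  proof (induction rule: span_induct_alt)
    case (step c y z)
    then have "act (neg j) (neg i) y \<in> span ?N" using nw_step[OF _ that(1)] mem by blast
    then show ?case using step by (auto simp: act_rules intro!: span_add span_scale)
  qed (simp add: act_rules span_zero)
  have all: "\<forall>i\<in>idx n. \<forall>j\<in>idx n. act i j y \<in> span ?N" if "nw n \<omega> v \<mu> y" for \<mu> y
    using that
  proof (induction rule: nw_induct)
    case nw_base
    show ?case
    proof (intro ballI)
      fix i j assume ij: "i \<in> idx n" "j \<in> idx n"
      note e = idx_ev[OF ij(1)] idx_ev[OF ij(2)]
      consider "i = j" | "j = neg i" | "(i, j) \<in> roots n" | "(neg j, neg i) \<in> roots n"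
        using ht_inj[OF ij(2), of "neg i"] ij by (fastforce simp: roots_def)
      then show "act i j v \<in> span ?N"
      proof cases
        case 1
        then show ?thesis by (simp add: act_self span_zero)
      next
        case 2
        then show ?thesis using act_hm_weight[OF vW(1) e(1)] mem[OF nw_start] by (simp add: span_scale)
      next
        case 3
        then show ?thesis using v by (auto simp: highest_def span_zero)
      next
        case 4
        then show ?thesis using lower[OF 4 mem[OF nw_start]] by simp
      qed
    qed
  next
    case (nw_act \<mu> y k l)
    have kl: "k \<in> idx n" "l \<in> idx n" using nw_act.hyps by (auto simp: roots_def)
    show ?case
    proof (intro ballI)
      fix i j assume ij: "i \<in> idx n" "j \<in> idx n"
      \<comment> \<open>Every bracket term is a single root vector applied to the shorter word
        \<open>y\<close>, so the induction hypothesis covers it.\<close>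
      have "act i j (act (neg l) (neg k) y) = act (neg l) (neg k) (act i j y)
        + scale (of_bool (neg l = neg j)) (act i (neg k) y) - scale (of_bool (neg l = neg i)) (act j (neg k) y)
        + scale (of_bool (neg k = neg j)) (act (neg l) i y) - scale (of_bool (neg k = neg i)) (act (neg l) j y)"
        using ij kl by (intro act_bracket_even) (auto simp: idx_ev)
      also have "\<dots> \<in> span ?N"
        using nw_act.IH ij kl by (intro span_add span_diff span_scale lower[OF nw_act.hyps(2)]) auto
      finally show "act i j (act (neg l) (neg k) y) \<in> span ?N" .
    qed
  qed
  have "stable n (span ?N)" by (rule stable_spanI) (use all in auto)
  then show ?thesis using mem[OF nw_start] by (rule gen_minimal)
qed

text \<open>\<open>N\<close> contains a highest weight vector \<open>w\<close>, whose weight lies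
  below \<omega> and has the same Casimir value. Dominance then forces the weights to agree, and the
  \<omega>-part of the lowering words is spanned by \<open>v\<close>.\<close>

lemma highest_simple:
  assumes \<Phi>: "finite \<Phi>" "\<Phi> \<subseteq> wts" "stable n (fs \<Phi>)" and v: "highest n \<omega> v" "v \<in> fs \<Phi>"
    and N: "N \<subseteq> gen n v" "stable n N" "h_stable N" "N \<noteq> {0}"
  shows "v \<in> N"
proof -
  have sub: "subspace N" using N by (simp add: stable_def)
  have "gen n v \<subseteq> fs \<Phi>" using \<Phi>(3) v(2) by (rule gen_minimal)
  then have NF: "N \<subseteq> fs \<Phi>" using N(1) by blast
  define P where "P = (\<lambda>\<mu> w. \<mu> \<in> wts \<and> w \<in> W \<mu> \<and> w \<in> N \<and> w \<noteq> 0)"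
  have "\<exists>\<mu> w. P \<mu> w" using weight_vector_exists[OF sub N(3,4)] by (auto simp: P_def)
  then obtain \<mu>0 w0 where P0: "P \<mu>0 w0" by blast
  have "\<exists>\<mu> w. P \<mu> w \<and> (\<forall>(i, j)\<in>roots n. act i j w \<in> {0})"
  proof (rule raise[where \<Phi> = \<Phi> and P = P, OF \<Phi>(1) _ P0])
    show "\<mu> \<in> \<Phi>" if "P \<mu> w" for \<mu> w using that NF \<Phi>(2) fs_weight by (auto simp: P_def)
    show "P (\<mu> + (rt i + rt j)) (act i j w)"
      if "P \<mu> w" "(i, j) \<in> roots n" "act i j w \<notin> {0}" for \<mu> w i j
      using that act_W stableD[OF N(2)] by (auto simp: P_def roots_def intro!: wts_add rt_wts)
  qed
  then obtain \<mu> w where "P \<mu> w" and killed: "\<forall>(i, j)\<in>roots n. act i j w \<in> {0}" by blast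
  then have w: "\<mu> \<in> wts" "w \<in> W \<mu>" "w \<in> N" "w \<noteq> 0" "\<And>i j. (i, j) \<in> roots n \<Longrightarrow> act i j w = 0"
    by (auto simp: P_def)
  then have hw: "highest n \<mu> w" by (auto simp: highest_def)
  have vW: "v \<in> W \<omega>" "\<omega> \<in> wts" "v \<noteq> 0" using v by (auto simp: highest_def)
  have "w \<in> span (\<Union>\<mu>\<in>wts. {y. nw n \<omega> v \<mu> y})" using gen_highest[OF v(1)] w(3) N(1) by blast
  then have wn: "w \<in> span {y. nw n \<omega> v \<mu> y}"
    using graded_span_weight[where \<Psi> = wts and S = "\<lambda>\<mu>. {y. nw n \<omega> v \<mu> y}" and y = w and \<mu> = \<mu>]
      w nw_weight vW by blast
  have "{y. nw n \<omega> v \<mu> y} \<noteq> {}"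
  proof
    assume "{y. nw n \<omega> v \<mu> y} = {}"
    then show False using wn w(4) by simp
  qed
  then have pq: "posq n (\<omega> - \<mu>)" using nw_posq by blast
  have "scale (casval n \<mu>) w = scale (casval n \<omega>) w"
    using highest_cas[OF hw] cas_gen[OF highest_cas[OF v(1)]] w(3) N(1) by auto
  then have eq: "casval n \<omega> = casval n \<mu>" using w(4) by simp
  have "\<omega> - \<mu> = 0"
  proof (rule casval_injective[OF pq, of \<mu>])
    show "odd_on n (crd \<mu>)" using odd_crd w by blast
    show "odd_on n (crd (\<mu> + (\<omega> - \<mu>)))" using odd_crd[OF vW(1,3)] by simp
    show "nonneg (crd \<mu> i + crd \<mu> j)" if "(i, j) \<in> roots n" for i j
      using highest_dominant[OF stable_zero w(2) _ _ that] w by auto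
    show "nonneg (crd (\<mu> + (\<omega> - \<mu>)) i + crd (\<mu> + (\<omega> - \<mu>)) j)" if "(i, j) \<in> roots n" for i j
      using highest_dominant[OF stable_zero vW(1) _ _ that] v(1) by (auto simp: highest_def)
    show "casval n (\<mu> + (\<omega> - \<mu>)) = casval n \<mu>" using eq by simp
  qed
  then have "\<mu> = \<omega>" by simp
  then have "{y. nw n \<omega> v \<mu> y} \<subseteq> {v}" using nw_height by fastforce
  then have "w \<in> span {v}" using wn span_mono by blast
  then obtain k where k: "w = scale k v" by (auto simp: span_singleton)
  then have "k \<noteq> 0" using w(4) by auto
  then have "v = scale (inverse k) w" by (simp add: k)
  then show ?thesis using w(3) sub by (simp add: subspace_scale)
qed

text \<open>The product of the operators \<open>cas n\<close> - c over the list: it annihilates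
  eigenvectors whose eigenvalue occurs in \<open>cs\<close>.\<close>

definition casp :: "nat \<Rightarrow> complex list \<Rightarrow> 'm \<Rightarrow> 'm" where
  "casp n cs y = foldr (\<lambda>c y. cas n y - scale c y) cs y"

lemma casp_simps [simp]: "casp n [] y = y" "casp n (c # cs) y = cas n (casp n cs y) - scale c (casp n cs y)"
  by (simp_all add: casp_def)

lemma casp_eigen: "cas n y = scale c y \<Longrightarrow> casp n cs y = scale (\<Prod>c'\<leftarrow>cs. c - c') y"
  by (induction cs) (simp_all add: cas_rules scale_left_diff_distrib[symmetric] left_diff_distrib[symmetric] mult.commute)

lemma casp_act: "x \<in> idx n \<Longrightarrow> y \<in> idx n \<Longrightarrow> act x y (casp n cs v) = casp n cs (act x y v)"
  by (induction cs) (simp_all add: cas_comm act_rules)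

lemma casp_W: "v \<in> W \<mu> \<Longrightarrow> casp n cs v \<in> W \<mu>"
  by (induction cs) (auto intro: cas_W subspace_diff subspace_scale subspace_W)

lemma casp_stable: "stable n N \<Longrightarrow> v \<in> N \<Longrightarrow> casp n cs v \<in> N"
  by (induction cs) (auto intro!: cas_stable subspace_diff subspace_scale simp: stable_def)

lemma casp_linear: "Vector_Spaces.linear scale scale (casp n cs)"
proof (rule linearI_rules)
  show "casp n cs (v + w) = casp n cs v + casp n cs w" for v w
    by (induction cs) (simp_all add: cas_rules scale_right_distrib)
  show "casp n cs (scale c v) = scale c (casp n cs v)" for c v
    by (induction cs) (simp_all add: cas_rules scale_right_diff_distrib mult.commute)
qed

lemma casp_mod:
  assumes S: "stable n S" and x: "cas n x - scale c x \<in> S"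
  shows "casp n cs x - scale (\<Prod>c'\<leftarrow>cs. c - c') x \<in> S"
proof (induction cs)
  case Nil
  show ?case using S by (simp add: stable_def subspace_0)
next
  case (Cons d cs)
  have sub: "subspace S" using S by (simp add: stable_def)
  define k where "k = (\<Prod>c'\<leftarrow>cs. c - c')"
  define s where "s = casp n cs x - scale k x"
  have s: "s \<in> S" using Cons by (simp add: s_def k_def)
  have cx: "casp n cs x = scale k x + s" by (simp add: s_def)
  have "casp n (d # cs) x - scale (\<Prod>c'\<leftarrow>d # cs. c - c') x
      = scale k (cas n x - scale c x) + (cas n s - scale d s)"
    by (simp add: cx cas_rules k_def[symmetric] algebra_simps)
  also have "\<dots> \<in> S"
    by (rule subspace_add[OF sub subspace_scale[OF sub x]
          subspace_diff[OF sub cas_stable[OF S s] subspace_scale[OF sub s]]])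
  finally show ?case .
qed

text \<open>If a weight vector \<open>x\<close> of maximal weight \<open>\<nu>\<close> outside the sum \<open>S\<close> of the highest
  weight submodules existed, a polynomial in the Casimir operator would turn it into one on which
  the positive root vectors produce only Casimir eigenvectors with the eigenvalue of \<open>\<nu>\<close>, which is
  not attained at higher dominant weights.\<close>

lemma generated_by_highest:
  assumes \<Phi>: "finite \<Phi>" "\<Phi> \<subseteq> wts" "stable n (fs \<Phi>)"
  shows "fs \<Phi> \<subseteq> span {y. \<exists>\<omega> w. highest n \<omega> w \<and> w \<in> fs \<Phi> \<and> y \<in> gw n w}" (is "_ \<subseteq> ?S")
proof (rule ccontr)
  assume "\<not> fs \<Phi> \<subseteq> ?S"
  then have "\<not> (\<Union>\<nu>\<in>\<Phi>. W \<nu>) \<subseteq> ?S"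
    unfolding fs_def by (rule contrapos_nn) (rule span_minimal[OF _ subspace_span])
  then obtain \<nu>0 x0 where x0: "\<nu>0 \<in> \<Phi>" "x0 \<in> W \<nu>0" "x0 \<notin> ?S" by blast
  have S: "stable n ?S" by (rule stable_spanI) (auto intro!: span_base intro: gw_act)
  have sub: "subspace ?S" by simp
  have S0: "0 \<in> ?S" by (rule span_zero)
  define P where "P = (\<lambda>\<nu> x. \<nu> \<in> \<Phi> \<and> x \<in> W \<nu> \<and> x \<notin> ?S)"
  have "\<exists>\<nu> x. P \<nu> x \<and> (\<forall>(i, j)\<in>roots n. act i j x \<in> ?S)"
  proof (rule raise[where \<Phi> = \<Phi> and P = P, OF \<Phi>(1)])
    show "P \<nu>0 x0" using x0 by (simp add: P_def)
    show "P (\<mu> + (rt i + rt j)) (act i j w)" if "P \<mu> w" "(i, j) \<in> roots n" "act i j w \<notin> ?S" for \<mu> w i j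
    proof -
      have w: "\<mu> \<in> \<Phi>" "w \<in> W \<mu>" using that by (auto simp: P_def)
      have aw: "act i j w \<in> W (\<mu> + (rt i + rt j))" using act_W[OF w(2)] .
      have "act i j w \<in> fs \<Phi>" using that(2) stableD[OF \<Phi>(3)] fs_base[OF w] by (auto simp: roots_def)
      moreover have "act i j w \<noteq> 0" using that(3) S0 by metis
      moreover have "\<mu> + (rt i + rt j) \<in> wts" using w(1) \<Phi>(2) by (auto intro!: wts_add rt_wts)
      ultimately have "\<mu> + (rt i + rt j) \<in> \<Phi>" using fs_weight[OF _ aw] \<Phi>(2) by blast
      then show ?thesis using aw that(3) by (simp add: P_def)
    qed
  qed (simp add: P_def)
  then obtain \<nu> x where x: "\<nu> \<in> \<Phi>" "x \<in> W \<nu>" "x \<notin> ?S"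
    and high: "\<And>i j. (i, j) \<in> roots n \<Longrightarrow> act i j x \<in> ?S" unfolding P_def by blast
  define c0 where "c0 = casval n \<nu>"
  \<comment> \<open>All Casimir values of weights in \<Phi> except that of \<nu>; so
    \<open>casp n cs\<close> acts on \<open>x\<close> modulo \<open>?S\<close> by a nonzero
    scalar.\<close>
  obtain cs where cs: "set cs = casval n ` \<Phi> - {c0}"
    using finite_list[of "casval n ` \<Phi> - {c0}"] \<Phi>(1) by auto
  define x' where "x' = casp n cs x"
  define k where "k = (\<Prod>c'\<leftarrow>cs. c0 - c')"
  have k0: "k \<noteq> 0" using cs by (auto simp: k_def prod_list_zero_iff)
  have "cas n x - scale c0 x \<in> ?S" unfolding c0_def by (rule cas_highest[OF S x(2) high])
  then have x'_eq: "x' - scale k x \<in> ?S" unfolding x'_def k_def by (rule casp_mod[OF S])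
  have x'S: "x' \<notin> ?S"
  proof
    assume "x' \<in> ?S"
    from subspace_diff[OF sub this x'_eq] have "x' - (x' - scale k x) \<in> ?S" .
    then have "scale (inverse k) (x' - (x' - scale k x)) \<in> ?S" by (intro subspace_scale sub)
    then show False using k0 x(3) by simp
  qed
  have x'0: "x' \<noteq> 0" using x'S S0 by metis
  have x'W: "x' \<in> W \<nu>" unfolding x'_def by (rule casp_W[OF x(2)])
  have xF: "x \<in> fs \<Phi>" by (rule fs_base[OF x(1,2)])
  have x'F: "x' \<in> fs \<Phi>" unfolding x'_def by (rule casp_stable[OF \<Phi>(3) xF])
  have \<nu>: "\<nu> \<in> wts" using x(1) \<Phi>(2) by blast
  have x0: "x \<noteq> 0" using x(3) S0 by metis
  \<comment> \<open>On \<open>?S\<close> the operator \<open>casp n cs\<close> annihilates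
    generators with another Casimir value, so its image consists of eigenvectors for
    \<open>c0\<close>.\<close>
  have eig_S: "cas n (casp n cs s) = scale c0 (casp n cs s)" if "s \<in> ?S" for s
    using that
  proof (induction rule: span_induct_alt)
    case base
    then show ?case by (simp add: linear_rules[OF casp_linear] cas_rules)
  next
    case (step c y z)
    then obtain \<omega> w where w: "highest n \<omega> w" "w \<in> fs \<Phi>" "y \<in> gw n w" by blast
    have "\<omega> \<in> \<Phi>" using fs_weight[OF w(2)] w(1) \<Phi>(2) by (auto simp: highest_def)
    have y: "cas n y = scale (casval n \<omega>) y" using cas_gw[OF w(3) highest_cas[OF w(1)]] .
    have "cas n (casp n cs y) = scale c0 (casp n cs y)"
    proof (cases "casval n \<omega> = c0")
      case True
      then show ?thesis using y by (simp add: casp_eigen[OF y] cas_rules mult.commute)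
    next
      case False
      then have "casval n \<omega> \<in> set cs" using cs \<open>\<omega> \<in> \<Phi>\<close> by auto
      then have "(\<Prod>c'\<leftarrow>cs. casval n \<omega> - c') = 0" by (auto simp: prod_list_zero_iff)
      then show ?thesis by (simp add: casp_eigen[OF y] cas_rules)
    qed
    then show ?case using step(2)
      by (simp add: linear_rules[OF casp_linear] cas_rules scale_right_distrib mult.commute)
  qed
  have killed: "act i j x' = 0" if ij: "(i, j) \<in> roots n" for i j
  proof (rule ccontr)
    assume nz: "act i j x' \<noteq> 0"
    have ij': "i \<in> idx n" "j \<in> idx n" using ij by (auto simp: roots_def)
    \<comment> \<open>A top vector of this family would be a highest weight vector strictly above
      \<nu> with Casimir value \<open>c0\<close>, against \<open>casval_injective\<close>.\<close>
    define Q where "Q = (\<lambda>\<mu> z. \<mu> \<in> wts \<and> z \<in> W \<mu> \<and> z \<noteq> 0 \<and> z \<in> fs \<Phi> \<and> cas n z = scale c0 z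
      \<and> posq n (\<mu> - \<nu>) \<and> height n \<mu> > height n \<nu>)"
    have "\<exists>\<mu> z. Q \<mu> z \<and> (\<forall>(i, j)\<in>roots n. act i j z \<in> {0})"
    proof (rule raise[where \<Phi> = \<Phi> and P = Q, OF \<Phi>(1)])
      show "\<mu> \<in> \<Phi>" if "Q \<mu> w" for \<mu> w using that fs_weight \<Phi>(2) by (auto simp: Q_def)
      have "cas n (act i j x') = scale c0 (act i j x')"
        using eig_S[OF high[OF ij]] by (simp add: x'_def casp_act ij')
      then show "Q (\<nu> + (rt i + rt j)) (act i j x')"
        using nz act_W[OF x'W] stableD[OF \<Phi>(3) ij' x'F] \<nu> posq_single[OF ij] height_root[OF ij]
        by (auto simp: Q_def intro!: wts_add rt_wts)
      show "Q (\<mu> + (rt k + rt l)) (act k l w)"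
        if "Q \<mu> w" "(k, l) \<in> roots n" "act k l w \<notin> {0}" for \<mu> w k l
      proof -
        have kl: "k \<in> idx n" "l \<in> idx n" using that(2) by (auto simp: roots_def)
        have "posq n ((\<mu> - \<nu>) + (rt k + rt l))" using that by (auto simp: Q_def intro: posq_step)
        then have "posq n (\<mu> + (rt k + rt l) - \<nu>)" by (simp add: algebra_simps)
        then show ?thesis
          using that act_W stableD[OF \<Phi>(3) kl] cas_comm[OF kl, of w] height_root[OF that(2), of \<mu>]
          by (auto simp: Q_def act_rules intro!: wts_add rt_wts)
      qed
    qed
    then obtain \<mu> z where "Q \<mu> z" and "\<forall>(i, j)\<in>roots n. act i j z \<in> {0}" by blast
    then have z: "\<mu> \<in> wts" "z \<in> W \<mu>" "z \<noteq> 0" "cas n z = scale c0 z"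
      "posq n (\<mu> - \<nu>)" "height n \<mu> > height n \<nu>" "\<And>i j. (i, j) \<in> roots n \<Longrightarrow> act i j z = 0"
      by (auto simp: Q_def)
    have "scale (casval n \<mu>) z = scale c0 z" using highest_cas[of n \<mu> z] z by (auto simp: highest_def)
    then have eq: "casval n \<mu> = c0" using z(3) by simp
    have "\<mu> - \<nu> = 0"
    proof (rule casval_injective[OF z(5), of \<nu>])
      show "odd_on n (crd \<nu>)" using odd_crd x(2) x0 by blast
      show "odd_on n (crd (\<nu> + (\<mu> - \<nu>)))" using odd_crd[OF z(2,3)] by simp
      show "nonneg (crd \<nu> i + crd \<nu> j)" if "(i, j) \<in> roots n" for i j
        using highest_dominant[OF S x(2,3) high that] by blast
      show "nonneg (crd (\<nu> + (\<mu> - \<nu>)) i + crd (\<nu> + (\<mu> - \<nu>)) j)" if "(i, j) \<in> roots n" for i j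
        using highest_dominant[OF stable_zero z(2) _ _ that] z by auto
      show "casval n (\<nu> + (\<mu> - \<nu>)) = casval n \<nu>" using eq by (simp add: c0_def)
    qed
    then show False using z(6) by simp
  qed
  have "highest n \<nu> x'" using killed \<nu> x'W x'0 by (auto simp: highest_def)
  then have "x' \<in> ?S" using x'F by (auto intro!: span_base exI[of _ \<nu>] exI[of _ x'] gw_base)
  then show False using x'S by simp
qed

lemma stable_sums:
  assumes "stable n A" "stable n B" shows "stable n {x + y | x y. x \<in> A \<and> y \<in> B}"
  unfolding stable_def
proof (intro conjI ballI)
  show "subspace {x + y | x y. x \<in> A \<and> y \<in> B}"
    using assms by (intro subspace_sums) (auto simp: stable_def)
  fix i j v assume ij: "i \<in> idx n" "j \<in> idx n" and "v \<in> {x + y | x y. x \<in> A \<and> y \<in> B}"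
  then obtain x y where "x \<in> A" "y \<in> B" "v = x + y" by blast
  then have "act i j x \<in> A" "act i j y \<in> B" "act i j v = act i j x + act i j y"
    using stableD[OF assms(1) ij] stableD[OF assms(2) ij] by (simp_all add: act_rules)
  then show "act i j v \<in> {x + y | x y. x \<in> A \<and> y \<in> B}" by blast
qed

lemma h_stable_sums:
  assumes "h_stable A" "h_stable B" shows "h_stable {x + y | x y. x \<in> A \<and> y \<in> B}"
  unfolding h_stable_def
proof (intro ballI)
  fix H v assume H: "H \<in> \<hh>" and "v \<in> {x + y | x y. x \<in> A \<and> y \<in> B}"
  then obtain x y where "x \<in> A" "y \<in> B" "v = x + y" by blast
  then have "\<rho> H x \<in> A" "\<rho> H y \<in> B" "\<rho> H v = \<rho> H x + \<rho> H y"
    using assms H by (simp_all add: h_stable_def linear_rules[OF rho_H_linear[OF H]])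
  then show "\<rho> H v \<in> {x + y | x y. x \<in> A \<and> y \<in> B}" by blast
qed

text \<open>\<open>N2\<close> is chosen of maximal dimension with trivial intersection with
  \<open>N1\<close>. If the sum missed something, it would miss a highest weight vector
  \<open>w\<close>; by simplicity \<open>gen n w\<close> meets the sum only in 0 and could be added
  to \<open>N2\<close>.\<close>

lemma complement:
  assumes \<Phi>: "finite \<Phi>" "\<Phi> \<subseteq> wts" "stable n (fs \<Phi>)"
    and N1: "stable n N1" "h_stable N1" "N1 \<subseteq> fs \<Phi>"
  shows "\<exists>N2. stable n N2 \<and> h_stable N2 \<and> N2 \<subseteq> fs \<Phi> \<and> N1 \<inter> N2 = {0} \<and>
    (\<forall>y\<in>fs \<Phi>. \<exists>y1\<in>N1. \<exists>y2\<in>N2. y = y1 + y2)"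
proof -
  define good where "good = (\<lambda>N2. stable n N2 \<and> h_stable N2 \<and> N2 \<subseteq> fs \<Phi> \<and> N1 \<inter> N2 = {0})"
  obtain B where B: "finite B" "fs \<Phi> \<subseteq> span B" using fs_finite_dim[OF \<Phi>(1)] by blast
  have sub1: "subspace N1" using N1 by (simp add: stable_def)
  have "good {0}" using stable_zero h_stable_zero subspace_0[OF sub1] subspace_0[OF subspace_fs] by (auto simp: good_def)
  moreover have "dim N < Suc (card B)" if "good N" for N
  proof -
    have "N \<subseteq> fs \<Phi>" using that by (simp add: good_def)
    then have "N \<subseteq> span B" using B(2) by (rule subset_trans)
    then show ?thesis using dim_le_card[OF _ B(1)] by (simp add: less_Suc_eq_le)
  qed
  ultimately obtain N2 where N2: "good N2" "\<And>N. good N \<Longrightarrow> dim N \<le> dim N2"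
    using ex_has_greatest_nat[of good "{0}" dim "Suc (card B)"] by (metis less_imp_le)
  have sub2: "subspace N2" and st2: "stable n N2" "h_stable N2" "N2 \<subseteq> fs \<Phi>" and disj: "N1 \<inter> N2 = {0}"
    using N2(1) by (auto simp: good_def stable_def)
  define Q where "Q = {y1 + y2 | y1 y2. y1 \<in> N1 \<and> y2 \<in> N2}"
  have subQ: "subspace Q" unfolding Q_def by (rule subspace_sums[OF sub1 sub2])
  have stQ: "stable n Q" unfolding Q_def by (rule stable_sums[OF N1(1) st2(1)])
  have hQ: "h_stable Q" unfolding Q_def by (rule h_stable_sums[OF N1(2) st2(2)])
  have "fs \<Phi> \<subseteq> Q"
  proof (rule ccontr)
    assume "\<not> fs \<Phi> \<subseteq> Q"
    then have "\<not> span {y. \<exists>\<omega> w. highest n \<omega> w \<and> w \<in> fs \<Phi> \<and> y \<in> gw n w} \<subseteq> Q"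
      by (rule contrapos_nn) (rule subset_trans[OF generated_by_highest[OF \<Phi>]])
    then have "\<not> {y. \<exists>\<omega> w. highest n \<omega> w \<and> w \<in> fs \<Phi> \<and> y \<in> gw n w} \<subseteq> Q"
      by (rule contrapos_nn) (rule span_minimal[OF _ subQ])
    then obtain y \<omega> w where w: "highest n \<omega> w" "w \<in> fs \<Phi>" "y \<in> gw n w" "y \<notin> Q"
      by blast
    have wQ: "w \<notin> Q"
    proof
      assume "w \<in> Q"
      then have "gen n w \<subseteq> Q" by (rule gen_minimal[OF stQ])
      then show False using w(3,4) by (auto simp: gen_def intro: span_base)
    qed
    have wW: "w \<in> W \<omega>" using w by (auto simp: highest_def)
    have gQ: "gen n w \<inter> Q = {0}"
    proof (rule ccontr)
      assume ne: "gen n w \<inter> Q \<noteq> {0}"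
      have "w \<in> gen n w \<inter> Q"
      proof (rule highest_simple[OF \<Phi> w(1,2) _ _ _ ne])
        show "stable n (gen n w \<inter> Q)"
          using gen_stable[of n w] stQ by (auto simp: stable_def subspace_inter)
        show "h_stable (gen n w \<inter> Q)" using gen_h_stable[OF wW, of n] hQ by (auto simp: h_stable_def)
      qed simp
      then show False using wQ by simp
    qed
    define N3 where "N3 = {y + g | y g. y \<in> N2 \<and> g \<in> gen n w}"
    have sub3: "subspace N3" unfolding N3_def by (rule subspace_sums[OF sub2 subspace_gen])
    have "good N3"
      unfolding good_def
    proof (intro conjI)
      show "stable n N3" unfolding N3_def by (rule stable_sums[OF st2(1) gen_stable])
      show "h_stable N3" unfolding N3_def by (rule h_stable_sums[OF st2(2) gen_h_stable[OF wW]])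
      have "gen n w \<subseteq> fs \<Phi>" using \<Phi>(3) w(2) by (rule gen_minimal)
      then show "N3 \<subseteq> fs \<Phi>" using st2(3) subspace_fs by (auto simp: N3_def intro!: subspace_add)
      show "N1 \<inter> N3 = {0}"
      proof
        show "N1 \<inter> N3 \<subseteq> {0}"
        proof
          fix z assume "z \<in> N1 \<inter> N3"
          then obtain y g where yg: "z \<in> N1" "y \<in> N2" "g \<in> gen n w" "z = y + g" by (auto simp: N3_def)
          have "z + (- y) \<in> Q" unfolding Q_def using yg(1,2) sub2 by (blast intro: subspace_neg)
          then have "g \<in> gen n w \<inter> Q" using yg by simp
          then have "g = 0" using gQ by blast
          then show "z \<in> {0}" using yg disj by auto
        qed
        show "{0} \<subseteq> N1 \<inter> N3" using subspace_0[OF sub1] subspace_0[OF sub3] by simp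
      qed
    qed
    then have le: "dim N3 \<le> dim N2" and N3F: "N3 \<subseteq> fs \<Phi>" using N2(2) by (auto simp: good_def)
    have "w \<in> N3" unfolding N3_def using subspace_0[OF sub2] gen_base[of w n] by force
    moreover have "w \<notin> N2" using wQ subspace_0[OF sub1] unfolding Q_def by force
    moreover have "N2 \<subseteq> N3" unfolding N3_def using subspace_0[OF subspace_gen] by force
    ultimately have "N2 \<subset> N3" by blast
    then have "dim N2 < dim N3" using dim_strict_mono[OF B(1) _ sub2] N3F B(2) by blast
    then show False using le by simp
  qed
  then have "\<forall>y\<in>fs \<Phi>. \<exists>y1\<in>N1. \<exists>y2\<in>N2. y = y1 + y2" unfolding Q_def by blast
  then show ?thesis using st2 disj by blast
qed

section \<open>Semisimplicity\<close>


lemma orth_submodule_iff: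
  "submodule scale \<rho> (osp_orth X a b) N \<longleftrightarrow> (\<forall>n. stable n N)"
proof
  assume N: "submodule scale \<rho> (osp_orth X a b) N"
  show "\<forall>n. stable n N"
    unfolding stable_def
  proof (intro allI conjI ballI)
    show "subspace N" using N by (simp add: submodule_def)
    fix n i j v assume "i \<in> idx n" "j \<in> idx n" "v \<in> N"
    then have e: "ev i" "ev j" by (auto simp: idx_ev)
    then have "wedge i j \<in> osp_orth X a b" by (intro wedge_orth) (auto simp: ev_def)
    then have "\<rho> (wedge i j) v \<in> N" using N \<open>v \<in> N\<close> by (simp add: submodule_def)
    then show "act i j v \<in> N" using e by (simp add: act_def ev_in_range)
  qed
next
  assume N: "\<forall>n. stable n N"
  show "submodule scale \<rho> (osp_orth X a b) N"
    unfolding submodule_def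
  proof (intro conjI ballI)
    show "subspace N" using N by (simp add: stable_def)
    fix A v assume "A \<in> osp_orth X a b" "v \<in> N"
    then show "\<rho> A v \<in> N" using orth_stable[of A] N by blast
  qed
qed

section \<open>Submodules over the union of the finite stages\<close>

lemma stable_mono: "m \<le> n \<Longrightarrow> stable n N \<Longrightarrow> stable m N"
  using idx_mono[of m n] unfolding stable_def by blast

lemma gen_mono: "m \<le> n \<Longrightarrow> gen m v \<subseteq> gen n v"
  by (rule gen_minimal[OF stable_mono[OF _ gen_stable] gen_base])

definition gen_all :: "'m \<Rightarrow> 'm set" where
  "gen_all v = (\<Union>n. gen n v)"

lemma gen_all_stable: "stable n (gen_all v)"
proof -
  have "subspace (gen_all v)"
    unfolding subspace_def
  proof (intro conjI ballI allI)
    show "0 \<in> gen_all v" unfolding gen_all_def using subspace_0[OF subspace_gen] by blast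
    fix x y assume "x \<in> gen_all v" "y \<in> gen_all v"
    then obtain m k where "x \<in> gen m v" "y \<in> gen k v" by (auto simp: gen_all_def)
    then have "x \<in> gen (max m k) v" "y \<in> gen (max m k) v"
      using gen_mono[of m "max m k" v] gen_mono[of k "max m k" v] by auto
    then have "x + y \<in> gen (max m k) v" by (rule subspace_add[OF subspace_gen])
    then show "x + y \<in> gen_all v" unfolding gen_all_def by blast
  next
    fix c x assume "x \<in> gen_all v"
    then obtain m where "x \<in> gen m v" by (auto simp: gen_all_def)
    then have "scale c x \<in> gen m v" by (rule subspace_scale[OF subspace_gen])
    then show "scale c x \<in> gen_all v" unfolding gen_all_def by blast
  qed
  moreover have "act i j x \<in> gen_all v" if ij: "i \<in> idx n" "j \<in> idx n" and x: "x \<in> gen_all v" for i j x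
  proof -
    obtain m where "x \<in> gen m v" using x by (auto simp: gen_all_def)
    then have "x \<in> gen (max m n) v" using gen_mono[of m "max m n" v] by auto
    moreover have "i \<in> idx (max m n)" "j \<in> idx (max m n)" using ij idx_mono[of n "max m n"] by auto
    ultimately have "act i j x \<in> gen (max m n) v" by (intro stableD[OF gen_stable])
    then show ?thesis unfolding gen_all_def by blast
  qed
  ultimately show ?thesis by (simp add: stable_def)
qed

lemma gen_all_base: "v \<in> gen_all v"
  unfolding gen_all_def using gen_base by blast

lemma gen_all_minimal: "(\<And>n. stable n N) \<Longrightarrow> v \<in> N \<Longrightarrow> gen_all v \<subseteq> N"
  unfolding gen_all_def using gen_minimal by blast

text \<open>On a submodule generated by a weight vector, a Cartan element differs from an element of the
  orthogonal algebra by a scalar; hence weight components can be separated without leaving the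
  orthogonal algebra.\<close>

lemma cartan_on_gen:
  assumes v: "v \<in> W \<mu>" and H: "H \<in> \<hh>"
  shows "\<exists>c. \<forall>y\<in>gen n v. \<rho> H y = (\<Sum>i\<in>{i\<in>idx n. 0 < ht i}. scale (H i i) (act i (neg i) y)) + scale c y"
proof -
  let ?I = "{i\<in>idx n. 0 < ht i}"
  define c where "c = \<mu> H - (\<Sum>i\<in>?I. H i i * crd \<mu> i)"
  have diag: "(\<Sum>i\<in>?I. H i i * crd (rt p) i) = H p p" if p: "p \<in> idx n" for p
  proof -
    have "(\<Sum>i\<in>?I. H i i * crd (rt p) i)
      = (\<Sum>i\<in>?I. (if i = p then H p p else 0) - (if i = neg p then H (neg p) (neg p) else 0))"
      by (rule sum.cong) (auto simp: crd_rt idx_ev)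
    also have "\<dots> = (if 0 < ht p then H p p else 0) - (if ht p < 0 then H (neg p) (neg p) else 0)"
      using p by (simp add: sum_subtractf)
    also have "\<dots> = H p p"
      using p cartan_neg_diag[OF H, of p] by (cases rule: idx_cases[OF p]) auto
    finally show ?thesis .
  qed
  have gw: "\<rho> H w = (\<Sum>i\<in>?I. scale (H i i) (act i (neg i) w)) + scale c w" if "w \<in> gw n v" for w
    using that
  proof (induction rule: gw.induct)
    case gw_base
    have "(\<Sum>i\<in>?I. scale (H i i) (act i (neg i) v)) = (\<Sum>i\<in>?I. scale (H i i * crd \<mu> i) v)"
      by (rule sum.cong) (auto simp: act_hm_weight[OF v] idx_ev)
    then show ?case using v H by (simp add: W_def c_def scale_left_diff_distrib scale_sum_left)
  next
    case (gw_act w p q)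
    have "(\<Sum>i\<in>?I. scale (H i i) (act i (neg i) (act p q w)))
      = (\<Sum>i\<in>?I. act p q (scale (H i i) (act i (neg i) w))
          + scale (H i i * crd (rt p) i + H i i * crd (rt q) i) (act p q w))"
      by (rule sum.cong) (auto simp: act_hm_act idx_ev act_rules scale_right_distrib scale_left_distrib distrib_left)
    also have "\<dots> = act p q (\<Sum>i\<in>?I. scale (H i i) (act i (neg i) w)) + scale (H p p + H q q) (act p q w)"
      using gw_act.hyps by (simp add: sum.distrib act_rules(6) scale_sum_left[symmetric] diag)
    finally show ?case
      using gw_act.IH by (simp add: rho_H_act[OF H] act_rules algebra_simps)
  qed
  have "\<rho> H y = (\<Sum>i\<in>?I. scale (H i i) (act i (neg i) y)) + scale c y" if "y \<in> gen n v" for y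
    using that unfolding gen_def
  proof (induction rule: span_induct_alt)
    case base
    then show ?case by (simp add: linear_rules[OF rho_H_linear[OF H]] act_rules)
  next
    case (step k w y)
    have "(\<Sum>i\<in>?I. scale (H i i) (act i (neg i) (scale k w + y)))
      = scale k (\<Sum>i\<in>?I. scale (H i i) (act i (neg i) w)) + (\<Sum>i\<in>?I. scale (H i i) (act i (neg i) y))"
      by (simp add: act_rules scale_right_distrib sum.distrib scale_sum_right mult.commute)
    then show ?case using gw[OF step(1)] step(2)
      by (simp add: linear_rules[OF rho_H_linear[OF H]] scale_right_distrib mult.commute)
  qed
  then show ?thesis by blast
qed

lemma h_stable_in_gen_all:
  assumes v: "v \<in> W \<mu>" and N: "\<And>n. stable n N" "N \<subseteq> gen_all v"
  shows "h_stable N"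
  unfolding h_stable_def
proof (intro ballI)
  fix H y assume H: "H \<in> \<hh>" and y: "y \<in> N"
  then obtain n where n: "y \<in> gen n v" using N(2) by (auto simp: gen_all_def)
  obtain c where "\<rho> H y = (\<Sum>i\<in>{i\<in>idx n. 0 < ht i}. scale (H i i) (act i (neg i) y)) + scale c y"
    using cartan_on_gen[OF v H, of n] n by blast
  moreover have sub: "subspace N" using N(1) by (simp add: stable_def)
  moreover have "(\<Sum>i\<in>{i\<in>idx n. 0 < ht i}. scale (H i i) (act i (neg i) y)) \<in> N"
    by (intro subspace_sum[OF sub] subspace_scale[OF sub] stableD[OF N(1) _ _ y]) auto
  ultimately show "\<rho> H y \<in> N" using y by (auto intro: subspace_add subspace_scale)
qed

text \<open>Such \<open>T\<close> stand in for the elements of weight \<open>\<beta>\<close> of the enveloping algebra.\<close>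

definition gop :: "nat \<Rightarrow> (smatrix \<Rightarrow> complex) \<Rightarrow> ('m \<Rightarrow> 'm) \<Rightarrow> bool" where
  "gop n \<beta> T \<longleftrightarrow> Vector_Spaces.linear scale scale T \<and> (\<forall>\<mu>. \<forall>u\<in>W \<mu>. T u \<in> W (\<mu> + \<beta>))
     \<and> (\<forall>u. T u \<in> gen n u) \<and> \<beta> \<in> wts"

lemma wts_0: "0 \<in> wts"
  by (simp add: wts_def zero_fun_apply)

lemma gop_zero: "gop n 0 (\<lambda>_. 0)"
  unfolding gop_def using subspace_0[OF subspace_W] subspace_0[OF subspace_gen]
  by (auto intro: linearI_rules wts_0)

lemma gop_combine:
  assumes "gop n \<beta> S" "gop n \<beta> T" shows "gop n \<beta> (\<lambda>v. scale c (S v) + scale d (T v))"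
proof -
  have lin: "Vector_Spaces.linear scale scale S" "Vector_Spaces.linear scale scale T"
    using assms by (auto simp: gop_def)
  have "Vector_Spaces.linear scale scale (\<lambda>v. scale c (S v) + scale d (T v))"
    by (rule linearI_rules)
      (simp_all add: linear_rules[OF lin(1)] linear_rules[OF lin(2)] scale_right_distrib mult.commute)
  then show ?thesis
    using assms unfolding gop_def
    by (auto intro!: subspace_add[OF subspace_W] subspace_add[OF subspace_gen]
        subspace_scale[OF subspace_W] subspace_scale[OF subspace_gen])
qed

lemma gop_mono: "m \<le> n \<Longrightarrow> gop m \<beta> T \<Longrightarrow> gop n \<beta> T"
  using gen_mono[of m n] unfolding gop_def by blast

lemma gw_gop: "w \<in> gw n v \<Longrightarrow> \<exists>\<beta> T. gop n \<beta> T \<and> w = T v"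
proof (induction rule: gw.induct)
  case gw_base
  have "gop n 0 (\<lambda>v. v)" unfolding gop_def by (auto intro: linearI_rules wts_0 gen_base)
  then show ?case by blast
next
  case (gw_act w i j)
  then obtain \<beta> T where T: "gop n \<beta> T" "w = T v" by blast
  then have lin: "Vector_Spaces.linear scale scale T" by (simp add: gop_def)
  have "gop n (\<beta> + (rt i + rt j)) (\<lambda>v. act i j (T v))"
    unfolding gop_def
  proof (intro conjI allI ballI)
    show "Vector_Spaces.linear scale scale (\<lambda>v. act i j (T v))"
      by (rule linearI_rules) (simp_all add: linear_rules[OF lin] act_rules)
    fix \<mu> u assume "u \<in> W \<mu>"
    then have "T u \<in> W (\<mu> + \<beta>)" using T by (simp add: gop_def)
    then show "act i j (T u) \<in> W (\<mu> + (\<beta> + (rt i + rt j)))"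
      using act_W[of "T u" "\<mu> + \<beta>" i j] by (simp add: add.assoc)
  next
    fix u show "act i j (T u) \<in> gen n u"
      using T(1) gw_act.hyps by (intro stableD[OF gen_stable]) (auto simp: gop_def)
  qed (use T in \<open>auto simp: gop_def intro!: wts_add rt_wts\<close>)
  then show ?case using T(2) by blast
qed

text \<open>Words in root vectors are homogeneous operators applied to \<open>v\<close>; since
  \<open>y\<close> has the weight of \<open>v\<close>, the words of nonzero degree drop out.\<close>

lemma gen_weight_gop:
  assumes v: "v \<in> W \<mu>" "\<mu> \<in> wts" and y: "y \<in> gen n v" "y \<in> W \<mu>"
  shows "\<exists>T. gop n 0 T \<and> y = T v"
proof -
  define S where "S = (\<lambda>\<nu>. {T v | T. gop n (\<nu> - \<mu>) T})"
  have "gw n v \<subseteq> (\<Union>\<nu>\<in>wts. S \<nu>)"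
  proof
    fix w assume "w \<in> gw n v"
    then obtain \<beta> T where T: "gop n \<beta> T" "w = T v" using gw_gop by blast
    have "\<mu> + \<beta> - \<mu> = \<beta>" by simp
    then have "w \<in> S (\<mu> + \<beta>)" using T unfolding S_def by force
    moreover have "\<mu> + \<beta> \<in> wts" using T(1) v(2) by (auto simp: gop_def intro: wts_add)
    ultimately show "w \<in> (\<Union>\<nu>\<in>wts. S \<nu>)" by blast
  qed
  then have "y \<in> span (\<Union>\<nu>\<in>wts. S \<nu>)" using y(1) span_mono unfolding gen_def by blast
  moreover have SW: "S \<nu> \<subseteq> W \<nu>" if "\<nu> \<in> wts" for \<nu>
  proof
    fix w assume "w \<in> S \<nu>"
    then obtain T where "gop n (\<nu> - \<mu>) T" "w = T v" by (auto simp: S_def)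
    then have "w \<in> W (\<mu> + (\<nu> - \<mu>))" using v(1) unfolding gop_def by blast
    then show "w \<in> W \<nu>" by simp
  qed
  ultimately have "y \<in> span (S \<mu>) \<or> y = 0"
    using graded_span_weight[where \<Psi> = wts and S = S and y = y and \<mu> = \<mu>, OF _ y(2) v(2) subset_refl] by blast
  then have "y \<in> span (S \<mu>)" by (auto simp: span_zero)
  then show ?thesis
  proof (induction rule: span_induct_alt)
    case base
    then show ?case using gop_zero by (intro exI[of _ "\<lambda>_. 0"]) auto
  next
    case (step c w z)
    then obtain T T' where "gop n 0 T" "w = T v" "gop n 0 T'" "z = T' v" by (auto simp: S_def)
    then show ?case using gop_combine[of n 0 T T' c 1] by (intro exI[of _ "\<lambda>v. scale c (T v) + scale 1 (T' v)"]) auto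
  qed
qed

text \<open>The restrictions of degree-zero operators to a finite subset of \<open>W \<mu>\<close>
  form an increasing chain of bounded dimension. The induction adds one vector of \<open>B\<close>
  at a time.\<close>

lemma gop_stabilizes:
  assumes "finite B" "B \<subseteq> W \<mu>"
  shows "\<exists>n. \<forall>m T. gop m 0 T \<longrightarrow> (\<exists>T'. gop n 0 T' \<and> (\<forall>b\<in>B. T b = T' b))"
  using assms
proof (induction B rule: finite_induct)
  case empty
  then show ?case using gop_zero by blast
next
  case (insert b B)
  then obtain n0 where n0: "\<And>m T. gop m 0 T \<Longrightarrow> \<exists>T'. gop n0 0 T' \<and> (\<forall>b\<in>B. T b = T' b)" by auto
  have b: "b \<in> W \<mu>" using insert by simp
  \<comment> \<open>The values at the new vector of operators vanishing on the old ones: subspaces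
    of \<open>W \<mu>\<close> increasing with \<open>m\<close>, hence eventually constant.\<close>
  define J where "J = (\<lambda>m. {T b | T. gop m 0 T \<and> (\<forall>b'\<in>B. T b' = 0)})"
  obtain C where C: "finite C" "W \<mu> \<subseteq> span C" using W_dim by blast
  have "J m \<subseteq> W \<mu>" for m
  proof
    fix y assume "y \<in> J m"
    then obtain T where "gop m 0 T" "y = T b" by (auto simp: J_def)
    then have "y \<in> W (\<mu> + 0)" using b unfolding gop_def by blast
    then show "y \<in> W \<mu>" by simp
  qed
  then have JC: "J m \<subseteq> span C" for m using C(2) by blast
  have subJ: "subspace (J m)" for m
    unfolding subspace_def
  proof (intro conjI ballI allI)
    show "0 \<in> J m" unfolding J_def using gop_zero by force
    fix y z assume "y \<in> J m" "z \<in> J m"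
    then obtain T T' where *: "gop m 0 T" "\<forall>b'\<in>B. T b' = 0" "y = T b" "gop m 0 T'" "\<forall>b'\<in>B. T' b' = 0" "z = T' b"
      by (auto simp: J_def)
    then show "y + z \<in> J m" unfolding J_def using gop_combine[OF *(1,4), of 1 1]
      by (intro CollectI exI[of _ "\<lambda>v. scale 1 (T v) + scale 1 (T' v)"]) auto
  next
    fix c y assume "y \<in> J m"
    then obtain T where *: "gop m 0 T" "\<forall>b'\<in>B. T b' = 0" "y = T b" by (auto simp: J_def)
    then show "scale c y \<in> J m" unfolding J_def using gop_combine[OF *(1,1), of c 0]
      by (intro CollectI exI[of _ "\<lambda>v. scale c (T v) + scale 0 (T v)"]) auto
  qed
  have Jmono: "J m \<subseteq> J k" if "m \<le> k" for m k unfolding J_def using gop_mono[OF that] by blast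
  have bound: "dim (J m) < Suc (card C)" for m using dim_le_card[OF JC C(1)] by (simp add: less_Suc_eq_le)
  obtain n1 where n1: "\<And>m. dim (J m) \<le> dim (J n1)"
    using ex_has_greatest_nat[of "\<lambda>_. True" 0 "\<lambda>m. dim (J m)" "Suc (card C)"] bound by (meson less_imp_le)
  define n where "n = max n0 n1"
  have Jn: "J m \<subseteq> J n" for m
  proof (rule ccontr)
    assume "\<not> J m \<subseteq> J n"
    then have "J n \<subset> J (max m n)" using Jmono[of n "max m n"] Jmono[of m "max m n"] by auto
    then have "dim (J n) < dim (J (max m n))" by (rule dim_strict_mono[OF C(1) JC subJ])
    moreover have "dim (J n1) \<le> dim (J n)"
    proof (cases "J n1 = J n")
      case False
      then have "J n1 \<subset> J n" using Jmono[of n1 n] by (auto simp: n_def)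
      then have "dim (J n1) < dim (J n)" by (rule dim_strict_mono[OF C(1) JC subJ])
      then show ?thesis by simp
    qed simp
    ultimately show False using n1[of "max m n"] by simp
  qed
  have "\<exists>T'. gop n 0 T' \<and> (\<forall>b\<in>insert b B. T b = T' b)" if T: "gop m 0 T" for m T
  proof -
    obtain T1 where T1: "gop n0 0 T1" "\<forall>b\<in>B. T b = T1 b" using n0[OF T] by blast
    have T1n: "gop n 0 T1" using gop_mono[OF _ T1(1)] by (simp add: n_def)
    define k where "k = max m n"
    have "gop k 0 T" "gop k 0 T1" using gop_mono[OF _ T, of k] gop_mono[OF _ T1n, of k] by (auto simp: k_def)
    from gop_combine[OF this, of 1 "- 1"] have "scale 1 (T b) + scale (- 1) (T1 b) \<in> J k"
      unfolding J_def using T1(2) by (intro CollectI exI[of _ "\<lambda>v. scale 1 (T v) + scale (- 1) (T1 v)"]) auto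
    then have "T b - T1 b \<in> J n" using Jn[of k] by auto
    then obtain T2 where T2: "gop n 0 T2" "\<forall>b'\<in>B. T2 b' = 0" "T b - T1 b = T2 b" by (auto simp: J_def)
    have "T b = scale 1 (T1 b) + scale 1 (T2 b)" using T2(3) by (simp add: algebra_simps)
    then show ?thesis using gop_combine[OF T1n T2(1), of 1 1] T1(2) T2(2)
      by (intro exI[of _ "\<lambda>v. scale 1 (T1 v) + scale 1 (T2 v)"]) auto
  qed
  then show ?case by blast
qed

text \<open>The stage \<open>n\<close> is the same for all \<open>v\<close> because a linear
  operator on \<open>W \<mu>\<close> is determined by its values on a finite basis.\<close>

lemma gen_all_weight_stabilizes:
  assumes "\<mu> \<in> wts"
  shows "\<exists>n. \<forall>v\<in>W \<mu>. gen_all v \<inter> W \<mu> \<subseteq> gen n v"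
proof -
  obtain C where C: "finite C" "W \<mu> \<subseteq> span C" using W_dim by blast
  obtain B where B: "B \<subseteq> W \<mu>" "independent B" "W \<mu> \<subseteq> span B" using basis_exists by metis
  have "B \<subseteq> span C" using B(1) C(2) by (rule subset_trans)
  then have "finite B" using independent_span_bound[OF C(1) B(2)] by simp
  then obtain n where n: "\<And>m T. gop m 0 T \<Longrightarrow> \<exists>T'. gop n 0 T' \<and> (\<forall>b\<in>B. T b = T' b)"
    using gop_stabilizes[OF _ B(1)] by blast
  have "y \<in> gen n v" if v: "v \<in> W \<mu>" and y: "y \<in> gen_all v" "y \<in> W \<mu>" for v y
  proof -
    obtain m where "y \<in> gen m v" using y(1) by (auto simp: gen_all_def)
    then obtain T where T: "gop m 0 T" "y = T v" using gen_weight_gop[OF v assms _ y(2)] by blast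
    obtain T' where T': "gop n 0 T'" "\<forall>b\<in>B. T b = T' b" using n[OF T(1)] by blast
    have lin: "Vector_Spaces.linear scale scale T" "Vector_Spaces.linear scale scale T'"
      using T T' by (auto simp: gop_def)
    have "T w = T' w" if "w \<in> span B" for w
      using that by (induction rule: span_induct_alt)
        (use T'(2) in \<open>auto simp: linear_rules[OF lin(1)] linear_rules[OF lin(2)]\<close>)
    then have "y = T' v" using T(2) v B(3) by blast
    then show ?thesis using T'(1) by (simp add: gop_def)
  qed
  then show ?thesis by blast
qed

text \<open>A vector of \<open>W \<mu>\<close> outside the socle for which the part of weight \<open>\<mu>\<close> of the generated
  submodule has minimal dimension generates a simple submodule, because submodules split off
  over each \<open>o(2n)\<close> or \<open>o(2n+1)\<close>, and finitely many indices already generate that part.\<close>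

theorem orth_semisimple: "semisimple_module scale \<rho> (osp_orth X a b)"
proof -
  define S where "S = span (\<Union>{N. simple_submodule scale \<rho> (osp_orth X a b) N})"
  have subS: "subspace S" by (simp add: S_def)
  have "W \<mu> \<subseteq> S" if \<mu>: "\<mu> \<in> wts" for \<mu>
  proof (rule ccontr)
    assume "\<not> W \<mu> \<subseteq> S"
    then obtain v0 where v0: "v0 \<in> W \<mu>" "v0 \<notin> S" by blast
    obtain n where n: "\<And>v. v \<in> W \<mu> \<Longrightarrow> gen_all v \<inter> W \<mu> \<subseteq> gen n v"
      using gen_all_weight_stabilizes[OF \<mu>] by blast
    obtain C where C: "finite C" "W \<mu> \<subseteq> span C" using W_dim by blast
    define d where "d = (\<lambda>v. dim (gen n v \<inter> W \<mu>))"
    obtain v where v: "v \<in> W \<mu>" "v \<notin> S" and min: "\<And>w. w \<in> W \<mu> \<Longrightarrow> w \<notin> S \<Longrightarrow> d v \<le> d w"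
      using ex_has_least_nat[of "\<lambda>v. v \<in> W \<mu> \<and> v \<notin> S" v0 d] v0 by blast
    \<comment> \<open>Otherwise \<open>gen n w\<close> would meet \<open>W \<mu>\<close> in a proper
      subspace of what \<open>gen n v\<close> does, against the minimal choice of
      \<open>v\<close>.\<close>
    have regenerate: "v \<in> gen n w" if w: "w \<in> W \<mu>" "w \<notin> S" "w \<in> gen_all v" for w
    proof (rule ccontr)
      assume nv: "v \<notin> gen n w"
      have "w \<in> gen n v" using n[OF v(1)] w by blast
      then have "gen n w \<subseteq> gen n v" by (rule gen_minimal[OF gen_stable])
      then have "gen n w \<inter> W \<mu> \<subset> gen n v \<inter> W \<mu>" using nv gen_base[of v n] v(1) by blast
      moreover have "gen n v \<inter> W \<mu> \<subseteq> span C" using C(2) by blast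
      moreover have "subspace (gen n w \<inter> W \<mu>)" by (intro subspace_inter subspace_gen subspace_W)
      ultimately have "d w < d v" unfolding d_def by (intro dim_strict_mono[OF C(1)])
      then show False using min[OF w(1,2)] by simp
    qed
    have "simple_submodule scale \<rho> (osp_orth X a b) (gen_all v)"
      unfolding simple_submodule_def orth_submodule_iff
    proof (intro conjI allI impI)
      show "stable n (gen_all v)" for n by (rule gen_all_stable)
      show "gen_all v \<noteq> {0}" using gen_all_base[of v] v(2) subspace_0[OF subS] by auto
      fix N assume "(\<forall>n. stable n N) \<and> N \<subseteq> gen_all v"
      then have N: "\<And>n. stable n N" "N \<subseteq> gen_all v" by auto
      have subN: "subspace N" using N(1) by (simp add: stable_def)
      show "N = {0} \<or> N = gen_all v"
      proof (rule disjCI)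
        assume "N \<noteq> gen_all v"
        show "N = {0}"
        proof (rule ccontr)
          assume "N \<noteq> {0}"
          then obtain \<nu> x where x: "\<nu> \<in> wts" "x \<in> W \<nu>" "x \<in> N" "x \<noteq> 0"
            using weight_vector_exists[OF subN h_stable_in_gen_all[OF v(1) N]] by blast
          obtain m0 where m0: "x \<in> gen m0 v" using x(3) N(2) by (auto simp: gen_all_def)
          \<comment> \<open>Large enough both to reach \<open>x\<close> from \<open>v\<close> and
            for \<open>regenerate\<close> to apply.\<close>
          define m where "m = max m0 n"
          have xm: "x \<in> gen m v" using m0 gen_mono[of m0 m v] by (auto simp: m_def)
          obtain \<Phi> where \<Phi>: "finite \<Phi>" "\<Phi> \<subseteq> wts" "\<mu> \<in> \<Phi>" "stable m (fs \<Phi>)"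
            using locally_finite[OF v(1) \<mu>, of m] by blast
          have "gen m v \<subseteq> fs \<Phi>" using fs_base[OF \<Phi>(3) v(1)] by (rule gen_minimal[OF \<Phi>(4)])
          then have "gen m x \<subseteq> fs \<Phi>" using xm by (intro gen_minimal[OF \<Phi>(4)]) blast
          from complement[OF \<Phi>(1,2,4) gen_stable gen_h_stable[OF x(2)] this] obtain N2 where
            "stable m N2 \<and> h_stable N2 \<and> N2 \<subseteq> fs \<Phi> \<and> gen m x \<inter> N2 = {0} \<and>
              (\<forall>y\<in>fs \<Phi>. \<exists>y1\<in>gen m x. \<exists>y2\<in>N2. y = y1 + y2)" by (elim exE)
          then have N2: "stable m N2" "h_stable N2" "gen m x \<inter> N2 = {0}"
            and split: "\<forall>y\<in>fs \<Phi>. \<exists>y1\<in>gen m x. \<exists>y2\<in>N2. y = y1 + y2" by simp_all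
          obtain v1 v2 where v12: "v1 \<in> gen m x" "v2 \<in> N2" "v = v1 + v2"
            using bspec[OF split fs_base[OF \<Phi>(3) v(1)]] by blast
          have sub2: "subspace N2" using N2(1) by (simp add: stable_def)
          \<comment> \<open>Both summands of the direct decomposition are stable under the Cartan
            subalgebra, so the components of the weight vector \<open>v\<close> have weight \<mu>
            too.\<close>
          have "\<rho> H v1 = scale (\<mu> H) v1 \<and> \<rho> H v2 = scale (\<mu> H) v2" if H: "H \<in> \<hh>" for H
          proof -
            have "\<rho> H v1 + \<rho> H v2 = scale (\<mu> H) v1 + scale (\<mu> H) v2"
              using v(1) H by (auto simp: W_def v12(3) linear_rules[OF rho_H_linear] scale_right_distrib)
            then have eq: "\<rho> H v1 - scale (\<mu> H) v1 = scale (\<mu> H) v2 - \<rho> H v2" by (simp add: algebra_simps)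
            have "\<rho> H v1 \<in> gen m x" "\<rho> H v2 \<in> N2"
              using gen_h_stable[OF x(2), of m] N2(2) v12(1,2) H by (auto simp: h_stable_def)
            then have "\<rho> H v1 - scale (\<mu> H) v1 \<in> gen m x" "scale (\<mu> H) v2 - \<rho> H v2 \<in> N2"
              using subspace_diff[OF subspace_gen _ subspace_scale[OF subspace_gen v12(1)]]
                subspace_diff[OF sub2 subspace_scale[OF sub2 v12(2)]] by blast+
            then have "\<rho> H v1 - scale (\<mu> H) v1 \<in> gen m x \<inter> N2" using eq by simp
            then have "\<rho> H v1 - scale (\<mu> H) v1 = 0" unfolding N2(3) by simp
            then show ?thesis using eq by simp
          qed
          then have vW: "v1 \<in> W \<mu>" "v2 \<in> W \<mu>" by (auto simp: W_def)
          have "gen m x \<subseteq> gen m v" using xm by (rule gen_minimal[OF gen_stable])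
          then have v1m: "v1 \<in> gen m v" using v12(1) by blast
          have "v2 = v - v1" using v12(3) by simp
          then have "v2 \<in> gen m v" using subspace_diff[OF subspace_gen gen_base v1m] by simp
          then have all: "v1 \<in> gen_all v" "v2 \<in> gen_all v" using v1m by (auto simp: gen_all_def)
          have nm: "n \<le> m" by (simp add: m_def)
          \<comment> \<open>As \<open>v\<close> lies outside \<open>S\<close>, so does
            \<open>v1\<close> or \<open>v2\<close>, and that component regenerates \<open>v\<close>:
            from \<open>v1\<close> this puts \<open>v\<close> into \<open>N\<close>, from
            \<open>v2\<close> it puts \<open>x\<close> into \<open>N2\<close>.\<close>
          show False
          proof (cases "v1 \<in> S")
            case False
            have "v \<in> gen m v1" using subsetD[OF gen_mono[OF nm] regenerate[OF vW(1) False all(1)]] .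
            moreover have "gen m v1 \<subseteq> gen m x" using v12(1) by (rule gen_minimal[OF gen_stable])
            moreover have "gen m x \<subseteq> N" using x(3) by (rule gen_minimal[OF N(1)])
            ultimately have "v \<in> N" by blast
            then have "gen_all v \<subseteq> N" by (rule gen_all_minimal[OF N(1)])
            then show False using N(2) \<open>N \<noteq> gen_all v\<close> by blast
          next
            case True
            then have "v2 \<notin> S" using v(2) v12(3) subspace_add[OF subS] by auto
            from subsetD[OF gen_mono[OF nm] regenerate[OF vW(2) this all(2)]] have "v \<in> gen m v2" .
            moreover have "gen m v2 \<subseteq> N2" using v12(2) by (rule gen_minimal[OF N2(1)])
            ultimately have "v \<in> N2" by blast
            then have "gen m v \<subseteq> N2" by (rule gen_minimal[OF N2(1)])
            then have "x \<in> gen m x \<inter> N2" using subsetD[OF _ xm] gen_base[of x m] by simp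
            then show False using N2(3) x(4) by simp
          qed
        qed
      qed
    qed
    then have "v \<in> \<Union>{N. simple_submodule scale \<rho> (osp_orth X a b) N}"
      using gen_all_base[of v] by blast
    then have "v \<in> S" unfolding S_def by (rule span_base)
    then show False using v(2) by simp
  qed
  then have "span (\<Union>\<mu>\<in>wts. W \<mu>) \<subseteq> S" by (intro span_minimal subS) blast
  then show ?thesis unfolding semisimple_module_def W_spanning S_def by (rule top.extremum_uniqueI)
qed

end

theorem proposition3p1:
  fixes X :: osp_type
    and a b :: enat
    and scale :: "complex \<Rightarrow> 'm::ab_group_add \<Rightarrow> 'm"
    and M :: "bit \<Rightarrow> 'm set"
    and \<rho> :: "smatrix \<Rightarrow> 'm \<Rightarrow> 'm"
  assumes "a = \<infinity> \<or> b = \<infinity>"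
    and "lie_supermodule scale (osp X a b) M \<rho>"
    and "bounded_weight_module scale M \<rho> (osp_cartan X a b)"
  shows "integrable_module scale \<rho> (osp_orth X a b) \<and>
         semisimple_module scale \<rho> (osp_orth X a b)"
proof -
  interpret osp_module X a b scale M \<rho>
    using assms by (simp add: osp_module_def osp_module_axioms_def)
  show ?thesis using orth_integrable orth_semisimple ..
qed

end
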